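(* Assume that the eigenvalues of $\mathbf Q$ are real and simple. Let $1\le i\le n$ and let $\boldsymbol\psi^{\varepsilon,i}=(\psi^{\varepsilon,i}_x)_{x\in\mathcal S}$ be the right eigenvector of $\mathbf Q^\varepsilon$ associated with $\lambda_i^\varepsilon$ and normalized such that $\max_{1\le j\le n}|\psi^{\varepsilon,i}_{\mathfrak m_j}|=1$. Let $\boldsymbol\psi^{\mathbf Q,i}=(\psi_j^{\mathbf Q,i})_{j=1}^n$ be the right eigenvector of $\mathbf Q$ associated with $\lambda_i^{\mathbf Q}$ and normalized such that $\max_{1\le j\le n}|\psi_j^{\mathbf Q,i}|=1$. Then the following limit holds: $$\max_{x\in\mathcal S}\Big|\psi_x^{\varepsilon,i}-\sum_{j=1}^n\psi_j^{\mathbf Q,i}\,\delta_x^j\Big|\to0,\qquad\varepsilon\to0.$$ In particular, for $i=1$, $\lambda_1^\varepsilon=0$ and $\boldsymbol\psi^{\varepsilon,1}=\mathbf 1$ (the constant vector).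
   Context: Potential. Let $n\ge2$ and let $U\in C^3(\mathbb R,\mathbb R)$ satisfy $|U'(x)|>c|x|^{1+c}$ as $x\to\pm\infty$ for some $c>0$, with exactly $n$ local minima $\mathfrak m_1,\dots,\mathfrak m_n$ and exactly $n-1$ local maxima $\mathfrak s_1,\dots,\mathfrak s_{n-1}$, ordered as $-\infty=\mathfrak s_0<\mathfrak m_1<\mathfrak s_1<\mathfrak m_2<\dots<\mathfrak m_n<\mathfrak s_n=\infty$, all non-degenerate: $U''(\mathfrak m_i)>0$, $U''(\mathfrak s_i)<0$. Put $\mathcal M=\{\mathfrak m_1,\dots,\mathfrak m_n\}$. Noise. Let $\alpha\in(0,2)$ and let $L_1$ be a symmetric $\alpha$-stable random variable with $\mathbb E e^{\mathrm i uL_1}=e^{-c(\alpha)|u|^\alpha}$, $c(\alpha)=\alpha\int_0^\infty\frac{1-\cos y}{y^{1+\alpha}}\,dy$ (so that $\lim_{u\to\infty}u^\alpha\mathbb P(|L_1|\ge u)=1$). The matrix $\mathbf Q$. $\mathbf Q=(q_{i,j})_{i,j=1}^n$ with $q_{i,j}=\frac12\Big|\frac1{|\mathfrak s_{j-1}-\mathfrak m_i|^\alpha}-\frac1{|\mathfrak s_j-\mathfrak m_i|^\alpha}\Big|$ for $i\ne j$ and $q_{i,i}=-\frac12\Big(\frac1{|\mathfrak s_{i-1}-\mathfrak m_i|^\alpha}+\frac1{|\mathfrak s_i-\mathfrak m_i|^\alpha}\Big)$, where $\mathfrak s_0=-\infty$, $\mathfrak s_n=\infty$ and $1/\infty=0$.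 Its eigenvalues are denoted $\lambda_1^{\mathbf Q}=0,\lambda_2^{\mathbf Q},\dots,\lambda_n^{\mathbf Q}$. Discretization (fixed, independent of $\varepsilon$). Fix a range $R>0$, a time step $h>0$ and a mesh parameter $\delta>0$ (for any prescribed $\gamma>0$ they can be chosen with $R^{-1}+h+\delta\le\gamma$) with $-R<\mathfrak m_1$ and $\mathfrak m_n<R$. Fix a finite set $\mathcal S$ with $N=|\mathcal S|$ and a partition $[-R,R)=\bigsqcup_{x\in\mathcal S}I_x$, $I_x=[a_x,b_x)$, such that $\max_x|b_x-a_x|\le\delta/2$, each $I_x$ contains only one point of $\mathcal S$, namely $x\in(a_x,b_x)$, $\mathcal M\subset\mathcal S$, and $\{-R,\mathfrak s_1,\dots,\mathfrak s_{n-1},R\}\subset\{a_x,b_x\}_{x\in\mathcal S}$, and $x-hU'(x)\notin I_x$ for every $x\in\mathcal S\setminus\mathcal M$. For $x\in\mathcal S$ let $y^*(x)=Tx$ be the unique element of $\mathcal S$ with $x-hU'(x)\in I_{y^*(x)}$; thus $Tx\ne x$ for $x\in\mathcal S\setminus\mathcal M$ and $Tx=x$ for $x\in\mathcal M$. Let $\mathcal S_j$ be the set of points of $\mathcal S$ lying between $\mathfrak s_{j-1}$ and $\mathfrak s_j$. For every $x\in\mathcal S$ the sequence $(T^kx)_{k\ge0}$ is monotone, and for $x\in\mathcal S_j$ it reaches $\mathfrak m_j$ in finitely many steps. The indicator vector $\boldsymbol\delta^j=(\delta^j_x)_{x\in\mathcal S}$, $1\le j\le n$, is defined by $\delta^j_x=1$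 for $x\in\mathcal S_j$ and $\delta_x^j=0$ otherwise. Perturbed chain. Let $\tilde y=\min\mathcal S$, $\hat y=\max\mathcal S$. For $\varepsilon>0$ let $\mathbf P^\varepsilon=(p^\varepsilon_{x,y})_{x,y\in\mathcal S}$ be the stochastic matrix $p^\varepsilon_{x,y}=\mathbb P(x-hU'(x)+\varepsilon h^{1/\alpha}L_1\in I_y)$ for $y\ne\tilde y,\hat y$, $p^\varepsilon_{x,\tilde y}=\mathbb P(x-hU'(x)+\varepsilon h^{1/\alpha}L_1\le b_{\tilde y})$, $p^\varepsilon_{x,\hat y}=\mathbb P(x-hU'(x)+\varepsilon h^{1/\alpha}L_1\ge a_{\hat y})$. Set $\mathbf Q^\varepsilon=\frac1{h\varepsilon^\alpha}(\mathbf P^\varepsilon-\mathbf I_N)$, where $\mathbf I_N$ is the identity matrix. Notation $\lambda_i^\varepsilon$: $\lambda_1^\varepsilon=0,\lambda_2^\varepsilon,\dots,\lambda_n^\varepsilon$ are the $n$ eigenvalues of $\mathbf Q^\varepsilon$ with $\lim_{\varepsilon\to0}\lambda_i^\varepsilon=\lambda_i^{\mathbf Q}$; all remaining eigenvalues of $\mathbf Q^\varepsilon$ tend to infinity in modulus as $\varepsilon\to0$.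
   Formalization: It is additionally assumed that x−hU'(x) is never exactly a saddle s_j for x in S (otherwise the eigenvalue limits and the claim fail, as such points split between two wells); eigenvectors, fixed only up to a factor of modulus one, converge after multiplication by such a factor (a sign if real). *)

theory Defs
  imports "HOL-Probability.Probability" "Jordan_Normal_Form.Char_Poly"
begin

section \<open>Matrices over a finite linearly ordered index set\<close>

text \<open>Rows and columns are listed in increasing order of the index. This carries matrices and
  vectors indexed by \<open>{1..n}\<close> or by a finite set of reals over to the matrix library;
  eigenvalues are taken over the complex numbers.\<close>

definition mat_on :: "'i::linorder set \<Rightarrow> ('i \<Rightarrow> 'i \<Rightarrow> real) \<Rightarrow> complex mat" where
  "mat_on I A = Matrix.mat (card I) (card I)
     (\<lambda>(k, l). complex_of_real (A (sorted_list_of_set I ! k) (sorted_list_of_set I ! l)))"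

definition vec_on :: "'i::linorder set \<Rightarrow> ('i \<Rightarrow> complex) \<Rightarrow> complex Matrix.vec" where
  "vec_on I v = Matrix.vec (card I) (\<lambda>k. v (sorted_list_of_set I ! k))"

text \<open>Right eigenvectors of \<open>A\<close> whose entries with index in \<open>J\<close> have maximal modulus one.\<close>

definition normalized_eigvec ::
  "'i::linorder set \<Rightarrow> 'i set \<Rightarrow> ('i \<Rightarrow> 'i \<Rightarrow> real) \<Rightarrow> complex \<Rightarrow> ('i \<Rightarrow> complex) \<Rightarrow> bool" where
  "normalized_eigvec I J A k v \<longleftrightarrow>
     eigenvector (mat_on I A) (vec_on I v) k \<and> Max ((\<lambda>x. cmod (v x)) ` J) = 1"


section \<open>The potential\<close>

definition C3 :: "(real \<Rightarrow> real) \<Rightarrow> bool" where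
  "C3 U \<longleftrightarrow> (\<forall>k<3. \<forall>x. (deriv ^^ k) U field_differentiable at x) \<and>
     continuous_on UNIV ((deriv ^^ 3) U)"

definition local_min_at :: "(real \<Rightarrow> real) \<Rightarrow> real \<Rightarrow> bool" where
  "local_min_at U x \<longleftrightarrow> (\<forall>\<^sub>F y in nhds x. U x \<le> U y)"

definition local_max_at :: "(real \<Rightarrow> real) \<Rightarrow> real \<Rightarrow> bool" where
  "local_max_at U x \<longleftrightarrow> (\<forall>\<^sub>F y in nhds x. U y \<le> U x)"

text \<open>Only \<open>m 1, \<dots>, m n\<close> and \<open>s 1, \<dots>, s (n - 1)\<close> are meaningful; the saddles with index \<open>0\<close> and
  \<open>n\<close> are \<open>-\<infinity>\<close> and \<open>\<infinity>\<close>.\<close>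

definition saddle :: "nat \<Rightarrow> (nat \<Rightarrow> real) \<Rightarrow> nat \<Rightarrow> ereal" where
  "saddle n s j = (if j = 0 then - \<infinity> else if j = n then \<infinity> else ereal (s j))"

definition multiwell_potential ::
  "(real \<Rightarrow> real) \<Rightarrow> nat \<Rightarrow> (nat \<Rightarrow> real) \<Rightarrow> (nat \<Rightarrow> real) \<Rightarrow> bool" where
  "multiwell_potential U n m s \<longleftrightarrow>
     n \<ge> 2 \<and> C3 U \<and>
     (\<exists>c>0. \<forall>\<^sub>F x in at_infinity. \<bar>deriv U x\<bar> > c * \<bar>x\<bar> powr (1 + c)) \<and>
     {x. local_min_at U x} = m ` {1..n} \<and>
     {x. local_max_at U x} = s ` {1..<n} \<and>
     (\<forall>j\<in>{1..n}. saddle n s (j - 1) < ereal (m j) \<and> ereal (m j) < saddle n s j) \<and>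
     (\<forall>j\<in>{1..n}. deriv (deriv U) (m j) > 0) \<and>
     (\<forall>j\<in>{1..<n}. deriv (deriv U) (s j) < 0)"


section \<open>The noise\<close>

definition stable_const :: "real \<Rightarrow> real" where
  "stable_const \<alpha> = \<alpha> * (LBINT y:{0<..}. (1 - cos y) / y powr (1 + \<alpha>))"

definition symmetric_stable_rv :: "real \<Rightarrow> 'a measure \<Rightarrow> ('a \<Rightarrow> real) \<Rightarrow> bool" where
  "symmetric_stable_rv \<alpha> M L \<longleftrightarrow>
     prob_space M \<and> L \<in> borel_measurable M \<and>
     (\<forall>u. char (distr M borel L) u = complex_of_real (exp (- (stable_const \<alpha> * \<bar>u\<bar> powr \<alpha>))))"


section \<open>The limiting generator\<close>

text \<open>\<open>1 / |z - x|\<^sup>\<alpha>\<close> with the convention \<open>1 / \<infinity> = 0\<close>.\<close>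

definition inv_dist_powr :: "real \<Rightarrow> ereal \<Rightarrow> real \<Rightarrow> real" where
  "inv_dist_powr \<alpha> z x = (if \<bar>z\<bar> = \<infinity> then 0 else 1 / \<bar>real_of_ereal z - x\<bar> powr \<alpha>)"

definition Q_entry :: "real \<Rightarrow> nat \<Rightarrow> (nat \<Rightarrow> real) \<Rightarrow> (nat \<Rightarrow> real) \<Rightarrow> nat \<Rightarrow> nat \<Rightarrow> real" where
  "Q_entry \<alpha> n m s i j =
     (if i = j
      then - (1 / 2) * (inv_dist_powr \<alpha> (saddle n s (i - 1)) (m i)
                        + inv_dist_powr \<alpha> (saddle n s i) (m i))
      else 1 / 2 * \<bar>inv_dist_powr \<alpha> (saddle n s (j - 1)) (m i)
                    - inv_dist_powr \<alpha> (saddle n s j) (m i)\<bar>)"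


section \<open>The discretization and the perturbed chain\<close>

text \<open>The map \<open>T\<close> of the unperturbed chain.\<close>

definition drift_map ::
  "(real \<Rightarrow> real) \<Rightarrow> real \<Rightarrow> real set \<Rightarrow> (real \<Rightarrow> real) \<Rightarrow> (real \<Rightarrow> real) \<Rightarrow> real \<Rightarrow> real" where
  "drift_map U h S a b x = (THE y. y \<in> S \<and> x - h * deriv U x \<in> {a y..<b y})"

definition well :: "nat \<Rightarrow> (nat \<Rightarrow> real) \<Rightarrow> real set \<Rightarrow> nat \<Rightarrow> real set" where
  "well n s S j = {x \<in> S. saddle n s (j - 1) < ereal x \<and> ereal x < saddle n s j}"

definition discretization ::
  "(real \<Rightarrow> real) \<Rightarrow> nat \<Rightarrow> (nat \<Rightarrow> real) \<Rightarrow> (nat \<Rightarrow> real) \<Rightarrow> real \<Rightarrow> real \<Rightarrow> real \<Rightarrow>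
   real set \<Rightarrow> (real \<Rightarrow> real) \<Rightarrow> (real \<Rightarrow> real) \<Rightarrow> bool" where
  "discretization U n m s R h \<delta> S a b \<longleftrightarrow>
     R > 0 \<and> h > 0 \<and> \<delta> > 0 \<and> - R < m 1 \<and> m n < R \<and>
     finite S \<and>
     disjoint_family_on (\<lambda>x. {a x..<b x}) S \<and> (\<Union>x\<in>S. {a x..<b x}) = {- R..<R} \<and>
     (\<forall>x\<in>S. \<bar>b x - a x\<bar> \<le> \<delta> / 2) \<and>
     (\<forall>x\<in>S. {a x..<b x} \<inter> S = {x} \<and> x \<in> {a x<..<b x}) \<and>
     m ` {1..n} \<subseteq> S \<and>
     {- R, R} \<union> s ` {1..<n} \<subseteq> a ` S \<union> b ` S \<and>
     (\<forall>x\<in>S - m ` {1..n}. x - h * deriv U x \<notin> {a x..<b x}) \<and>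
     (\<forall>x\<in>S. \<exists>!y. y \<in> S \<and> x - h * deriv U x \<in> {a y..<b y}) \<and>
     (\<forall>x\<in>S. monoseq (\<lambda>k. (drift_map U h S a b ^^ k) x)) \<and>
     (\<forall>j\<in>{1..n}. \<forall>x\<in>well n s S j. \<exists>k. (drift_map U h S a b ^^ k) x = m j)"

text \<open>Exits to the left of the first cell and to the right of the last cell are assigned to the
  extreme points of \<open>S\<close>.\<close>

definition P_eps ::
  "real \<Rightarrow> 'a measure \<Rightarrow> ('a \<Rightarrow> real) \<Rightarrow> (real \<Rightarrow> real) \<Rightarrow> real \<Rightarrow> real set \<Rightarrow> (real \<Rightarrow> real) \<Rightarrow>
   (real \<Rightarrow> real) \<Rightarrow> real \<Rightarrow> real \<Rightarrow> real \<Rightarrow> real" where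
  "P_eps \<alpha> M L U h S a b \<epsilon> x y =
     (let Z = \<lambda>\<omega>. x - h * deriv U x + \<epsilon> * h powr (1 / \<alpha>) * L \<omega> in
      if y = Min S then measure M {\<omega> \<in> space M. Z \<omega> \<le> b y}
      else if y = Max S then measure M {\<omega> \<in> space M. Z \<omega> \<ge> a y}
      else measure M {\<omega> \<in> space M. Z \<omega> \<in> {a y..<b y}})"

definition Q_eps ::
  "real \<Rightarrow> 'a measure \<Rightarrow> ('a \<Rightarrow> real) \<Rightarrow> (real \<Rightarrow> real) \<Rightarrow> real \<Rightarrow> real set \<Rightarrow> (real \<Rightarrow> real) \<Rightarrow>
   (real \<Rightarrow> real) \<Rightarrow> real \<Rightarrow> real \<Rightarrow> real \<Rightarrow> real" where
  "Q_eps \<alpha> M L U h S a b \<epsilon> x y =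
     1 / (h * \<epsilon> powr \<alpha>) * (P_eps \<alpha> M L U h S a b \<epsilon> x y - (if x = y then 1 else 0))"

end

theory Submission
  imports Defs
begin

text \<open>On the time scale of \<open>1 / (h \<epsilon>\<^sup>\<alpha>)\<close> steps the chain first follows the drift map \<open>T\<close> into a minimum and then leaves the
minimum \<open>m j\<close> by one large jump. An eigenvector of \<open>Q\<^sup>\<epsilon>\<close> with bounded eigenvalue satisfies \<open>P\<^sup>\<epsilon> \<psi> = (1 + O(\<epsilon>\<^sup>\<alpha>)) \<psi>\<close>,
so it is almost harmonic. From every point the path along \<open>T\<close> to the minimum of its well has probability
bounded away from zero, and escape from the well has probability tending to zero; hence \<open>\<psi>\<close> is almost constant on
wells (\<open>oscillation_bound\<close>). Reading the eigenvalue equation at the minima, where the entries of \<open>Q\<^sup>\<epsilon>\<close> stay bounded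
and sum over a well to an entry of \<open>Q\<close> in the limit (\<open>well_rate_tendsto\<close>), shows that the values of \<open>\<psi>\<close> at the
minima almost solve the eigenvalue equation of \<open>Q\<close>. Lemma \<open>generator_reduction\<close> combines both facts in a form that
is uniform over all functions on \<open>S\<close>, not only eigenvectors.

The rest is finite-dimensional. If \<open>\<mu>\<close> is a simple root of the characteristic polynomial of \<open>Q\<close>, some coordinate \<open>i0\<close>
can be fixed such that \<open>Q - \<mu>\<close> is injective on the vectors vanishing there (\<open>simple_root_pivot\<close>). Injective maps are bounded below
(\<open>injective_imp_bounded_below\<close>), so an approximate solution is close to a multiple of \<open>\<psi>Q\<close>, and the normalization forces the multiple
to have modulus close to one. Uniqueness follows by applying the same estimate to a combination of two
eigenvectors that vanishes at the minimum \<open>m i0\<close>. An eigenvalue tending to \<open>0\<close> is eventually \<open>0\<close>, because \<open>Q w = t \<one>\<close> forces \<open>t = 0\<close> by the maximum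
principle. Eigenvectors for \<open>0\<close> are constant since every state jumps to \<open>Min S\<close> with positive probability.

The probabilistic input is the tail \<open>P (L \<ge> u) \<sim> u\<^sup>-\<^sup>\<alpha> / 2\<close>, derived from the characteristic function. The law of
\<open>L / u\<close>, multiplied by \<open>u\<^sup>\<alpha>\<close>, should converge away from the origin to \<open>\<alpha> / 2 \<bar>y\<bar>\<^sup>-\<^sup>1\<^sup>-\<^sup>\<alpha> dy\<close>, which has infinite mass at
the origin. Multiplying by \<open>1 - sinc y\<close> makes all masses finite, and this weight is an average of functions \<open>1 - cos (t y)\<close>,
so the characteristic functions of the damped measures are explicit and converge. Levy's continuity theorem
then gives weak convergence (\<open>stable_tail\<close>).\<close>

section \<open>Averaging cosines\<close>

text \<open>Averaging \<open>1 - cos (t y)\<close> over \<open>t\<close> gives \<open>1 - sinc y\<close>, which unlike each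
\<open>1 - cos (t y)\<close> is bounded away from zero at infinity, so that one can divide by it there.\<close>

definition unif :: "real measure" where
  "unif = uniform_measure lborel {-1..1}"

lemma sets_unif [measurable_cong, simp]: "sets unif = sets borel"
  by (simp add: unif_def)

lemma space_unif [simp]: "space unif = UNIV"
  by (simp add: unif_def)

lemma prob_space_unif: "prob_space unif"
  unfolding unif_def by (rule prob_space_uniform_measure) auto

lemma AE_unif: "AE t in unif. \<bar>t\<bar> \<le> 1"
  unfolding unif_def by (rule AE_uniform_measureI) auto

lemma unif_density: "unif = density lborel (\<lambda>t. ennreal (indicator {-1..1} t / 2))"
proof -
  have "indicator {-1..1::real} t / (2::ennreal) = ennreal (indicator {-1..1} t / 2)" for t :: real
    by (auto split: split_indicator simp: divide_ennreal[symmetric])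
  then show ?thesis by (simp add: unif_def uniform_measure_def)
qed

lemma integral_unif:
  fixes f F :: "real \<Rightarrow> real"
  assumes "\<And>x. (F has_real_derivative f x) (at x)" and cont: "\<And>x. isCont f x"
  shows "(\<integral>t. f t \<partial>unif) = (F 1 - F (-1)) / 2"
proof -
  have [measurable]: "f \<in> borel_measurable borel"
    by (intro borel_measurable_continuous_onI continuous_at_imp_continuous_on ballI cont)
  have "(\<integral>t. f t \<partial>unif) = (\<integral>t. (indicator {-1..1} t / 2) *\<^sub>R f t \<partial>lborel)"
    unfolding unif_density by (rule integral_density) (auto)
  also have "\<dots> = (\<integral>t. f t * indicator {-1..1} t \<partial>lborel) / 2"
    by (simp flip: integral_divide_zero add: field_simps)
  also have "(\<integral>t. f t * indicator {-1..1} t \<partial>lborel) = F 1 - F (-1)"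
    by (rule integral_FTC_Icc_real) (use assms in auto)
  finally show ?thesis .
qed

lemma integral_cos_unif: "(\<integral>t. cos (t * y) \<partial>unif) = sinc y"
  and integral_sin_unif: "(\<integral>t. sin (t * y) \<partial>unif) = 0"
proof -
  interpret prob_space unif by (rule prob_space_unif)
  have c: "(\<integral>t. cos (t * y) \<partial>unif) = (sin (1 * y) / y - sin (-1 * y) / y) / 2" if "y \<noteq> 0"
    by (rule integral_unif) (use that in \<open>auto intro!: derivative_eq_intros continuous_intros\<close>)
  have s: "(\<integral>t. sin (t * y) \<partial>unif) = (- cos (1 * y) / y - - cos (-1 * y) / y) / 2" if "y \<noteq> 0"
    by (rule integral_unif) (use that in \<open>auto intro!: derivative_eq_intros continuous_intros\<close>)
  show "(\<integral>t. cos (t * y) \<partial>unif) = sinc y"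
    using c prob_space by (cases "y = 0") (auto simp: field_simps)
  show "(\<integral>t. sin (t * y) \<partial>unif) = 0"
    using s by (cases "y = 0") auto
qed

lemma average_cos_shift:
  "(\<integral>t. cos (v * y) - cos ((v + t) * y) \<partial>unif) = (1 - sinc y) * cos (v * y)"
proof -
  interpret prob_space unif by (rule prob_space_unif)
  have [simp]: "integrable unif (\<lambda>t. cos (t * y))" "integrable unif (\<lambda>t. sin (t * y))"
    by (auto intro!: integrable_const_bound[where B=1])
  have "(\<integral>t. cos (v * y) - cos ((v + t) * y) \<partial>unif)
     = (\<integral>t. cos (v * y) - (cos (v * y) * cos (t * y) - sin (v * y) * sin (t * y)) \<partial>unif)"
    by (simp add: distrib_right cos_add)
  also have "\<dots> = cos (v * y) - (cos (v * y) * sinc y - sin (v * y) * 0)"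
    using integral_cos_unif[of y] integral_sin_unif[of y] prob_space by simp
  finally show ?thesis by (simp add: algebra_simps)
qed

text \<open>By Fubini, the function \<open>\<Psi>\<close> alone determines the cosine transform of the damped measure \<open>(1 - sinc y) K(dy)\<close>. The
measure \<open>K\<close> may have infinite mass near the origin, where \<open>1 - cos (v y)\<close> vanishes quadratically, so the
statement covers a probability law and a Levy measure alike.\<close>

lemma sinc_weighted_cos_integral:
  fixes K :: "real measure" and \<Psi> :: "real \<Rightarrow> real"
  assumes K: "sigma_finite_measure K" and sets_K [measurable_cong]: "sets K = sets borel"
    and \<Psi>: "\<And>v. has_bochner_integral K (\<lambda>y. 1 - cos (v * y)) (\<Psi> v)"
    and int: "\<And>v. integrable unif (\<lambda>t. \<Psi> (v + t))"
  shows "has_bochner_integral K (\<lambda>y. (1 - sinc y) * cos (v * y)) (\<integral>t. \<Psi> (v + t) - \<Psi> v \<partial>unif)"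
proof -
  interpret U: prob_space unif by (rule prob_space_unif)
  interpret K: sigma_finite_measure K by (rule K)
  interpret pair_sigma_finite unif K ..
  have i1: "integrable (unif \<Otimes>\<^sub>M K) (\<lambda>(t, y). 1 - cos ((v + t) * y))"
  proof (rule Fubini_integrable)
    have "(\<integral>y. norm (case (t, y) of (t, y) \<Rightarrow> 1 - cos ((v + t) * y)) \<partial>K) = \<Psi> (v + t)" for t
      using has_bochner_integral_integral_eq[OF \<Psi>[of "v + t"]] by simp
    then show "integrable unif (\<lambda>t. \<integral>y. norm (case (t, y) of (t, y) \<Rightarrow> 1 - cos ((v + t) * y)) \<partial>K)"
      using int by simp
  qed (use \<Psi> in \<open>auto simp: has_bochner_integral_iff\<close>)
  have i2: "integrable (unif \<Otimes>\<^sub>M K) (\<lambda>(t, y). 1 - cos (v * y))"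
  proof (rule Fubini_integrable)
    have "(\<integral>y. norm (case (t, y) of (t, y) \<Rightarrow> 1 - cos (v * y)) \<partial>K) = \<Psi> v" for t :: real
      using has_bochner_integral_integral_eq[OF \<Psi>[of v]] by simp
    then show "integrable unif (\<lambda>t. \<integral>y. norm (case (t, y) of (t, y) \<Rightarrow> 1 - cos (v * y)) \<partial>K)"
      by simp
  qed (use \<Psi> in \<open>auto simp: has_bochner_integral_iff\<close>)
  have i: "integrable (unif \<Otimes>\<^sub>M K) (\<lambda>(t, y). cos (v * y) - cos ((v + t) * y))"
    using Bochner_Integration.integrable_diff[OF i1 i2] by (simp add: case_prod_unfold)
  have inner: "(\<integral>y. cos (v * y) - cos ((v + t) * y) \<partial>K) = \<Psi> (v + t) - \<Psi> v" for t
    using has_bochner_integral_integral_eq[OF has_bochner_integral_diff[OF \<Psi>[of "v + t"] \<Psi>[of v]]]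
    by simp
  show ?thesis
    using integrable_snd[OF i] Fubini_integral[OF i]
    by (simp only: average_cos_shift inner has_bochner_integral_iff)
qed


section \<open>The measure with density proportional to the stable jump density\<close>

lemma set_integrable_powr_nonneg:
  fixes e :: real
  assumes "(\<lambda>y. y powr e) integrable_on {a..b}"
  shows "integrable lborel (\<lambda>y. indicator {a..b} y * y powr e)"
proof -
  have "(\<lambda>y. y powr e) absolutely_integrable_on {a..b}"
    by (intro nonnegative_absolutely_integrable_1 assms) auto
  then have "integrable lebesgue (\<lambda>y. indicator {a..b} y * y powr e)"
    by (simp add: set_integrable_def)
  then show ?thesis
    by (subst (asm) integrable_completion) auto
qed

lemma has_bochner_integral_powr_to_inf:
  fixes a e :: real
  assumes "e < -1" "a > 0"
  shows "has_bochner_integral lborel (\<lambda>y. indicator {a..} y * y powr e) (- (a powr (e + 1)) / (e + 1))"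
proof -
  have "((\<lambda>y. y powr e) has_integral (- (a powr (e + 1)) / (e + 1))) {a..}"
    by (rule has_integral_powr_to_inf[OF assms])
  then have hi: "((\<lambda>y. if y \<in> {a..} then y powr e else 0) has_integral (- (a powr (e + 1)) / (e + 1))) UNIV"
    by (simp only: has_integral_restrict_UNIV)
  then have hi: "((\<lambda>y. indicator {a..} y * y powr e) has_integral (- (a powr (e + 1)) / (e + 1))) UNIV"
    by (rule has_integral_cong[THEN iffD1, rotated]) (auto simp: indicator_def)
  have "0 \<le> - (a powr (e + 1)) / (e + 1)"
    using assms by (intro divide_nonpos_neg) auto
  then have "has_bochner_integral lborel (\<lambda>y. indicator {a..} y * y powr e) (- (a powr (e + 1)) / (e + 1))"
    by (intro has_bochner_integral_nn_integral nn_integral_has_integral_lborel hi) auto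
  then show ?thesis .
qed

text \<open>The numerator tames the singularity at the origin because \<open>\<alpha> < 2\<close>, and the power decays fast enough at infinity because \<open>\<alpha> > 0\<close>.\<close>

lemma integrable_one_minus_cos_powr:
  fixes \<alpha> :: real
  assumes "0 < \<alpha>" "\<alpha> < 2"
  shows "integrable lborel (\<lambda>y. (1 - cos y) * \<bar>y\<bar> powr (- 1 - \<alpha>))"
proof -
  define g where "g y = indicator {0..1} y * y powr (1 - \<alpha>) + 2 * (indicator {1..} y * y powr (- 1 - \<alpha>))" for y :: real
  have "integrable lborel (\<lambda>y. indicator {0..1} y * y powr (1 - \<alpha>))"
    by (rule set_integrable_powr_nonneg, rule integrable_on_powr_from_0) (use assms in auto)
  moreover have "integrable lborel (\<lambda>y. indicator {1..} y * y powr (- 1 - \<alpha>))"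
    using has_bochner_integral_powr_to_inf[of "- 1 - \<alpha>" 1] assms by (simp add: has_bochner_integral_iff)
  ultimately have g: "integrable lborel g"
    unfolding g_def by (intro Bochner_Integration.integrable_add integrable_mult_right) auto
  then have g': "integrable lborel (\<lambda>y. g (- y))"
    using lborel_integrable_real_affine[OF g, of "-1" 0] by simp
  have bound: "(1 - cos y) * y powr (- 1 - \<alpha>) \<le> g y" if "y > 0" for y
  proof (cases "y \<le> 1")
    case True
    have "4 * (sin (y / 2))\<^sup>2 \<le> y\<^sup>2" "1 - cos y = 2 * (sin (y / 2))\<^sup>2"
      using cos_double_sin[of "y / 2"] power_mono[OF abs_sin_x_le_abs_x[of "y / 2"], of 2]
      by (simp_all add: power_divide)
    then have "1 - cos y \<le> y\<^sup>2" using zero_le_power2[of y] by linarith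
    then have "(1 - cos y) * y powr (- 1 - \<alpha>) \<le> y powr 2 * y powr (- 1 - \<alpha>)"
      using that by (intro mult_right_mono) auto
    also have "\<dots> = y powr (1 - \<alpha>)" by (simp flip: powr_add)
    finally show ?thesis using True that by (auto simp: g_def indicator_def)
  next
    case False
    have "1 - cos y \<le> 2" using cos_ge_minus_one[of y] by linarith
    then have "(1 - cos y) * y powr (- 1 - \<alpha>) \<le> 2 * y powr (- 1 - \<alpha>)"
      by (intro mult_right_mono) auto
    then show ?thesis using False by (auto simp: g_def indicator_def)
  qed
  have g_nonneg: "g y \<ge> 0" for y by (auto simp: g_def)
  have "(1 - cos y) * \<bar>y\<bar> powr (- 1 - \<alpha>) \<le> g y + g (- y)" for y
  proof -
    consider "y > 0" | "y < 0" | "y = 0" by linarith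
    then show ?thesis
      using bound[of y] bound[of "- y"] g_nonneg[of y] g_nonneg[of "- y"]
      by cases auto
  qed
  then show ?thesis
    by (intro Bochner_Integration.integrable_bound[OF Bochner_Integration.integrable_add[OF g g']])
       (auto simp: abs_mult intro!: order_trans[OF _ abs_ge_self])
qed

lemma integral_one_minus_cos_powr:
  fixes \<alpha> :: real
  assumes "0 < \<alpha>" "\<alpha> < 2"
  shows "(\<integral>y. (1 - cos y) * \<bar>y\<bar> powr (- 1 - \<alpha>) \<partial>lborel) = 2 * stable_const \<alpha> / \<alpha>"
proof -
  define f where "f y = (1 - cos y) * \<bar>y\<bar> powr (- 1 - \<alpha>)" for y :: real
  have f: "integrable lborel f"
    unfolding f_def by (rule integrable_one_minus_cos_powr[OF assms])
  have int: "integrable lborel (\<lambda>y. indicator {0<..} y * f y)" "integrable lborel (\<lambda>y. indicator {..<0} y * f y)"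
    using integrable_mult_indicator[OF _ f, of "{0<..}"] integrable_mult_indicator[OF _ f, of "{..<0}"] by auto
  have "(\<integral>y. f y \<partial>lborel) = (\<integral>y. indicator {0<..} y * f y + indicator {..<0} y * f y \<partial>lborel)"
    by (rule Bochner_Integration.integral_cong) (auto simp: f_def indicator_def)
  also have "\<dots> = (\<integral>y. indicator {0<..} y * f y \<partial>lborel) + (\<integral>y. indicator {..<0} y * f y \<partial>lborel)"
    using int by (rule Bochner_Integration.integral_add)
  also have "(\<integral>y. indicator {..<0} y * f y \<partial>lborel) = (\<integral>y. indicator {0<..} y * f y \<partial>lborel)"
    by (subst lborel_integral_real_affine[of "-1" _ 0])
       (auto simp: f_def indicator_def intro!: Bochner_Integration.integral_cong)
  also have "(\<integral>y. indicator {0<..} y * f y \<partial>lborel) = stable_const \<alpha> / \<alpha>"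
    using assms unfolding stable_const_def set_lebesgue_integral_def
    by (auto simp: f_def indicator_def powr_diff powr_minus powr_add divide_simps intro!: Bochner_Integration.integral_cong)
  finally show ?thesis unfolding f_def by simp
qed

lemma stable_const_pos:
  fixes \<alpha> :: real
  assumes "0 < \<alpha>" "\<alpha> < 2"
  shows "stable_const \<alpha> > 0"
proof -
  define f where "f y = (1 - cos y) * \<bar>y\<bar> powr (- 1 - \<alpha>)" for y :: real
  have f: "integrable lborel f"
    unfolding f_def by (rule integrable_one_minus_cos_powr[OF assms])
  have nn: "f y \<ge> 0" for y by (auto simp: f_def)
  have "(\<integral>y. f y \<partial>lborel) \<noteq> 0"
  proof
    assume "(\<integral>y. f y \<partial>lborel) = 0"
    then have "AE y in lborel. f y = 0"
      using integral_nonneg_eq_0_iff_AE[OF f] nn by auto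
    then have "AE y in lborel. y \<notin> {1..2::real}"
    proof eventually_elim
      case (elim y)
      have "cos y < 1" if "1 \<le> y" "y \<le> 2"
        using cos_monotone_0_pi[of 0 y] that pi_gt3 by auto
      with elim show ?case by (auto simp: f_def)
    qed
    then have "emeasure lborel {1..2::real} = 0"
      by (subst (asm) AE_iff_measurable[OF _ refl]) (auto simp flip: atLeastAtMost_def atLeastAtMost_iff)
    then show False by simp
  qed
  moreover have "(\<integral>y. f y \<partial>lborel) \<ge> 0" using nn by simp
  ultimately show ?thesis
    using integral_one_minus_cos_powr[OF assms] assms unfolding f_def
    by (auto simp: less_le zero_le_divide_iff zero_le_mult_iff)
qed

text \<open>Up to the factor \<open>\<alpha> / 2\<close>, the Levy measure of the symmetric stable law.\<close>

definition powr_measure :: "real \<Rightarrow> real measure" where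
  "powr_measure \<alpha> = density lborel (\<lambda>y. ennreal (\<bar>y\<bar> powr (- 1 - \<alpha>)))"

lemma sets_powr_measure [measurable_cong, simp]: "sets (powr_measure \<alpha>) = sets borel"
  by (simp add: powr_measure_def)

lemma has_bochner_integral_powr_measure:
  fixes f :: "real \<Rightarrow> real"
  assumes "f \<in> borel_measurable borel"
  shows "has_bochner_integral (powr_measure \<alpha>) f I \<longleftrightarrow>
         has_bochner_integral lborel (\<lambda>y. f y * \<bar>y\<bar> powr (- 1 - \<alpha>)) I"
  using assms unfolding powr_measure_def has_bochner_integral_iff
  by (subst integrable_density; simp add: integral_density mult.commute)

text \<open>The substitution \<open>y \<mapsto> v y\<close> reduces every frequency to \<open>v = 1\<close>, which is the integral in the stable constant.\<close>

lemma powr_measure_cos_integral: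
  fixes \<alpha> :: real
  assumes "0 < \<alpha>" "\<alpha> < 2"
  shows "has_bochner_integral (powr_measure \<alpha>) (\<lambda>y. 1 - cos (v * y)) (2 * stable_const \<alpha> / \<alpha> * \<bar>v\<bar> powr \<alpha>)"
proof (cases "v = 0")
  case True
  then show ?thesis using has_bochner_integral_zero[of "powr_measure \<alpha>"] by simp
next
  case False
  define f where "f y = (1 - cos y) * \<bar>y\<bar> powr (- 1 - \<alpha>)" for y :: real
  have f: "integrable lborel f"
    unfolding f_def by (rule integrable_one_minus_cos_powr[OF assms])
  have eq: "(1 - cos (v * y)) * \<bar>y\<bar> powr (- 1 - \<alpha>) = \<bar>v\<bar> powr (1 + \<alpha>) * f (0 + v * y)" for y
  proof -
    have "\<bar>v\<bar> powr (1 + \<alpha>) * \<bar>v * y\<bar> powr (- 1 - \<alpha>) = \<bar>v\<bar> powr (1 + \<alpha> + (- 1 - \<alpha>)) * \<bar>y\<bar> powr (- 1 - \<alpha>)"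
      by (simp only: abs_mult powr_mult abs_ge_zero powr_add mult.assoc)
    also have "\<dots> = \<bar>y\<bar> powr (- 1 - \<alpha>)" using False by simp
    finally show ?thesis by (simp add: f_def)
  qed
  have "integrable lborel (\<lambda>y. f (0 + v * y))"
    by (rule lborel_integrable_real_affine[OF f False])
  moreover have "(\<integral>y. f (0 + v * y) \<partial>lborel) = 2 * stable_const \<alpha> / \<alpha> / \<bar>v\<bar>"
    using lborel_integral_real_affine[OF False, of f 0] integral_one_minus_cos_powr[OF assms, folded f_def] False
    by (simp add: field_simps)
  ultimately have "has_bochner_integral lborel (\<lambda>y. \<bar>v\<bar> powr (1 + \<alpha>) * f (0 + v * y)) (\<bar>v\<bar> powr (1 + \<alpha>) * (2 * stable_const \<alpha> / \<alpha> / \<bar>v\<bar>))"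
    by (intro has_bochner_integral_mult_right) (auto simp: has_bochner_integral_iff)
  moreover have "\<bar>v\<bar> powr (1 + \<alpha>) * (2 * stable_const \<alpha> / \<alpha> / \<bar>v\<bar>) = 2 * stable_const \<alpha> / \<alpha> * \<bar>v\<bar> powr \<alpha>"
    using False by (simp add: powr_add)
  ultimately show ?thesis
    by (subst has_bochner_integral_powr_measure) (auto simp: eq)
qed

lemma sigma_finite_powr_measure: "sigma_finite_measure (powr_measure \<alpha>)"
  unfolding powr_measure_def
  by (subst sigma_finite_measure.sigma_finite_iff_density_finite[OF sigma_finite_lborel]) auto


section \<open>Damping a symmetric measure at the origin\<close>

definition sinc_weighted :: "real measure \<Rightarrow> real measure" where
  "sinc_weighted K = density K (\<lambda>y. ennreal ((1 - sinc y) / (\<integral>y. 1 - sinc y \<partial>K)))"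

lemma sinc_le_1: "sinc y \<le> 1"
proof -
  interpret prob_space unif by (rule prob_space_unif)
  have "(\<integral>t. cos (t * y) \<partial>unif) \<le> (\<integral>t. 1 \<partial>unif)"
    by (intro integral_mono integrable_const_bound[where B=1]) auto
  then show ?thesis using integral_cos_unif[of y] prob_space by simp
qed

text \<open>Symmetry of \<open>K\<close> removes the sine part, so the damped law has a real characteristic function, given by \<open>\<Psi>\<close>.\<close>

lemma
  fixes K :: "real measure" and \<Psi> :: "real \<Rightarrow> real"
  assumes K: "sigma_finite_measure K" and sets_K [measurable_cong]: "sets K = sets borel"
    and symmetric: "distr K borel uminus = K"
    and \<Psi>: "\<And>v. has_bochner_integral K (\<lambda>y. 1 - cos (v * y)) (\<Psi> v)"
    and int: "\<And>v. integrable unif (\<lambda>t. \<Psi> (v + t))"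
    and pos: "(\<integral>t. \<Psi> t \<partial>unif) > 0"
  shows real_distribution_sinc_weighted: "real_distribution (sinc_weighted K)"
    and char_sinc_weighted: "char (sinc_weighted K) v =
      complex_of_real ((\<integral>t. \<Psi> (v + t) - \<Psi> v \<partial>unif) / (\<integral>t. \<Psi> t \<partial>unif))"
    and integral_sinc_weighted: "f \<in> borel_measurable borel \<Longrightarrow>
      (\<integral>y. f y \<partial>sinc_weighted K) = (\<integral>y. (1 - sinc y) * f y \<partial>K) / (\<integral>t. \<Psi> t \<partial>unif)"
proof -
  define m where "m = (\<integral>t. \<Psi> t \<partial>unif)"
  have "\<Psi> 0 = 0"
    using has_bochner_integral_integral_eq[OF \<Psi>[of 0]] by simp
  then have m: "has_bochner_integral K (\<lambda>y. 1 - sinc y) (\<integral>t. \<Psi> t \<partial>unif)"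
    using sinc_weighted_cos_integral[OF K sets_K \<Psi> int, of 0] by simp
  have m_eq: "(\<integral>y. 1 - sinc y \<partial>K) = m" and m_int: "integrable K (\<lambda>y. 1 - sinc y)"
    using m by (simp_all add: has_bochner_integral_iff m_def)
  have "m > 0" using pos by (simp add: m_def)
  have W: "sinc_weighted K = density K (\<lambda>y. ennreal ((1 - sinc y) / m))"
    by (simp add: sinc_weighted_def m_eq)
  have w_nn: "0 \<le> (1 - sinc y) / m" for y
    using sinc_le_1[of y] \<open>m > 0\<close> by (intro divide_nonneg_pos) auto
  have w_meas [measurable]: "(\<lambda>y. (1 - sinc y) / m) \<in> borel_measurable borel"
    using borel_measurable_sinc by measurable
  have "emeasure (sinc_weighted K) UNIV = (\<integral>\<^sup>+ y. ennreal ((1 - sinc y) / m) \<partial>K)"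
    unfolding W using sets_eq_imp_space_eq[OF sets_K] by (subst emeasure_density) (auto simp: measurable_cong_sets[OF sets_K refl])
  also have "\<dots> = ennreal (m / m)"
    using m \<open>m > 0\<close> w_nn
    by (subst nn_integral_eq_integral) (auto simp: has_bochner_integral_iff m_def)
  finally have total: "emeasure (sinc_weighted K) UNIV = 1" using \<open>m > 0\<close> by simp
  show "real_distribution (sinc_weighted K)"
    unfolding real_distribution_def real_distribution_axioms_def
    using total sets_eq_imp_space_eq[OF sets_K] by (auto intro!: prob_spaceI simp: W sets_K)
  have cos: "has_bochner_integral K (\<lambda>y. (1 - sinc y) * cos (v * y)) (\<integral>t. \<Psi> (v + t) - \<Psi> v \<partial>unif)"
    by (rule sinc_weighted_cos_integral[OF K sets_K \<Psi> int])
  have sin_meas [measurable]: "(\<lambda>y. (1 - sinc y) * sin (v * y)) \<in> borel_measurable borel"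
    using borel_measurable_sinc by measurable
  have sin_int: "integrable K (\<lambda>y. (1 - sinc y) * sin (v * y))"
  proof (rule Bochner_Integration.integrable_bound[OF m_int])
    show "AE y in K. norm ((1 - sinc y) * sin (v * y)) \<le> norm (1 - sinc y)"
      by (intro AE_I2) (simp only: norm_mult, intro mult_left_le, auto)
  qed (simp add: measurable_cong_sets[OF sets_K refl])
  have "(\<integral>y. (1 - sinc y) * sin (v * y) \<partial>K) = (\<integral>y. (1 - sinc y) * sin (v * y) \<partial>distr K borel uminus)"
    by (simp only: symmetric)
  also have "\<dots> = (\<integral>y. - ((1 - sinc y) * sin (v * y)) \<partial>K)"
    by (subst integral_distr) (auto intro!: Bochner_Integration.integral_cong simp: measurable_cong_sets[OF sets_K refl])
  finally have sin0: "(\<integral>y. (1 - sinc y) * sin (v * y) \<partial>K) = 0" by simp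
  have "char (sinc_weighted K) v = (\<integral>y. ((1 - sinc y) / m) *\<^sub>R iexp (v * y) \<partial>K)"
    unfolding char_def W
    by (rule integral_density) (use w_nn in \<open>auto simp: measurable_cong_sets[OF sets_K refl]\<close>)
  also have "\<dots> = (\<integral>y. complex_of_real ((1 - sinc y) * cos (v * y) / m) + \<i> * complex_of_real ((1 - sinc y) * sin (v * y) / m) \<partial>K)"
    by (rule Bochner_Integration.integral_cong[OF refl])
       (simp add: complex_eq_iff cis_conv_exp[symmetric] del: of_real_mult)
  also have "\<dots> = complex_of_real (\<integral>y. (1 - sinc y) * cos (v * y) / m \<partial>K) + \<i> * complex_of_real (\<integral>y. (1 - sinc y) * sin (v * y) / m \<partial>K)"
    using cos sin_int
    by (subst Bochner_Integration.integral_add)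
       (auto simp: has_bochner_integral_iff integral_complex_of_real simp del: of_real_mult of_real_divide)
  also have "\<dots> = complex_of_real ((\<integral>t. \<Psi> (v + t) - \<Psi> v \<partial>unif) / m)"
    using cos sin0 by (simp add: has_bochner_integral_iff)
  finally show "char (sinc_weighted K) v =
      complex_of_real ((\<integral>t. \<Psi> (v + t) - \<Psi> v \<partial>unif) / (\<integral>t. \<Psi> t \<partial>unif))"
    by (simp add: m_def)
  show "(\<integral>y. f y \<partial>sinc_weighted K) = (\<integral>y. (1 - sinc y) * f y \<partial>K) / (\<integral>t. \<Psi> t \<partial>unif)"
    if "f \<in> borel_measurable borel"
  proof -
    have "(\<integral>y. f y \<partial>sinc_weighted K) = (\<integral>y. ((1 - sinc y) / m) *\<^sub>R f y \<partial>K)"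
      unfolding W by (rule integral_density) (use w_nn that in \<open>auto simp: measurable_cong_sets[OF sets_K refl]\<close>)
    then show ?thesis by (simp add: m_def)
  qed
qed


lemma AE_unif_nonzero: "AE t in unif. t \<noteq> 0"
  unfolding unif_def by (rule AE_uniform_measureI) (use AE_lborel_singleton[of 0] in auto)

text \<open>The exception at \<open>0\<close> is there because \<open>\<Psi>\<close> vanishes at \<open>0\<close>.\<close>

lemma integral_unif_pos:
  fixes f :: "real \<Rightarrow> real"
  assumes "integrable unif f" and nn: "\<And>t. f t \<ge> 0" and pos: "\<And>t. t \<noteq> 0 \<Longrightarrow> f t > 0"
  shows "(\<integral>t. f t \<partial>unif) > 0"
proof -
  interpret prob_space unif by (rule prob_space_unif)
  have "(\<integral>t. f t \<partial>unif) \<noteq> 0"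
  proof
    assume "(\<integral>t. f t \<partial>unif) = 0"
    then have "AE t in unif. f t = 0"
      using integral_nonneg_eq_0_iff_AE[OF assms(1)] nn by auto
    with AE_unif_nonzero have "AE t in unif. False"
      by eventually_elim (use pos in force)
    then show False by simp
  qed
  moreover have "(\<integral>t. f t \<partial>unif) \<ge> 0" using nn by simp
  ultimately show ?thesis by simp
qed

lemma abs_sinc_le_1: "\<bar>sinc y\<bar> \<le> 1"
proof -
  interpret prob_space unif by (rule prob_space_unif)
  have "integrable unif (\<lambda>t. cos (t * y))"
    by (rule integrable_const_bound[where B=1]) auto
  then have "(\<integral>t. - 1 \<partial>unif) \<le> (\<integral>t. cos (t * y) \<partial>unif)"
    by (intro integral_mono) auto
  then show ?thesis using integral_cos_unif[of y] prob_space sinc_le_1[of y] by simp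
qed

text \<open>The rescaled exponents \<open>(1 - char)\<close> converge because this is the derivative of \<open>1 - exp (- c q)\<close> at \<open>q = 0\<close>.\<close>

lemma one_minus_exp_quotient: "((\<lambda>q. (1 - exp (- (c * q))) / q) \<longlongrightarrow> c) (at (0::real))"
proof -
  have "((\<lambda>q. 1 - exp (- (c * q))) has_real_derivative c) (at 0)"
    by (auto intro!: derivative_eq_intros)
  then show ?thesis by (simp add: DERIV_def)
qed


section \<open>Tails of symmetric stable laws\<close>

locale stable_noise =
  fixes \<alpha> :: real and M :: "'a measure" and L :: "'a \<Rightarrow> real"
  assumes alpha: "0 < \<alpha>" "\<alpha> < 2" and noise: "symmetric_stable_rv \<alpha> M L"

sublocale stable_noise \<subseteq> prob_space M
  using noise by (simp add: symmetric_stable_rv_def)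

context stable_noise
begin

lemma L_measurable [measurable]: "L \<in> borel_measurable M"
  using noise by (simp add: symmetric_stable_rv_def)

abbreviation "\<phi> v \<equiv> exp (- (stable_const \<alpha> * \<bar>v\<bar> powr \<alpha>))"

lemma char_scaled_stable:
  "char (distr M borel (\<lambda>\<omega>. r * L \<omega>)) v = complex_of_real (\<phi> (r * v))"
proof -
  have "char (distr M borel (\<lambda>\<omega>. r * L \<omega>)) v = char (distr M borel L) (r * v)"
    unfolding char_def by (simp add: integral_distr mult_ac)
  then show ?thesis using noise by (simp add: symmetric_stable_rv_def)
qed

lemma real_distribution_scaled: "real_distribution (distr M borel (\<lambda>\<omega>. r * L \<omega>))"
  by (intro real_distribution_distr) simp

lemma stable_symmetric: "distr M borel (\<lambda>\<omega>. - (r * L \<omega>)) = distr M borel (\<lambda>\<omega>. r * L \<omega>)"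
proof (rule Levy_uniqueness)
  show "real_distribution (distr M borel (\<lambda>\<omega>. - (r * L \<omega>)))" by (intro real_distribution_distr) simp
  show "char (distr M borel (\<lambda>\<omega>. - (r * L \<omega>))) = char (distr M borel (\<lambda>\<omega>. r * L \<omega>))"
    using char_scaled_stable[of "- r"] char_scaled_stable[of r] by (intro ext) simp
qed (rule real_distribution_scaled)

lemma
  shows stable_cos_expectation: "has_bochner_integral M (\<lambda>\<omega>. cos (v * L \<omega>)) (\<phi> v)"
    and stable_sin_expectation: "has_bochner_integral M (\<lambda>\<omega>. sin (v * L \<omega>)) 0"
proof -
  have i: "complex_integrable M (\<lambda>\<omega>. iexp (v * L \<omega>))"
    by (rule integrable_const_bound[where B=1]) auto
  have c: "(\<integral>\<omega>. iexp (v * L \<omega>) \<partial>M) = complex_of_real (\<phi> v)"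
    using noise by (simp add: symmetric_stable_rv_def char_def integral_distr)
  have "(\<integral>\<omega>. cos (v * L \<omega>) \<partial>M) = (\<integral>\<omega>. Re (iexp (v * L \<omega>)) \<partial>M)"
    by (simp add: cis_conv_exp[symmetric] del: of_real_mult)
  also have "\<dots> = \<phi> v"
    by (simp only: integral_Re[OF i] c complex.sel Re_complex_of_real)
  finally show "has_bochner_integral M (\<lambda>\<omega>. cos (v * L \<omega>)) (\<phi> v)"
    by (auto simp: has_bochner_integral_iff intro!: integrable_const_bound[where B=1])
  have "(\<integral>\<omega>. sin (v * L \<omega>) \<partial>M) = (\<integral>\<omega>. Im (iexp (v * L \<omega>)) \<partial>M)"
    by (simp add: cis_conv_exp[symmetric] del: of_real_mult)
  also have "\<dots> = 0"
    by (simp only: integral_Im[OF i] c Im_complex_of_real)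
  finally show "has_bochner_integral M (\<lambda>\<omega>. sin (v * L \<omega>)) 0"
    by (auto simp: has_bochner_integral_iff intro!: integrable_const_bound[where B=1])
qed

lemma stable_affine_cos_integral:
  "has_bochner_integral (distr M borel (\<lambda>\<omega>. r * (L \<omega> - a))) (\<lambda>y. 1 - cos (v * y))
     (1 - cos (r * a * v) * \<phi> (r * v))"
proof -
  have "has_bochner_integral M (\<lambda>\<omega>. 1 :: real) 1"
    using prob_space by (simp add: has_bochner_integral_iff)
  then have "has_bochner_integral M
      (\<lambda>\<omega>. 1 - (cos (r * a * v) * cos (r * v * L \<omega>) + sin (r * a * v) * sin (r * v * L \<omega>)))
      (1 - (cos (r * a * v) * \<phi> (r * v) + sin (r * a * v) * 0))"
    by (intro has_bochner_integral_diff has_bochner_integral_add has_bochner_integral_mult_right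
        stable_cos_expectation stable_sin_expectation)
  moreover have "1 - (cos (r * a * v) * cos (r * v * L \<omega>) + sin (r * a * v) * sin (r * v * L \<omega>))
      = 1 - cos (v * (r * (L \<omega> - a)))" for \<omega>
    using cos_diff[of "r * v * L \<omega>" "r * a * v"] by (simp add: algebra_simps)
  ultimately have "has_bochner_integral M (\<lambda>\<omega>. 1 - cos (v * (r * (L \<omega> - a))))
     (1 - cos (r * a * v) * \<phi> (r * v))"
    by simp
  then show ?thesis by (intro has_bochner_integral_distr) auto
qed

lemma stable_cos_integral:
  "has_bochner_integral (distr M borel (\<lambda>\<omega>. r * L \<omega>)) (\<lambda>y. 1 - cos (v * y))
     (1 - \<phi> (r * v))"
  using stable_affine_cos_integral[of r 0 v] by simp


text \<open>The damped laws of \<open>2 L / u\<close> converge weakly to the damped powr measure, since their characteristic functions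
do. The indicator of \<open>[2, \<infinity>)\<close> divided by the weight \<open>1 - sinc\<close> is a bounded test function with a single discontinuity, and its
integrals are the tail of \<open>L\<close> and the mass of \<open>[2, \<infinity>)\<close>, up to the normalizing constants.\<close>

lemma stable_tail: "((\<lambda>u. u powr \<alpha> * prob {\<omega> \<in> space M. u \<le> L \<omega>}) \<longlongrightarrow> 1 / 2) at_top"
proof (rule tendsto_at_topI_sequentially)
  fix X :: "nat \<Rightarrow> real"
  assume X: "filterlim X at_top sequentially"
  interpret U: prob_space unif by (rule prob_space_unif)
  define C where "C = stable_const \<alpha>"
  have C: "C > 0" unfolding C_def by (rule stable_const_pos[OF alpha])
  define Y where "Y n = max 1 (X n)" for n
  have Y1: "Y n \<ge> 1" for n by (simp add: Y_def)
  let ?W = "sinc_weighted (powr_measure \<alpha>)" and ?p = "\<lambda>n. prob {\<omega> \<in> space M. Y n \<le> L \<omega>}"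
  have Y: "filterlim Y at_top sequentially"
    by (rule filterlim_at_top_mono[OF X]) (simp add: Y_def)
  \<comment> \<open>Scaling by \<open>2 / Y\<close> moves the tail event to \<open>[2, \<infinity>)\<close>, where \<open>sinc y \<le> 1 / 2\<close> is immediate.\<close>
  define r where "r n = 2 / Y n" for n
  define q where "q n = r n powr \<alpha>" for n
  have r_pos: "r n > 0" for n using Y1[of n] by (simp add: r_def)
  have q_pos: "q n > 0" for n using r_pos[of n] by (simp add: q_def)
  have "r \<longlonglongrightarrow> 0"
    unfolding r_def by (rule real_tendsto_divide_at_top[OF tendsto_const Y])
  then have "(\<lambda>n. r n powr \<alpha>) \<longlonglongrightarrow> 0 powr \<alpha>"
    using alpha r_pos by (intro tendsto_powr') (auto simp: less_imp_le)
  then have "q \<longlonglongrightarrow> 0" by (simp add: q_def[abs_def])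
  then have q: "filterlim q (at 0) sequentially"
    using q_pos by (auto simp: filterlim_at less_imp_neq[symmetric])
  define K where "K n = distr M borel (\<lambda>\<omega>. r n * L \<omega>)" for n
  define \<Psi> where "\<Psi> n v = 1 - exp (- (C * \<bar>v\<bar> powr \<alpha> * q n))" for n v
  define \<Psi>' where "\<Psi>' v = 2 * C / \<alpha> * \<bar>v\<bar> powr \<alpha>" for v
  have [measurable]: "\<Psi> n \<in> borel_measurable borel" "\<Psi>' \<in> borel_measurable borel" for n
    unfolding \<Psi>_def \<Psi>'_def by measurable
  have \<Psi>_bounds: "0 \<le> \<Psi> n v" "\<Psi> n v \<le> 1" "\<Psi> n v \<le> C * \<bar>v\<bar> powr \<alpha> * q n" for n v
    using C q_pos[of n] exp_ge_add_one_self[of "- (C * \<bar>v\<bar> powr \<alpha> * q n)"]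
    by (auto simp: \<Psi>_def)
  have \<Psi>_pos: "0 < \<Psi> n v" "0 < \<Psi>' v" if "v \<noteq> 0" for n v
    using C q_pos[of n] alpha that by (auto simp: \<Psi>_def \<Psi>'_def)
  have \<Psi>0: "\<Psi> n 0 = 0" "\<Psi>' 0 = 0" for n using alpha by (simp_all add: \<Psi>_def \<Psi>'_def)
  have shift: "AE t in unif. \<bar>v + t\<bar> powr \<alpha> \<le> (\<bar>v\<bar> + 1) powr \<alpha>" for v
    using AE_unif by eventually_elim (use alpha in \<open>intro powr_mono2, auto\<close>)
  have int: "integrable unif (\<lambda>t. \<Psi> n (v + t))" for n v
    by (rule U.integrable_const_bound[where B=1]) (use \<Psi>_bounds in auto)
  have int': "integrable unif (\<lambda>t. \<Psi>' (v + t))" for v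
  proof (rule U.integrable_const_bound[where B="2 * C / \<alpha> * (\<bar>v\<bar> + 1) powr \<alpha>"])
    show "AE t in unif. norm (\<Psi>' (v + t)) \<le> 2 * C / \<alpha> * (\<bar>v\<bar> + 1) powr \<alpha>"
      using shift[of v]
    proof eventually_elim
      case (elim t)
      then show ?case
        using C alpha mult_left_mono[OF elim, of "2 * C / \<alpha>"] by (simp add: \<Psi>'_def abs_mult)
    qed
  qed simp
  define m where "m n = (\<integral>t. \<Psi> n t \<partial>unif)" for n
  define m' where "m' = (\<integral>t. \<Psi>' t \<partial>unif)"
  have m_pos: "m n > 0" for n
    unfolding m_def by (rule integral_unif_pos) (use int[of n 0] \<Psi>_bounds \<Psi>_pos in auto)
  have "\<Psi>' v \<ge> 0" for v using C alpha by (simp add: \<Psi>'_def)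
  then have m'_pos: "m' > 0"
    unfolding m'_def by (intro integral_unif_pos) (use int'[of 0] \<Psi>_pos in auto)

  have K_facts: "sigma_finite_measure (K n)" "sets (K n) = sets borel" "distr (K n) borel uminus = K n"
    "\<And>v. has_bochner_integral (K n) (\<lambda>y. 1 - cos (v * y)) (\<Psi> n v)" for n
  proof -
    interpret Kn: real_distribution "K n"
      unfolding K_def by (rule real_distribution_scaled)
    show "sigma_finite_measure (K n)" "sets (K n) = sets borel" by unfold_locales simp
    show "distr (K n) borel uminus = K n"
      unfolding K_def by (subst distr_distr) (auto simp: comp_def stable_symmetric)
    show "has_bochner_integral (K n) (\<lambda>y. 1 - cos (v * y)) (\<Psi> n v)" for v
      using stable_cos_integral[of "r n" v] r_pos[of n]
      by (simp add: K_def \<Psi>_def C_def q_def abs_mult powr_mult mult_ac)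
  qed
  have K'_sym: "distr (powr_measure \<alpha>) borel uminus = powr_measure \<alpha>"
  proof -
    have "powr_measure \<alpha> = density (distr lborel borel uminus) (\<lambda>y. ennreal (\<bar>y\<bar> powr (- 1 - \<alpha>)))"
      by (simp add: powr_measure_def lborel_distr_uminus)
    also have "\<dots> = distr (density lborel (\<lambda>y. ennreal (\<bar>- y\<bar> powr (- 1 - \<alpha>)))) borel uminus"
      by (rule density_distr) auto
    finally show ?thesis by (simp add: powr_measure_def)
  qed
  note K'_facts = sigma_finite_powr_measure[of \<alpha>] sets_powr_measure[of \<alpha>] K'_sym
    powr_measure_cos_integral[OF alpha, folded C_def, folded \<Psi>'_def] int' m'_pos[unfolded m'_def]
  note Kn_facts = K_facts int m_pos[unfolded m_def]

  have J: "(\<lambda>n. (\<integral>t. \<Psi> n (v + t) - \<Psi> n v \<partial>unif) / q n) \<longlonglongrightarrow> \<alpha> / 2 * (\<integral>t. \<Psi>' (v + t) - \<Psi>' v \<partial>unif)" for v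
  proof -
    have lim: "(\<lambda>n. \<Psi> n w / q n) \<longlonglongrightarrow> \<alpha> / 2 * \<Psi>' w" for w
      using filterlim_compose[OF one_minus_exp_quotient[of "C * \<bar>w\<bar> powr \<alpha>"] q] alpha
      by (simp add: \<Psi>_def \<Psi>'_def)
    have bnd: "\<bar>\<Psi> n w / q n\<bar> \<le> C * \<bar>w\<bar> powr \<alpha>" for n w
      using \<Psi>_bounds[of n w] q_pos[of n] by (simp add: field_simps)
    have "(\<lambda>n. \<integral>t. \<Psi> n (v + t) / q n - \<Psi> n v / q n \<partial>unif) \<longlonglongrightarrow> (\<integral>t. \<alpha> / 2 * \<Psi>' (v + t) - \<alpha> / 2 * \<Psi>' v \<partial>unif)"
    proof (rule integral_dominated_convergence[where w="\<lambda>_. C * (\<bar>v\<bar> + 1) powr \<alpha> + C * \<bar>v\<bar> powr \<alpha>"])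
      show "AE t in unif. norm (\<Psi> n (v + t) / q n - \<Psi> n v / q n) \<le> C * (\<bar>v\<bar> + 1) powr \<alpha> + C * \<bar>v\<bar> powr \<alpha>" for n
        using shift[of v]
      proof eventually_elim
        case (elim t)
        show ?case
          using bnd[of n "v + t"] bnd[of n v] mult_left_mono[OF elim, of C] C unfolding real_norm_def by linarith
      qed
      show "AE t in unif. (\<lambda>n. \<Psi> n (v + t) / q n - \<Psi> n v / q n) \<longlonglongrightarrow> \<alpha> / 2 * \<Psi>' (v + t) - \<alpha> / 2 * \<Psi>' v"
        by (intro AE_I2 tendsto_diff lim)
    qed auto
    moreover have "(\<integral>t. \<Psi> n (v + t) / q n - \<Psi> n v / q n \<partial>unif) = (\<integral>t. \<Psi> n (v + t) - \<Psi> n v \<partial>unif) / q n" for n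
      by (simp flip: diff_divide_distrib)
    moreover have "(\<integral>t. \<alpha> / 2 * \<Psi>' (v + t) - \<alpha> / 2 * \<Psi>' v \<partial>unif) = \<alpha> / 2 * (\<integral>t. \<Psi>' (v + t) - \<Psi>' v \<partial>unif)"
      by (simp only: integral_mult_right_zero flip: right_diff_distrib)
    ultimately show ?thesis by (simp only:)
  qed
  have m_lim: "(\<lambda>n. m n / q n) \<longlonglongrightarrow> \<alpha> / 2 * m'"
    using J[of 0] by (simp add: \<Psi>0 m_def m'_def)

  have weak: "weak_conv_m (\<lambda>n. sinc_weighted (K n)) (?W)"
  proof (rule levy_continuity)
    show "real_distribution (sinc_weighted (K n))" for n
      by (rule real_distribution_sinc_weighted[OF Kn_facts])
    show "real_distribution (?W)"
      by (rule real_distribution_sinc_weighted[OF K'_facts])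
    fix v
    have "(\<lambda>n. ((\<integral>t. \<Psi> n (v + t) - \<Psi> n v \<partial>unif) / q n) / (m n / q n))
        \<longlonglongrightarrow> (\<alpha> / 2 * (\<integral>t. \<Psi>' (v + t) - \<Psi>' v \<partial>unif)) / (\<alpha> / 2 * m')"
      by (rule tendsto_divide[OF J m_lim]) (use alpha m'_pos in auto)
    then have "(\<lambda>n. (\<integral>t. \<Psi> n (v + t) - \<Psi> n v \<partial>unif) / m n) \<longlonglongrightarrow> (\<integral>t. \<Psi>' (v + t) - \<Psi>' v \<partial>unif) / m'"
      using q_pos alpha by (simp add: less_imp_neq[symmetric])
    then show "(\<lambda>n. char (sinc_weighted (K n)) v) \<longlonglongrightarrow> char (?W) v"
      unfolding char_sinc_weighted[OF Kn_facts] char_sinc_weighted[OF K'_facts] m_def m'_def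
      by (rule tendsto_of_real)
  qed

  define f where "f y = indicator {2..} y / (1 - sinc y)" for y :: real
  have f_meas: "f \<in> borel_measurable borel"
    unfolding f_def using borel_measurable_sinc by measurable
  have sinc_half: "sinc y \<le> 1 / 2" if "y \<ge> 2" for y
  proof -
    have "2 * sin y \<le> y" using that sin_le_one[of y] by linarith
    then show ?thesis using that by (simp add: field_simps)
  qed
  have f_eq: "(1 - sinc y) * f y = indicator {2..} y" for y
    using sinc_half[of y] by (auto simp: f_def indicator_def)
  have f_int: "(\<lambda>n. \<integral>y. f y \<partial>sinc_weighted (K n)) \<longlonglongrightarrow> (\<integral>y. f y \<partial>?W)"
  proof (rule weak_conv_imp_bdd_ae_continuous_conv[where B=2, OF _ _ weak])
    show "real_distribution (sinc_weighted (K n))" for n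
      by (rule real_distribution_sinc_weighted[OF Kn_facts])
    show rd: "real_distribution (?W)"
      by (rule real_distribution_sinc_weighted[OF K'_facts])
    show "norm (f y) \<le> 2" for y
      using sinc_half[of y] by (auto simp: f_def indicator_def divide_simps)
    have "isCont f y" if "y \<noteq> 2" for y
    proof (cases "y < 2")
      case True
      have "\<forall>\<^sub>F z in nhds y. f z = 0"
        using eventually_nhds_in_open[of "{..<2}" y] True
        by (auto elim!: eventually_mono simp: f_def)
      then have "isCont f y \<longleftrightarrow> isCont (\<lambda>_. 0 :: real) y" by (rule isCont_cong)
      then show ?thesis by simp
    next
      case False
      with that have "y > 2" by simp
      have "\<forall>\<^sub>F z in nhds y. f z = 1 / (1 - sinc z)"
        using eventually_nhds_in_open[of "{2<..}" y] \<open>y > 2\<close>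
        by (auto elim!: eventually_mono simp: f_def)
      then have "isCont f y \<longleftrightarrow> isCont (\<lambda>z. 1 / (1 - sinc z)) y" by (rule isCont_cong)
      also have "\<dots>" by (intro continuous_intros isCont_sinc) (use sinc_half[of y] \<open>y > 2\<close> in linarith)
      finally show ?thesis .
    qed
    then have sub: "{y. \<not> isCont f y} \<subseteq> {2}" by auto
    interpret W: real_distribution "?W" by (rule rd)
    have "AE y in powr_measure \<alpha>. y \<noteq> 2"
      unfolding powr_measure_def by (subst AE_density) (use AE_lborel_singleton[of 2] in auto)
    then have "AE y in ?W. y \<noteq> 2"
      unfolding sinc_weighted_def by (subst AE_density) (use borel_measurable_sinc in auto)
    then have "emeasure (?W) {2} = 0"
      by (subst (asm) AE_iff_measurable[OF _ refl]) auto
    then show "emeasure (?W) {y. \<not> isCont f y} = 0"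
      using emeasure_mono[OF sub, of "?W"] by simp
  qed (rule f_meas)

  have Kn_tail: "(\<integral>y. f y \<partial>sinc_weighted (K n)) = ?p n / m n" for n
  proof -
    have "(\<integral>y. f y \<partial>sinc_weighted (K n)) = measure (K n) {2..} / m n"
      using sets_eq_imp_space_eq[OF K_facts(2)]
      by (simp add: integral_sinc_weighted[OF Kn_facts f_meas] f_eq m_def)
    also have "measure (K n) {2..} = ?p n"
      unfolding K_def using Y1[of n]
      by (subst measure_distr) (auto intro!: arg_cong[where f="measure M"] simp: r_def field_simps)
    finally show ?thesis .
  qed
  have tail_integrand: "(\<lambda>y. indicator {2..} y * \<bar>y\<bar> powr (- 1 - \<alpha>)) = (\<lambda>y. indicator {2..} y * y powr (- 1 - \<alpha>))"
    by (intro ext) (auto simp: indicator_def)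
  have "has_bochner_integral (powr_measure \<alpha>) (indicator {2..}) (- (2 powr (- 1 - \<alpha> + 1)) / (- 1 - \<alpha> + 1))"
    using has_bochner_integral_powr_to_inf[of "- 1 - \<alpha>" 2] alpha tail_integrand
    by (subst has_bochner_integral_powr_measure) simp_all
  then have K'_tail: "(\<integral>y. f y \<partial>?W) = 2 powr (- \<alpha>) / \<alpha> / m'"
    unfolding integral_sinc_weighted[OF K'_facts f_meas] f_eq m'_def
    by (simp add: has_bochner_integral_iff)
  have "(\<lambda>n. (m n / q n) * (?p n / m n))
      \<longlonglongrightarrow> \<alpha> / 2 * m' * (2 powr (- \<alpha>) / \<alpha> / m')"
    using tendsto_mult[OF m_lim f_int[unfolded Kn_tail K'_tail]] .
  then have "(\<lambda>n. 2 powr \<alpha> * (?p n / q n)) \<longlonglongrightarrow> 2 powr \<alpha> * (2 powr (- \<alpha>) / 2)"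
    using m_pos m'_pos alpha by (intro tendsto_mult_left) (simp add: less_imp_neq[symmetric])
  moreover have "2 powr \<alpha> * (p / q n) = Y n powr \<alpha> * p" for n p
    using Y1[of n] by (simp add: q_def r_def powr_divide)
  moreover have "2 powr \<alpha> * (2 powr (- \<alpha>) / 2) = 1 / 2"
    by (simp add: powr_minus)
  ultimately have lim: "(\<lambda>n. Y n powr \<alpha> * ?p n) \<longlonglongrightarrow> 1 / 2"
    by (simp only:)
  have "\<forall>\<^sub>F n in sequentially. X n > 1"
    using X by (simp add: filterlim_at_top_dense)
  then have "\<forall>\<^sub>F n in sequentially. Y n powr \<alpha> * ?p n
      = X n powr \<alpha> * prob {\<omega> \<in> space M. X n \<le> L \<omega>}"
    by eventually_elim (simp add: Y_def)
  from Lim_transform_eventually[OF lim this]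
  show "(\<lambda>n. X n powr \<alpha> * prob {\<omega> \<in> space M. X n \<le> L \<omega>}) \<longlonglongrightarrow> 1 / 2" .
qed

text \<open>As \<open>k \<rightarrow> \<infinity>\<close>, \<open>sinc (k (L - a))\<close> tends to the indicator of \<open>L = a\<close>. Its expectation is an average of the characteristic
function over \<open>[-k, k]\<close> up to phases, which tends to zero because the characteristic function does.\<close>

lemma stable_no_atom: "prob {\<omega> \<in> space M. L \<omega> = a} = 0"
proof -
  interpret U: prob_space unif by (rule prob_space_unif)
  define C where "C = stable_const \<alpha>"
  have C: "C > 0" unfolding C_def by (rule stable_const_pos[OF alpha])
  define K where "K k = distr M borel (\<lambda>\<omega>. real k * (L \<omega> - a))" for k
  define \<Psi> where "\<Psi> k v = 1 - cos (real k * a * v) * exp (- (C * \<bar>real k * v\<bar> powr \<alpha>))" for k v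
  have [measurable]: "\<Psi> k \<in> borel_measurable borel" for k
    unfolding \<Psi>_def by measurable
  have \<Psi>_bound: "\<bar>\<Psi> k v - 1\<bar> \<le> 1" for k v
  proof -
    have "\<bar>cos (real k * a * v)\<bar> * exp (- (C * \<bar>real k * v\<bar> powr \<alpha>)) \<le> 1 * 1"
      using C by (intro mult_mono) auto
    then show ?thesis by (simp add: \<Psi>_def abs_mult)
  qed
  have \<Psi>_bound2: "\<bar>\<Psi> k v\<bar> \<le> 2" for k v using \<Psi>_bound[of k v] by linarith
  have avg: "1 - (\<integral>\<omega>. sinc (real k * (L \<omega> - a)) \<partial>M) = (\<integral>t. \<Psi> k t \<partial>unif)" for k
  proof -
    interpret Kk: real_distribution "K k" unfolding K_def by (intro real_distribution_distr) simp
    have "has_bochner_integral (K k) (\<lambda>y. (1 - sinc y) * cos (0 * y)) (\<integral>t. \<Psi> k (0 + t) - \<Psi> k 0 \<partial>unif)"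
    proof (rule sinc_weighted_cos_integral)
      show "has_bochner_integral (K k) (\<lambda>y. 1 - cos (v * y)) (\<Psi> k v)" for v
        using stable_affine_cos_integral[of "real k" a v] by (simp add: K_def \<Psi>_def C_def)
      show "integrable unif (\<lambda>t. \<Psi> k (v + t))" for v
        by (rule U.integrable_const_bound[where B=2]) (use \<Psi>_bound2 in auto)
    qed (unfold_locales, simp)
    moreover have "\<Psi> k 0 = 0" using alpha by (simp add: \<Psi>_def)
    ultimately have "(\<integral>y. 1 - sinc y \<partial>K k) = (\<integral>t. \<Psi> k t \<partial>unif)"
      by (simp add: has_bochner_integral_iff)
    moreover have "integrable (K k) sinc"
      by (rule Kk.integrable_const_bound[where B=1]) (use abs_sinc_le_1 in auto)
    moreover have "(\<integral>y. sinc y \<partial>K k) = (\<integral>\<omega>. sinc (real k * (L \<omega> - a)) \<partial>M)"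
      unfolding K_def by (rule integral_distr) (use borel_measurable_sinc in auto)
    ultimately show ?thesis using Kk.prob_space by simp
  qed
  have "(\<lambda>k. \<integral>t. \<Psi> k t \<partial>unif) \<longlonglongrightarrow> (\<integral>t. 1 \<partial>unif)"
  proof (rule integral_dominated_convergence[where w="\<lambda>_. 2"])
    show "AE t in unif. (\<lambda>k. \<Psi> k t) \<longlonglongrightarrow> 1"
      using AE_unif_nonzero
    proof eventually_elim
      case (elim t)
      have "filterlim (\<lambda>k. real k * \<bar>t\<bar>) at_top sequentially"
        using elim filterlim_tendsto_pos_mult_at_top[OF tendsto_const _ filterlim_real_sequentially, of "\<bar>t\<bar>"]
        by (simp add: mult.commute)
      then have "filterlim (\<lambda>k. (real k * \<bar>t\<bar>) powr \<alpha>) at_top sequentially"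
        using alpha by (intro filterlim_compose[OF real_powr_at_top]) auto
      then have "filterlim (\<lambda>k. C * (real k * \<bar>t\<bar>) powr \<alpha>) at_top sequentially"
        using C by (intro filterlim_tendsto_pos_mult_at_top[OF tendsto_const])
      then have "filterlim (\<lambda>k. - (C * (real k * \<bar>t\<bar>) powr \<alpha>)) at_bot sequentially"
        by (simp add: filterlim_uminus_at_top)
      then have e: "(\<lambda>k. exp (- (C * (real k * \<bar>t\<bar>) powr \<alpha>))) \<longlonglongrightarrow> 0"
        by (rule filterlim_compose[OF exp_at_bot])
      have "(\<lambda>k. \<Psi> k t - 1) \<longlonglongrightarrow> 0"
      proof (rule Lim_null_comparison[OF _ e])
        show "\<forall>\<^sub>F k in sequentially. norm (\<Psi> k t - 1) \<le> exp (- (C * (real k * \<bar>t\<bar>) powr \<alpha>))"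
          by (intro always_eventually allI) (auto simp: \<Psi>_def abs_mult intro!: mult_left_le_one_le)
      qed
      then show ?case by (simp add: LIM_zero_iff)
    qed
  qed (use \<Psi>_bound2 in auto)
  then have "(\<lambda>k. 1 - (\<integral>t. \<Psi> k t \<partial>unif)) \<longlonglongrightarrow> 1 - 1"
    using U.prob_space by (intro tendsto_diff) auto
  then have "(\<lambda>k. \<integral>\<omega>. sinc (real k * (L \<omega> - a)) \<partial>M) \<longlonglongrightarrow> 0"
    by (simp flip: avg)
  moreover have "(\<lambda>k. \<integral>\<omega>. sinc (real k * (L \<omega> - a)) \<partial>M) \<longlonglongrightarrow> (\<integral>\<omega>. indicator {\<omega> \<in> space M. L \<omega> = a} \<omega> \<partial>M)"
  proof (rule integral_dominated_convergence[where w="\<lambda>_. 1"])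
    show "AE \<omega> in M. (\<lambda>k. sinc (real k * (L \<omega> - a))) \<longlonglongrightarrow> indicator {\<omega> \<in> space M. L \<omega> = a} \<omega>"
    proof (rule AE_I2)
      fix \<omega> assume \<omega>: "\<omega> \<in> space M"
      show "(\<lambda>k. sinc (real k * (L \<omega> - a))) \<longlonglongrightarrow> indicator {\<omega> \<in> space M. L \<omega> = a} \<omega>"
      proof (cases "L \<omega> = a")
        case True
        then show ?thesis using \<omega> by simp
      next
        case False
        have "(\<lambda>k. 1 / (real k * \<bar>L \<omega> - a\<bar>)) \<longlonglongrightarrow> 0"
          using False filterlim_tendsto_pos_mult_at_top[OF tendsto_const _ filterlim_real_sequentially, of "\<bar>L \<omega> - a\<bar>"]
          by (intro real_tendsto_divide_at_top[OF tendsto_const]) (simp add: mult.commute)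
        moreover have "\<forall>\<^sub>F k in sequentially. norm (sinc (real k * (L \<omega> - a))) \<le> 1 / (real k * \<bar>L \<omega> - a\<bar>)"
          using eventually_gt_at_top[of 0]
        proof eventually_elim
          case (elim k)
          then show ?case using False by (simp add: abs_mult divide_right_mono)
        qed
        ultimately have "(\<lambda>k. sinc (real k * (L \<omega> - a))) \<longlonglongrightarrow> 0"
          by (rule Lim_null_comparison[rotated])
        then show ?thesis using False by simp
      qed
    qed
    show "AE \<omega> in M. norm (sinc (real k * (L \<omega> - a))) \<le> 1" for k
      by (intro AE_I2) (simp only: real_norm_def abs_sinc_le_1)
    show "(\<lambda>\<omega>. sinc (real k * (L \<omega> - a))) \<in> borel_measurable M" for k
      using borel_measurable_sinc by measurable
  qed auto
  ultimately have "(\<integral>\<omega>. indicator {\<omega> \<in> space M. L \<omega> = a} \<omega> \<partial>M) = (0::real)"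
    by (rule LIMSEQ_unique[rotated])
  then show ?thesis by simp
qed

lemma measure_stable_uminus:
  assumes "A \<in> sets borel"
  shows "prob {\<omega> \<in> space M. - L \<omega> \<in> A} = prob {\<omega> \<in> space M. L \<omega> \<in> A}"
proof -
  have "measure (distr M borel (\<lambda>\<omega>. - (1 * L \<omega>))) A = measure (distr M borel (\<lambda>\<omega>. 1 * L \<omega>)) A"
    by (simp only: stable_symmetric)
  then show ?thesis
    using assms by (simp add: measure_distr vimage_def Int_def conj_commute)
qed

lemma stable_lower_tail: "prob {\<omega> \<in> space M. L \<omega> \<le> - u} = prob {\<omega> \<in> space M. u \<le> L \<omega>}"
proof -
  have "prob {\<omega> \<in> space M. - L \<omega> \<in> {u..}} = prob {\<omega> \<in> space M. L \<omega> \<in> {u..}}"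
    by (rule measure_stable_uminus) simp
  moreover have "- L \<omega> \<in> {u..} \<longleftrightarrow> L \<omega> \<le> - u" for \<omega> by auto
  ultimately show ?thesis by simp
qed

lemma stable_tail_pos: "prob {\<omega> \<in> space M. u \<le> L \<omega>} > 0"
proof -
  have "\<forall>\<^sub>F v in at_top. v powr \<alpha> * prob {\<omega> \<in> space M. v \<le> L \<omega>} > 0"
    using stable_tail by (rule order_tendstoD) simp
  moreover have "\<forall>\<^sub>F v in at_top. v \<ge> u" by (rule eventually_ge_at_top)
  ultimately have "\<forall>\<^sub>F v in at_top. v \<ge> u \<and> v powr \<alpha> * prob {\<omega> \<in> space M. v \<le> L \<omega>} > 0"
    by eventually_elim simp
  then obtain v where v: "v \<ge> u" "v powr \<alpha> * prob {\<omega> \<in> space M. v \<le> L \<omega>} > 0"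
    by (auto simp: eventually_at_top_linorder)
  have "prob {\<omega> \<in> space M. v \<le> L \<omega>} \<le> prob {\<omega> \<in> space M. u \<le> L \<omega>}"
    by (rule finite_measure_mono) (use v in auto)
  moreover have "prob {\<omega> \<in> space M. v \<le> L \<omega>} > 0"
    using v(2) by (simp add: zero_less_mult_iff)
  ultimately show ?thesis by linarith
qed

lemma stable_nonneg_half: "prob {\<omega> \<in> space M. 0 \<le> L \<omega>} \<ge> 1 / 2"
proof -
  have "1 = measure M (space M)" by (simp add: prob_space)
  also have "\<dots> \<le> measure M ({\<omega> \<in> space M. 0 \<le> L \<omega>} \<union> {\<omega> \<in> space M. L \<omega> \<le> - 0})"
    by (rule finite_measure_mono) auto
  also have "\<dots> \<le> prob {\<omega> \<in> space M. 0 \<le> L \<omega>} + prob {\<omega> \<in> space M. L \<omega> \<le> - 0}"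
    by (rule measure_Un_le) auto
  finally show ?thesis by (simp add: stable_lower_tail[of 0, simplified])
qed

text \<open>The tail at \<open>u = r / (\<epsilon> h\<^sup>1\<^sup>/\<^sup>\<alpha>)\<close>, for which \<open>u\<^sup>\<alpha> = r\<^sup>\<alpha> / (h \<epsilon>\<^sup>\<alpha>)\<close>.\<close>

lemma scaled_stable_tail:
  assumes "h > 0" "r > 0"
  shows "((\<lambda>\<epsilon>. prob {\<omega> \<in> space M. r \<le> \<epsilon> * h powr (1 / \<alpha>) * L \<omega>} / (h * \<epsilon> powr \<alpha>))
          \<longlongrightarrow> 1 / (2 * r powr \<alpha>)) (at_right 0)"
proof -
  define c where "c = h powr (1 / \<alpha>)"
  have c: "c > 0" "c powr \<alpha> = h" using assms alpha by (auto simp: c_def powr_powr)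
  have "filterlim (\<lambda>\<epsilon>. r / c * inverse \<epsilon>) at_top (at_right 0)"
    using assms c by (intro filterlim_tendsto_pos_mult_at_top[OF tendsto_const _ filterlim_inverse_at_top_right]) auto
  from filterlim_compose[OF stable_tail this]
  have lim: "((\<lambda>\<epsilon>. 1 / r powr \<alpha> * ((r / c * inverse \<epsilon>) powr \<alpha> * prob {\<omega> \<in> space M. r / c * inverse \<epsilon> \<le> L \<omega>})) \<longlongrightarrow> 1 / r powr \<alpha> * (1 / 2)) (at_right 0)"
    by (rule tendsto_mult_left)
  have "\<forall>\<^sub>F \<epsilon> in at_right 0. 1 / r powr \<alpha> * ((r / c * inverse \<epsilon>) powr \<alpha> * prob {\<omega> \<in> space M. r / c * inverse \<epsilon> \<le> L \<omega>})
     = prob {\<omega> \<in> space M. r \<le> \<epsilon> * c * L \<omega>} / (h * \<epsilon> powr \<alpha>)"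
    using eventually_at_right_less[of 0]
  proof eventually_elim
    case (elim \<epsilon>)
    have "r / c * inverse \<epsilon> \<le> x \<longleftrightarrow> r \<le> \<epsilon> * c * x" for x
      using elim c by (simp add: field_simps)
    moreover have "(r / c * inverse \<epsilon>) powr \<alpha> = r powr \<alpha> / (h * \<epsilon> powr \<alpha>)"
      using elim c assms by (simp add: powr_mult powr_divide inverse_eq_divide)
    ultimately show ?case using assms by simp
  qed
  from Lim_transform_eventually[OF lim this] show ?thesis
    by (simp add: c_def mult.commute)
qed

end


section \<open>Eigenvectors over finite index sets and simple eigenvalues\<close>

lemma bij_betw_nth_sorted_list:
  "finite I \<Longrightarrow> bij_betw ((!) (sorted_list_of_set I)) {..<card I} I"
  by (rule bij_betw_nth) auto

lemma sum_nth_sorted_list: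
  "finite I \<Longrightarrow> (\<Sum>l<card I. f (sorted_list_of_set I ! l)) = (\<Sum>y\<in>I. f y)"
  by (rule sum.reindex_bij_betw[OF bij_betw_nth_sorted_list])

lemma ball_nth_sorted_list:
  "finite I \<Longrightarrow> (\<forall>l<card I. P (sorted_list_of_set I ! l)) \<longleftrightarrow> (\<forall>x\<in>I. P x)"
proof -
  let ?l = "sorted_list_of_set I"
  assume "finite I"
  then have "(!) ?l ` {..<card I} = I" by (rule bij_betw_imp_surj_on[OF bij_betw_nth_sorted_list])
  moreover have "(\<forall>l<card I. P (?l ! l)) \<longleftrightarrow> (\<forall>x\<in>(!) ?l ` {..<card I}. P x)" by auto
  ultimately show ?thesis by simp
qed

lemma eigenvector_mat_on_iff:
  fixes I :: "'i::linorder set"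
  assumes "finite I"
  shows "eigenvector (mat_on I A) (vec_on I v) k \<longleftrightarrow>
    (\<exists>x\<in>I. v x \<noteq> 0) \<and> (\<forall>x\<in>I. (\<Sum>y\<in>I. complex_of_real (A x y) * v y) = k * v x)"
proof -
  let ?l = "sorted_list_of_set I"
  have all: "(\<forall>i<card I. P (?l ! i)) \<longleftrightarrow> (\<forall>x\<in>I. P x)" for P
    by (rule ball_nth_sorted_list[OF assms])
  have nz: "vec_on I v \<noteq> 0\<^sub>v (card I) \<longleftrightarrow> (\<exists>x\<in>I. v x \<noteq> 0)"
  proof -
    have "vec_on I v = 0\<^sub>v (card I) \<longleftrightarrow> (\<forall>i<card I. v (?l ! i) = 0)"
      by (simp add: vec_on_def vec_eq_iff)
    then show ?thesis using all[of "\<lambda>x. v x = 0"] by simp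
  qed
  have "(mat_on I A *\<^sub>v vec_on I v) $ i = (\<Sum>y\<in>I. complex_of_real (A (?l ! i) y) * v y)" if "i < card I" for i
    using that sum_nth_sorted_list[OF assms, of "\<lambda>y. complex_of_real (A (?l ! i) y) * v y"]
    by (simp add: mat_on_def vec_on_def scalar_prod_def lessThan_atLeast0)
  then have "mat_on I A *\<^sub>v vec_on I v = k \<cdot>\<^sub>v vec_on I v \<longleftrightarrow>
      (\<forall>i<card I. (\<Sum>y\<in>I. complex_of_real (A (?l ! i) y) * v y) = k * v (?l ! i))"
    by (simp add: vec_eq_iff) (simp add: mat_on_def vec_on_def)
  also have "\<dots> \<longleftrightarrow> (\<forall>x\<in>I. (\<Sum>y\<in>I. complex_of_real (A x y) * v y) = k * v x)"
    by (rule all)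
  finally show ?thesis
    using nz unfolding eigenvector_def by (simp add: mat_on_def vec_on_def)
qed

lemma eigenvalue_mat_onE:
  fixes I :: "'i::linorder set"
  assumes "finite I" "eigenvalue (mat_on I A) k"
  obtains v where "eigenvector (mat_on I A) (vec_on I v) k"
proof -
  let ?l = "sorted_list_of_set I"
  obtain w where w: "eigenvector (mat_on I A) w k" using assms(2) by (auto simp: eigenvalue_def)
  then have dim: "w \<in> carrier_vec (card I)" by (simp add: eigenvector_def mat_on_def)
  define v where "v x = w $ (THE i. i < card I \<and> ?l ! i = x)" for x
  have "v (?l ! i) = w $ i" if "i < card I" for i
  proof -
    have "(THE j. j < card I \<and> ?l ! j = ?l ! i) = i"
      using that assms(1) by (intro the_equality) (auto simp: nth_eq_iff_index_eq)
    then show ?thesis by (simp add: v_def)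
  qed
  then have "vec_on I v = w" using dim by (auto simp: vec_on_def vec_eq_iff)
  with w that show ?thesis by blast
qed

text \<open>The derivative of the characteristic polynomial is the sum of the characteristic polynomials of the principal minors
of size \<open>n - 1\<close>. At a simple root one summand is nonzero, that is, \<open>k\<close> is not an eigenvalue of the matrix with row and column
\<open>i\<close> deleted, and a vector with \<open>w $ i = 0\<close> is a vector for this smaller matrix.\<close>

lemma simple_root_injective_mat:
  fixes A :: "complex mat"
  assumes A: "A \<in> carrier_mat n n" and simple: "Polynomial.order k (char_poly A) = 1"
  obtains i where "i < n"
    "\<And>w. w \<in> carrier_vec n \<Longrightarrow> w $ i = 0 \<Longrightarrow> (\<And>j. j < n \<Longrightarrow> j \<noteq> i \<Longrightarrow> (A *\<^sub>v w) $ j = k * w $ j) \<Longrightarrow> w = 0\<^sub>v n"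
proof -
  have nz: "char_poly A \<noteq> 0" using degree_monic_char_poly[OF A] by auto
  have "pderiv (char_poly A) \<noteq> 0"
  proof
    assume "pderiv (char_poly A) = 0"
    then have "degree (char_poly A) = 0" by (simp add: pderiv_eq_0_iff)
    then have "order k (char_poly A) = 0" using order_degree[OF nz, of k] by simp
    with simple show False by simp
  qed
  then have "order k (char_poly A) = Suc (order k (pderiv (char_poly A)))"
    using order_pderiv[OF nz, of k] simple order_root[of "char_poly A" k] nz by simp
  then have "poly (pderiv (char_poly A)) k \<noteq> 0"
    using simple order_root[of "pderiv (char_poly A)" k] \<open>pderiv (char_poly A) \<noteq> 0\<close> by simp
  then have "(\<Sum>i<n. poly (char_poly (mat_delete A i i)) k) \<noteq> 0"
    by (simp add: pderiv_char_poly[OF A] poly_sum)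
  then obtain i where i: "i < n" "poly (char_poly (mat_delete A i i)) k \<noteq> 0"
    by (auto elim!: sum.not_neutral_contains_not_neutral)
  have D: "mat_delete A i i \<in> carrier_mat (n - 1) (n - 1)"
    using A by (rule mat_delete_carrier)
  have not_ev: "\<not> eigenvalue (mat_delete A i i) k"
    using eigenvalue_root_char_poly[OF D] i by simp
  show thesis
  proof (rule that[OF i(1)])
    fix w assume w: "w \<in> carrier_vec n" "w $ i = 0"
      and eq: "\<And>j. j < n \<Longrightarrow> j \<noteq> i \<Longrightarrow> (A *\<^sub>v w) $ j = k * w $ j"
    define w' where "w' = Matrix.vec (n - 1) (\<lambda>j. w $ (insert_index i j))"
    have w'_eigen: "mat_delete A i i *\<^sub>v w' = k \<cdot>\<^sub>v w'"
    proof (rule eq_vecI)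
      fix j assume "j < dim_vec (k \<cdot>\<^sub>v w')"
      then have j: "j < n - 1" by (simp add: w'_def)
      let ?j = "insert_index i j"
      have j': "?j < n" "?j \<noteq> i" using j by (auto simp: insert_index_def)
      have "(mat_delete A i i *\<^sub>v w') $ j = (\<Sum>l<n-1. A $$ (?j, insert_index i l) * w $ insert_index i l)"
      proof -
        have "mat_delete A i i $$ (j, l) = A $$ (?j, insert_index i l)" if "l < n - 1" for l
          using A j that by (auto simp: mat_delete_def insert_index_def)
        moreover have "(mat_delete A i i *\<^sub>v w') $ j = (\<Sum>l<n-1. mat_delete A i i $$ (j, l) * w $ insert_index i l)"
          using j carrier_matD[OF D] by (simp add: scalar_prod_def w'_def lessThan_atLeast0 del: mat_delete_dim)
        ultimately show ?thesis by simp
      qed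
      also have "\<dots> = (\<Sum>l\<in>insert_index i ` {..<n-1}. A $$ (?j, l) * w $ l)"
        by (subst sum.reindex) (auto intro: inj_onI simp: insert_index_def split: if_splits)
      also have "insert_index i ` {..<n-1} = {..<n} - {i}"
      proof -
        have "l \<in> insert_index i ` {..<n-1}" if "l < n" "l \<noteq> i" for l
          using that i by (intro image_eqI[of _ _ "if l < i then l else l - 1"]) (auto simp: insert_index_def)
        then show ?thesis by (auto simp: insert_index_def)
      qed
      also have "(\<Sum>l\<in>{..<n} - {i}. A $$ (?j, l) * w $ l) = (\<Sum>l<n. A $$ (?j, l) * w $ l)"
        using i w by (intro sum.mono_neutral_left) auto
      also have "\<dots> = (A *\<^sub>v w) $ ?j"
        using A w j' by (simp add: scalar_prod_def lessThan_atLeast0)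
      also have "\<dots> = k * w $ ?j" using j' by (rule eq)
      finally show "(mat_delete A i i *\<^sub>v w') $ j = (k \<cdot>\<^sub>v w') $ j" using j by (simp add: w'_def)
    qed (use D in \<open>auto simp: w'_def\<close>)
    have "w' = 0\<^sub>v (n - 1)"
    proof (rule ccontr)
      have "dim_row (mat_delete A i i) = n - 1" using D by (rule carrier_matD)
      moreover have "w' \<in> carrier_vec (n - 1)" by (simp add: w'_def)
      moreover assume "w' \<noteq> 0\<^sub>v (n - 1)"
      ultimately have "eigenvector (mat_delete A i i) w' k"
        using w'_eigen unfolding eigenvector_def by simp
      with not_ev show False unfolding eigenvalue_def by blast
    qed
    then have "w $ insert_index i l = 0" if "l < n - 1" for l
      using that by (auto simp: w'_def vec_eq_iff)
    then have "w $ l = 0" if "l < n" for l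
    proof (cases "l = i")
      case False
      have "insert_index i (if l < i then l else l - 1) = l" "(if l < i then l else l - 1) < n - 1"
        using False that i by (auto simp: insert_index_def)
      then show ?thesis using \<open>\<And>l. l < n - 1 \<Longrightarrow> w $ insert_index i l = 0\<close>[of "if l < i then l else l - 1"] by simp
    qed (use w in simp)
    then show "w = 0\<^sub>v n" using w by (auto simp: vec_eq_iff)
  qed
qed

lemma simple_eigenvalue_injective:
  fixes I :: "'i::linorder set"
  assumes "finite I" "Polynomial.order k (char_poly (mat_on I A)) = 1"
  obtains i where "i \<in> I"
    "\<And>w. w i = 0 \<Longrightarrow> (\<And>j. j \<in> I \<Longrightarrow> j \<noteq> i \<Longrightarrow> (\<Sum>y\<in>I. complex_of_real (A j y) * w y) = k * w j) \<Longrightarrow> (\<forall>j\<in>I. w j = 0)"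
proof -
  let ?l = "sorted_list_of_set I"
  have car: "mat_on I A \<in> carrier_mat (card I) (card I)" by (simp add: mat_on_def)
  obtain p where p: "p < card I" "\<And>w. w \<in> carrier_vec (card I) \<Longrightarrow> w $ p = 0 \<Longrightarrow>
      (\<And>j. j < card I \<Longrightarrow> j \<noteq> p \<Longrightarrow> (mat_on I A *\<^sub>v w) $ j = k * w $ j) \<Longrightarrow> w = 0\<^sub>v (card I)"
    using simple_root_injective_mat[OF car assms(2)] by blast
  show thesis
  proof (rule that)
    show "?l ! p \<in> I"
      using p(1) bij_betwE[OF bij_betw_nth_sorted_list[OF assms(1)]] by blast
    fix w assume w: "w (?l ! p) = 0" and eq: "\<And>j. j \<in> I \<Longrightarrow> j \<noteq> ?l ! p \<Longrightarrow> (\<Sum>y\<in>I. complex_of_real (A j y) * w y) = k * w j"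
    have "vec_on I w = 0\<^sub>v (card I)"
    proof (rule p(2))
      fix j assume j: "j < card I" "j \<noteq> p"
      have "?l ! j \<in> I"
        using j bij_betwE[OF bij_betw_nth_sorted_list[OF assms(1)]] by blast
      moreover have "?l ! j \<noteq> ?l ! p"
        using j p(1) assms(1) by (simp add: nth_eq_iff_index_eq)
      ultimately show "(mat_on I A *\<^sub>v vec_on I w) $ j = k * vec_on I w $ j"
        using j eq[of "?l ! j"] sum_nth_sorted_list[OF assms(1), of "\<lambda>y. complex_of_real (A (?l ! j) y) * w y"]
        by (simp add: mat_on_def vec_on_def scalar_prod_def lessThan_atLeast0)
    qed (use p(1) w in \<open>auto simp: vec_on_def\<close>)
    then have "\<forall>i<card I. w (?l ! i) = 0" by (auto simp: vec_on_def vec_eq_iff)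
    then show "\<forall>j\<in>I. w j = 0"
      using ball_nth_sorted_list[OF assms(1), of "\<lambda>x. w x = 0"] by simp
  qed
qed

text \<open>Bolzano-Weierstrass, one coordinate after the other.\<close>

lemma finite_family_convergent_subseq:
  fixes f :: "'i \<Rightarrow> nat \<Rightarrow> complex"
  assumes "finite I" "\<And>i. i \<in> I \<Longrightarrow> bounded (range (f i))"
  shows "\<exists>r l. strict_mono r \<and> (\<forall>i\<in>I. (\<lambda>k. f i (r k)) \<longlonglongrightarrow> l i)"
  using assms
proof (induction I rule: finite_induct)
  case empty
  show ?case by (rule exI[of _ id]) (simp add: strict_mono_id)
next
  case (insert i I)
  then obtain r l where r: "strict_mono r" "\<forall>j\<in>I. (\<lambda>k. f j (r k)) \<longlonglongrightarrow> l j" by auto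
  have "bounded (range (f i \<circ> r))"
    using insert.prems[of i] by (auto intro: bounded_subset)
  from bounded_imp_convergent_subsequence[OF this] obtain c r' where
    r': "strict_mono r'" "((f i \<circ> r) \<circ> r') \<longlonglongrightarrow> c" by auto
  have "(\<lambda>k. f j ((r \<circ> r') k)) \<longlonglongrightarrow> (l(i := c)) j" if "j \<in> insert i I" for j
  proof (cases "j = i")
    case True
    then show ?thesis using r'(2) by (simp add: comp_def)
  next
    case False
    then have "(\<lambda>k. f j (r k)) \<longlonglongrightarrow> l j" using that r by auto
    from LIMSEQ_subseq_LIMSEQ[OF this r'(1)] show ?thesis using False by (simp add: comp_def)
  qed
  then show ?case using r(1) r'(1) by (blast intro: strict_mono_o)
qed

text \<open>If no constant worked, vectors of maximum norm one would have images tending to zero, and a convergent subsequence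
would have a nonzero limit with image zero.\<close>

lemma injective_imp_bounded_below:
  fixes A :: "'j \<Rightarrow> 'i \<Rightarrow> complex"
  assumes I: "finite I" and J: "finite J"
    and inj: "\<And>v. (\<forall>j\<in>J. (\<Sum>i\<in>I. A j i * v i) = 0) \<Longrightarrow> \<forall>i\<in>I. v i = 0"
  obtains C where "C > 0" "\<And>v B i. (\<And>j. j \<in> J \<Longrightarrow> cmod (\<Sum>i\<in>I. A j i * v i) \<le> B) \<Longrightarrow> 0 \<le> B \<Longrightarrow> i \<in> I \<Longrightarrow> cmod (v i) \<le> C * B"
proof (rule ccontr)
  assume neg: "\<not> thesis"
  have "\<exists>v B i. (\<forall>j\<in>J. cmod (\<Sum>i\<in>I. A j i * v i) \<le> B) \<and> 0 \<le> B \<and> i \<in> I \<and> cmod (v i) > real (Suc k) * B" for k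
  proof (rule ccontr)
    assume "\<not> ?thesis"
    then have *: "cmod (v i) \<le> real (Suc k) * B"
      if "\<And>j. j \<in> J \<Longrightarrow> cmod (\<Sum>i\<in>I. A j i * v i) \<le> B" "0 \<le> B" "i \<in> I" for v B i
      using that by (meson not_le)
    have thesis by (rule that[of "real (Suc k)"], simp, rule *)
    with neg show False by blast
  qed
  then have "\<forall>k. \<exists>t. (\<forall>j\<in>J. cmod (\<Sum>i\<in>I. A j i * fst t i) \<le> fst (snd t)) \<and> 0 \<le> fst (snd t) \<and>
      snd (snd t) \<in> I \<and> cmod (fst t (snd (snd t))) > real (Suc k) * fst (snd t)" (is "\<forall>k. \<exists>t. ?R k t")
    by (simp del: of_nat_Suc)
  from choice[OF this] obtain t where t: "\<And>k. ?R k (t k)" by blast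
  define v where "v k = fst (t k)" for k
  define B where "B k = fst (snd (t k))" for k
  define i where "i k = snd (snd (t k))" for k
  have *: "\<And>k j. j \<in> J \<Longrightarrow> cmod (\<Sum>i\<in>I. A j i * v k i) \<le> B k" "\<And>k. 0 \<le> B k"
    "\<And>k. i k \<in> I" "\<And>k. cmod (v k (i k)) > real (Suc k) * B k"
    using t by (simp_all add: v_def B_def i_def del: of_nat_Suc)
  define N where "N k = Max ((\<lambda>i. cmod (v k i)) ` I)" for k
  have N_ge: "cmod (v k x) \<le> N k" if "x \<in> I" for k x
    unfolding N_def using that I by (intro Max_ge) auto
  have N_att: "\<exists>x\<in>I. cmod (v k x) = N k" for k
  proof -
    have "N k \<in> (\<lambda>i. cmod (v k i)) ` I"
      unfolding N_def using I *(3) by (intro Max_in) auto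
    then show ?thesis by auto
  qed
  have NB: "N k > real (Suc k) * B k" for k using N_ge[OF *(3)[of k], of k] *(4)[of k] by linarith
  have N_pos: "N k > 0" for k
    using NB[of k] mult_nonneg_nonneg[of "real (Suc k)" "B k"] *(2)[of k] by linarith
  define w where "w x k = v k x / N k" for x k
  have "bounded (range (w x))" if "x \<in> I" for x
    using N_ge[OF that] N_pos
    by (intro boundedI[of _ 1]) (auto simp: w_def norm_divide abs_of_pos divide_simps)
  then obtain r l where r: "strict_mono r" "\<forall>x\<in>I. (\<lambda>k. w x (r k)) \<longlonglongrightarrow> l x"
    using finite_family_convergent_subseq[OF I, of w] by blast
  have "(\<Sum>x\<in>I. A j x * l x) = 0" if "j \<in> J" for j
  proof (rule LIMSEQ_unique)
    show "(\<lambda>k. \<Sum>x\<in>I. A j x * w x (r k)) \<longlonglongrightarrow> (\<Sum>x\<in>I. A j x * l x)"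
      using r by (intro tendsto_sum tendsto_mult_left) auto
    have "(\<Sum>x\<in>I. A j x * w x k) = (\<Sum>x\<in>I. A j x * v k x) / N k" for k
      by (simp add: w_def sum_divide_distrib)
    then have "cmod (\<Sum>x\<in>I. A j x * w x k) \<le> 1 / real (Suc k)" for k
    proof -
      have "cmod (\<Sum>x\<in>I. A j x * v k x) \<le> N k / real (Suc k)"
      proof -
        have "real (Suc k) * cmod (\<Sum>x\<in>I. A j x * v k x) \<le> real (Suc k) * B k"
          by (rule mult_left_mono[OF *(1)[OF that, of k]]) simp
        then have "real (Suc k) * cmod (\<Sum>x\<in>I. A j x * v k x) \<le> N k" using NB[of k] by linarith
        then show ?thesis by (simp add: pos_le_divide_eq mult.commute del: of_nat_Suc)
      qed
      then have "cmod (\<Sum>x\<in>I. A j x * v k x) / N k \<le> N k / real (Suc k) / N k"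
        using N_pos[of k] by (intro divide_right_mono) auto
      then show ?thesis
        using N_pos[of k] \<open>\<And>k. (\<Sum>x\<in>I. A j x * w x k) = (\<Sum>x\<in>I. A j x * v k x) / N k\<close>[of k]
        by (simp add: norm_divide del: of_nat_Suc)
    qed
    then have "(\<lambda>k. \<Sum>x\<in>I. A j x * w x k) \<longlonglongrightarrow> 0"
      by (intro Lim_null_comparison[OF _ LIMSEQ_Suc[OF lim_1_over_n]]) auto
    from LIMSEQ_subseq_LIMSEQ[OF this r(1)]
    show "(\<lambda>k. \<Sum>x\<in>I. A j x * w x (r k)) \<longlonglongrightarrow> 0" by (simp add: comp_def)
  qed
  then have l0: "\<forall>x\<in>I. l x = 0" using inj by blast
  have "(\<lambda>k. \<Sum>x\<in>I. cmod (w x (r k))) \<longlonglongrightarrow> (\<Sum>x\<in>I. cmod (l x))"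
    using r by (intro tendsto_sum tendsto_norm) auto
  then have "(\<lambda>k. \<Sum>x\<in>I. cmod (w x (r k))) \<longlonglongrightarrow> 0" using l0 by simp
  moreover have "1 \<le> (\<Sum>x\<in>I. cmod (w x k))" for k
  proof -
    obtain x where "x \<in> I" "cmod (v k x) = N k" using N_att by blast
    then have "1 = cmod (w x k)" using N_pos[of k] by (simp add: w_def norm_divide)
    also have "\<dots> \<le> (\<Sum>x\<in>I. cmod (w x k))" using I \<open>x \<in> I\<close> by (intro member_le_sum) auto
    finally show ?thesis .
  qed
  ultimately have "(1::real) \<le> 0" by (intro LIMSEQ_le_const) auto
  then show False by simp
qed


section \<open>Cells, wells and the unperturbed dynamics\<close>

locale discretized_potential =
  fixes U :: "real \<Rightarrow> real" and n :: nat and m s :: "nat \<Rightarrow> real"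
    and R h \<delta> :: real and S :: "real set" and a b :: "real \<Rightarrow> real"
  assumes potential: "multiwell_potential U n m s"
    and discretization: "discretization U n m s R h \<delta> S a b"
    and no_saddle_hit: "\<forall>x\<in>S. \<forall>j\<in>{1..<n}. x - h * deriv U x \<noteq> s j"
begin

abbreviation "\<Sigma> \<equiv> saddle n s"
abbreviation "W \<equiv> well n s S"
abbreviation "T \<equiv> drift_map U h S a b"

definition target :: "real \<Rightarrow> real" where "target x = x - h * deriv U x"

text \<open>The half-open interval between consecutive saddles, unlike \<open>well\<close>, which is a subset of \<open>S\<close>.\<close>

definition region :: "nat \<Rightarrow> real set" where
  "region k = {z. \<Sigma> (k - 1) \<le> ereal z \<and> ereal z < \<Sigma> k}"

text \<open>The set of positions that the chain rounds to \<open>y\<close>: the interval of \<open>y\<close>, extended to infinity for the two extreme points. These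
sets partition the line.\<close>

definition cell :: "real \<Rightarrow> real set" where
  "cell y = {z. (y = Min S \<or> a y \<le> z) \<and> (y = Max S \<or> z < b y)}"

definition well_index :: "real \<Rightarrow> nat" where
  "well_index x = (THE j. j \<in> {1..n} \<and> x \<in> W j)"

definition bottom :: "real \<Rightarrow> real" where "bottom x = m (well_index x)"

lemma n_ge: "n \<ge> 2" and minimum_between_saddles: "j \<in> {1..n} \<Longrightarrow> \<Sigma> (j - 1) < ereal (m j) \<and> ereal (m j) < \<Sigma> j"
  using potential by (auto simp: multiwell_potential_def)

lemma h_pos: "h > 0" and finite_S [simp]: "finite S" and minima_in_S: "j \<in> {1..n} \<Longrightarrow> m j \<in> S"
  using discretization by (auto simp: discretization_def)

lemma deriv_minimum: "j \<in> {1..n} \<Longrightarrow> deriv U (m j) = 0"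
proof -
  assume "j \<in> {1..n}"
  then have "local_min_at U (m j)" using potential by (auto simp: multiwell_potential_def)
  then obtain d where d: "d > 0" "\<forall>y. \<bar>m j - y\<bar> < d \<longrightarrow> U (m j) \<le> U y"
    by (auto simp: local_min_at_def eventually_nhds_metric dist_real_def abs_minus_commute)
  have "((deriv ^^ 0) U) field_differentiable at (m j)"
    using potential unfolding multiwell_potential_def C3_def by (metis zero_less_numeral)
  then have "DERIV U (m j) :> deriv U (m j)" by (simp add: DERIV_deriv_iff_field_differentiable)
  then show ?thesis using d by (rule DERIV_local_min)
qed

lemma saddle_simps [simp]: "\<Sigma> 0 = - \<infinity>" "\<Sigma> n = \<infinity>"
  using n_ge by (simp_all add: saddle_def)

lemma saddle_eq: "j \<in> {1..<n} \<Longrightarrow> \<Sigma> j = ereal (s j)"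
  by (simp add: saddle_def)

lemma saddle_mono: "j \<le> k \<Longrightarrow> k \<le> n \<Longrightarrow> \<Sigma> j \<le> \<Sigma> k"
proof (induction k rule: dec_induct)
  case (step k)
  then have "\<Sigma> k < \<Sigma> (Suc k)" using minimum_between_saddles[of "Suc k"] by auto
  with step show ?case by auto
qed simp

lemma region_cover: "\<exists>k\<in>{1..n}. z \<in> region k"
proof -
  define k where "k = (LEAST k. ereal z < \<Sigma> k)"
  have k: "ereal z < \<Sigma> k" "k \<le> n"
    unfolding k_def by (rule LeastI[of _ n], simp) (rule Least_le, simp)
  have "k \<noteq> 0" using k(1) by (cases k) auto
  then have "\<not> ereal z < \<Sigma> (k - 1)"
    unfolding k_def by (metis diff_less not_less_Least less_numeral_extra(1) neq0_conv)
  with k \<open>k \<noteq> 0\<close> show ?thesis by (intro bexI[of _ k]) (auto simp: region_def)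
qed

lemma region_unique:
  assumes "z \<in> region j" "z \<in> region k" "j \<in> {1..n}" "k \<in> {1..n}"
  shows "j = k"
proof -
  have *: False if "z \<in> region i" "z \<in> region l" "i < l" "l \<le> n" for i l
  proof -
    have "ereal z < \<Sigma> i" using that by (simp add: region_def)
    also have "\<Sigma> i \<le> \<Sigma> (l - 1)" using that by (intro saddle_mono) auto
    also have "\<dots> \<le> ereal z" using that by (simp add: region_def)
    finally show False by simp
  qed
  show ?thesis using *[of j k] *[of k j] assms by (cases j k rule: linorder_cases) auto
qed

lemma well_subset_region: "W j \<subseteq> region j" and well_subset_S: "W j \<subseteq> S"
  by (auto simp: well_def region_def)

lemma minimum_in_well: "j \<in> {1..n} \<Longrightarrow> m j \<in> W j"
  using minimum_between_saddles minima_in_S by (auto simp: well_def)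

lemma cells_disjoint: "disjoint_family_on (\<lambda>x. {a x..<b x}) S"
  using discretization unfolding discretization_def by (elim conjE)

lemma cells_Union: "(\<Union>x\<in>S. {a x..<b x}) = {- R..<R}"
  using discretization unfolding discretization_def by (elim conjE)

lemma cells_contain: "\<forall>x\<in>S. {a x..<b x} \<inter> S = {x} \<and> x \<in> {a x<..<b x}"
  using discretization unfolding discretization_def by (elim conjE)

lemma saddles_are_ends: "{- R, R} \<union> s ` {1..<n} \<subseteq> a ` S \<union> b ` S"
  using discretization unfolding discretization_def by (elim conjE)

lemma drift_target_unique: "\<forall>x\<in>S. \<exists>!y. y \<in> S \<and> x - h * deriv U x \<in> {a y..<b y}"
  using discretization unfolding discretization_def by (elim conjE)

lemma wells_attracted: "\<forall>j\<in>{1..n}. \<forall>x\<in>W j. \<exists>k. (T ^^ k) x = m j"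
  using discretization unfolding discretization_def by (elim conjE)

lemma cell_ends: "y \<in> S \<Longrightarrow> a y < y \<and> y < b y"
  using cells_contain by simp

lemma cell_disjoint_raw: "x \<in> S \<Longrightarrow> y \<in> S \<Longrightarrow> z \<in> {a x..<b x} \<Longrightarrow> z \<in> {a y..<b y} \<Longrightarrow> x = y"
  using cells_disjoint unfolding disjoint_family_on_def by blast

lemma cell_cover_raw: "z \<in> {- R..<R} \<Longrightarrow> \<exists>y\<in>S. z \<in> {a y..<b y}"
  unfolding cells_Union[symmetric] by blast

lemma cell_range_raw: "y \<in> S \<Longrightarrow> {a y..<b y} \<subseteq> {- R..<R}"
  unfolding cells_Union[symmetric] by blast

lemma cell_bounds: assumes "y \<in> S" shows "- R \<le> a y" "b y \<le> R"
proof -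
  have ab: "a y < b y" using cell_ends[OF assms] by simp
  then show "- R \<le> a y" using cell_range_raw[OF assms] by auto
  show "b y \<le> R"
  proof (rule ccontr)
    assume "\<not> b y \<le> R"
    then have "max (a y) R \<in> {a y..<b y}" using ab by auto
    with cell_range_raw[OF assms] have "max (a y) R \<in> {- R..<R}" by blast
    then show False by auto
  qed
qed

lemma S_nonempty: "S \<noteq> {}"
  using minima_in_S[of 1] n_ge by auto

lemma Min_Max_in_S: "Min S \<in> S" "Max S \<in> S"
  using S_nonempty by auto

lemma R_pos: "R > 0" using discretization by (simp add: discretization_def)

lemma leftmost_cell: "a (Min S) = - R"
proof -
  have "- R \<in> {- R..<R}" using R_pos by simp
  then obtain y where y: "y \<in> S" "- R \<in> {a y..<b y}" using cell_cover_raw by blast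
  have "- R \<le> a (Min S)" "a (Min S) < Min S" "Min S \<le> y" "y < b y"
    using cell_bounds cell_ends Min_Max_in_S y by auto
  moreover have "a y \<le> - R" using y by simp
  ultimately have "Min S \<in> {a y..<b y}" unfolding atLeastLessThan_iff by linarith
  moreover have "Min S \<in> {a (Min S)..<b (Min S)}" using cell_ends[OF Min_Max_in_S(1)] by auto
  ultimately have "Min S = y" using cell_disjoint_raw y Min_Max_in_S by blast
  then show ?thesis using y cell_bounds(1)[OF y(1)] by auto
qed

lemma rightmost_cell: "b (Max S) = R"
proof (rule ccontr)
  assume "b (Max S) \<noteq> R"
  then have lt: "b (Max S) < R" using cell_bounds(2)[OF Min_Max_in_S(2)] by simp
  have M: "a (Max S) < Max S" "Max S < b (Max S)" "- R \<le> a (Max S)"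
    using cell_ends cell_bounds Min_Max_in_S by auto
  then have "b (Max S) \<in> {- R..<R}" using lt by auto
  then obtain y where y: "y \<in> S" "b (Max S) \<in> {a y..<b y}" using cell_cover_raw by blast
  have "a y < y" "y \<le> Max S" "b (Max S) < b y" using cell_ends y by auto
  then have "Max S \<in> {a y..<b y}" using M unfolding atLeastLessThan_iff by linarith
  moreover have "Max S \<in> {a (Max S)..<b (Max S)}" using M by auto
  ultimately have "Max S = y" using cell_disjoint_raw y Min_Max_in_S by blast
  then show False using y by auto
qed

lemma interval_subset_cell: "{a y..<b y} \<subseteq> cell y"
  by (auto simp: cell_def)

lemma cell_cover: "\<exists>y\<in>S. z \<in> cell y"
proof -
  consider "z < - R" | "z \<in> {- R..<R}" | "z \<ge> R" by force
  then show ?thesis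
  proof cases
    case 1
    then have "z \<in> cell (Min S)"
      using cell_bounds(1)[OF Min_Max_in_S(1)] cell_ends[OF Min_Max_in_S(1)] by (auto simp: cell_def)
    then show ?thesis using Min_Max_in_S by blast
  next
    case 2
    then show ?thesis using cell_cover_raw interval_subset_cell by blast
  next
    case 3
    then have "z \<in> cell (Max S)"
      using cell_bounds(2)[OF Min_Max_in_S(2)] cell_ends[OF Min_Max_in_S(2)] by (auto simp: cell_def)
    then show ?thesis using Min_Max_in_S by blast
  qed
qed

lemma cell_disjoint:
  assumes "x \<in> S" "y \<in> S" "z \<in> cell x" "z \<in> cell y"
  shows "x = y"
proof -
  consider "z < - R" | "z \<in> {- R..<R}" | "z \<ge> R" by force
  then show ?thesis
  proof cases
    case 1
    have "u = Min S" if "u \<in> S" "z \<in> cell u" for u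
      using that 1 cell_bounds(1)[of u] by (auto simp: cell_def)
    then show ?thesis using assms by metis
  next
    case 2
    have "z \<in> {a u..<b u}" if "u \<in> S" "z \<in> cell u" for u
      using that 2 leftmost_cell rightmost_cell by (auto simp: cell_def)
    then show ?thesis using assms cell_disjoint_raw by blast
  next
    case 3
    have "u = Max S" if "u \<in> S" "z \<in> cell u" for u
      using that 3 cell_bounds(2)[of u] by (auto simp: cell_def)
    then show ?thesis using assms by metis
  qed
qed

text \<open>A saddle is an endpoint of some cell, so a cell with the saddle in its interior would overlap that cell.\<close>

lemma saddle_not_inside_cell:
  assumes y: "y \<in> S" and j: "j \<in> {1..<n}"
  shows "\<not> (a y < s j \<and> s j < b y)"
proof
  assume in_y: "a y < s j \<and> s j < b y"
  have "s j \<in> a ` S \<union> b ` S" using saddles_are_ends j by blast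
  then obtain w where w: "w \<in> S" "s j = a w \<or> s j = b w" by auto
  have "a w < b w" using cell_ends[OF w(1)] by simp
  from w(2) show False
  proof
    assume eq: "s j = a w"
    then have "w = y" using cell_disjoint_raw[OF w(1) y, of "s j"] in_y \<open>a w < b w\<close> by auto
    then show False using in_y eq by simp
  next
    assume eq: "s j = b w"
    then have "w = y" using cell_disjoint_raw[OF w(1) y, of "max (a w) (a y)"] in_y \<open>a w < b w\<close> by auto
    then show False using in_y eq by simp
  qed
qed

lemma in_some_well: assumes "y \<in> S" shows "\<exists>k\<in>{1..n}. y \<in> W k"
proof -
  obtain k where k: "k \<in> {1..n}" "y \<in> region k" using region_cover by blast
  have "\<Sigma> (k - 1) \<noteq> ereal y"
  proof (cases "k = 1")
    case False
    then have "k - 1 \<in> {1..<n}" using k by auto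
    then show ?thesis
      using saddle_not_inside_cell[OF assms, of "k - 1"] cell_ends[OF assms] by (auto simp: saddle_eq)
  qed simp
  then show ?thesis using k assms by (intro bexI[of _ k]) (auto simp: region_def well_def less_le)
qed

lemma well_unique: "x \<in> W j \<Longrightarrow> x \<in> W k \<Longrightarrow> j \<in> {1..n} \<Longrightarrow> k \<in> {1..n} \<Longrightarrow> j = k"
  using region_unique well_subset_region by blast

lemma well_index: assumes "x \<in> S" shows "well_index x \<in> {1..n}" "x \<in> W (well_index x)"
proof -
  have "\<exists>!j. j \<in> {1..n} \<and> x \<in> W j" using in_some_well[OF assms] well_unique by blast
  from theI'[OF this] show "well_index x \<in> {1..n}" "x \<in> W (well_index x)"
    unfolding well_index_def by auto
qed

lemma well_index_eq: "x \<in> W j \<Longrightarrow> j \<in> {1..n} \<Longrightarrow> well_index x = j"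
  using well_index[of x] well_unique well_subset_S by blast

lemma well_index_minimum: "j \<in> {1..n} \<Longrightarrow> well_index (m j) = j"
  by (rule well_index_eq[OF minimum_in_well])

lemma m_inj: "j \<in> {1..n} \<Longrightarrow> k \<in> {1..n} \<Longrightarrow> m j = m k \<Longrightarrow> j = k"
  using well_index_minimum by metis

lemma bottom_minimum: "j \<in> {1..n} \<Longrightarrow> bottom (m j) = m j"
  by (simp add: bottom_def well_index_minimum)

lemma well_eq: "k \<in> {1..n} \<Longrightarrow> W k = {x \<in> S. well_index x = k}"
  using well_index well_index_eq well_subset_S by blast

lemma cell_subset_region:
  assumes k: "k \<in> {1..n}" and y: "y \<in> W k"
  shows "cell y \<subseteq> region k"
proof
  fix z assume z: "z \<in> cell y"
  have yS: "y \<in> S" using y well_subset_S by blast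
  have ab: "a y < y" "y < b y" using cell_ends[OF yS] by auto
  have "\<Sigma> (k - 1) \<le> ereal z"
  proof (cases "k = 1")
    case False
    then have k1: "k - 1 \<in> {1..<n}" "k - 1 \<in> {1..n}" using k by auto
    have sy: "s (k - 1) < y" using y k1 by (auto simp: well_def saddle_eq)
    have "m (k - 1) < s (k - 1)" using minimum_between_saddles[OF k1(2)] k1 by (simp add: saddle_eq)
    moreover have "Min S \<le> m (k - 1)" using minima_in_S[OF k1(2)] by simp
    ultimately have "y \<noteq> Min S" using sy by linarith
    then have "a y \<le> z" using z by (auto simp: cell_def)
    then have "s (k - 1) \<le> z"
      using saddle_not_inside_cell[OF yS k1(1)] sy ab by linarith
    then show ?thesis unfolding saddle_eq[OF k1(1)] by simp
  qed simp
  moreover have "ereal z < \<Sigma> k"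
  proof (cases "k = n")
    case False
    then have k1: "k \<in> {1..<n}" "k + 1 \<in> {1..n}" using k by auto
    have sy: "y < s k" using y k1 by (auto simp: well_def saddle_eq)
    have "s k < m (k + 1)" using minimum_between_saddles[OF k1(2)] k1 by (simp add: saddle_eq)
    moreover have "m (k + 1) \<le> Max S" using minima_in_S[OF k1(2)] by simp
    ultimately have "y \<noteq> Max S" using sy by linarith
    then have "z < b y" using z by (auto simp: cell_def)
    then have "z < s k"
      using saddle_not_inside_cell[OF yS k1(1)] sy ab by linarith
    then show ?thesis unfolding saddle_eq[OF k1(1)] by simp
  qed simp
  ultimately show "z \<in> region k" by (simp add: region_def)
qed

lemma region_iff_well:
  assumes "k \<in> {1..n}" "y \<in> S" "z \<in> cell y"
  shows "z \<in> region k \<longleftrightarrow> y \<in> W k"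
  using assms cell_subset_region[OF well_index[OF assms(2)]] cell_subset_region region_unique
    well_index[OF assms(2)] by blast

lemma T_props: assumes "x \<in> S" shows "T x \<in> S" "target x \<in> {a (T x)..<b (T x)}"
proof -
  have "\<exists>!y. y \<in> S \<and> x - h * deriv U x \<in> {a y..<b y}"
    using drift_target_unique assms by blast
  from theI'[OF this] show "T x \<in> S" "target x \<in> {a (T x)..<b (T x)}"
    unfolding drift_map_def target_def by auto
qed

lemma target_minimum: "j \<in> {1..n} \<Longrightarrow> target (m j) = m j"
  by (simp add: target_def deriv_minimum)

text \<open>The derivative vanishes at a minimum, so the drift does not move it.\<close>

lemma T_minimum: assumes "j \<in> {1..n}" shows "T (m j) = m j"
proof (rule cell_disjoint_raw)
  show "m j \<in> {a (T (m j))..<b (T (m j))}"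
    using T_props(2)[OF minima_in_S[OF assms]] by (simp add: target_minimum[OF assms])
  show "m j \<in> {a (m j)..<b (m j)}" using cell_ends[OF minima_in_S[OF assms]] by auto
qed (use T_props minima_in_S assms in auto)

lemma T_pow_minimum: "j \<in> {1..n} \<Longrightarrow> (T ^^ k) (m j) = m j"
  by (induction k) (auto simp: T_minimum)

lemma reaches_bottom: assumes "x \<in> S" shows "\<exists>k. (T ^^ k) x = bottom x"
  using wells_attracted well_index[OF assms] unfolding bottom_def by blast

lemma reaches_bottom_uniform: "\<exists>N. \<forall>x\<in>S. (T ^^ N) x = bottom x"
proof -
  obtain k where k: "\<And>x. x \<in> S \<Longrightarrow> (T ^^ k x) x = bottom x" using reaches_bottom by metis
  have "(T ^^ (\<Sum>x\<in>S. k x)) x = bottom x" if "x \<in> S" for x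
  proof -
    have "k x \<le> (\<Sum>x\<in>S. k x)" using that by (intro member_le_sum) auto
    then have "(T ^^ (\<Sum>x\<in>S. k x)) x = (T ^^ ((\<Sum>x\<in>S. k x) - k x)) ((T ^^ k x) x)"
      by (simp flip: funpow_add comp_apply[of "T ^^ _" "T ^^ _"])
    also have "\<dots> = bottom x"
      using k[OF that] T_pow_minimum well_index[OF that] by (simp add: bottom_def)
    finally show ?thesis .
  qed
  then show ?thesis by blast
qed

text \<open>The orbits of \<open>x\<close> and of \<open>T x\<close> end at the same fixed point.\<close>

lemma well_index_T: assumes "x \<in> S" shows "well_index (T x) = well_index x"
proof -
  obtain N where N: "\<And>x. x \<in> S \<Longrightarrow> (T ^^ N) x = bottom x" using reaches_bottom_uniform by blast
  have "bottom (T x) = (T ^^ N) (T x)" using N T_props[OF assms] by simp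
  also have "\<dots> = T ((T ^^ N) x)" by (simp add: funpow_swap1)
  also have "\<dots> = bottom x" using N[OF assms] T_minimum well_index[OF assms] by (simp add: bottom_def)
  finally show ?thesis
    using m_inj well_index[OF assms] well_index[OF T_props(1)[OF assms]] by (simp add: bottom_def)
qed

lemma neighbourhood_in_region:
  assumes "\<Sigma> (j - 1) < ereal z" "ereal z < \<Sigma> j"
  obtains \<rho> where "\<rho> > 0" "\<And>y. \<bar>y\<bar> < \<rho> \<Longrightarrow> z + y \<in> region j"
proof -
  have "\<exists>\<rho>>0. e < ereal (z - \<rho>)" if "e < ereal z" for e
    using that by (cases e) (auto intro: exI[of _ "(z - real_of_ereal e) / 2"] exI[of _ 1] simp: field_simps)
  then obtain \<rho>1 where 1: "\<rho>1 > 0" "\<Sigma> (j - 1) < ereal (z - \<rho>1)" using assms(1) by blast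
  have "\<exists>\<rho>>0. ereal (z + \<rho>) < e" if "ereal z < e" for e
    using that by (cases e) (auto intro: exI[of _ "(real_of_ereal e - z) / 2"] exI[of _ 1] simp: field_simps)
  then obtain \<rho>2 where 2: "\<rho>2 > 0" "ereal (z + \<rho>2) < \<Sigma> j" using assms(2) by blast
  show thesis
  proof (rule that[of "min \<rho>1 \<rho>2"])
    fix y assume "\<bar>y\<bar> < min \<rho>1 \<rho>2"
    then have "ereal (z - \<rho>1) \<le> ereal (z + y)" "ereal (z + y) \<le> ereal (z + \<rho>2)" by auto
    then show "z + y \<in> region j"
      using 1(2) 2(2) unfolding region_def mem_Collect_eq by (meson less_imp_le order.trans order.strict_trans1)
  qed (use 1 2 in auto)
qed

text \<open>The target lies in the region of the well of \<open>x\<close> and is not a saddle, so it is an interior point of that region. It may lie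
on the boundary of a cell; then \<open>P\<^sup>\<epsilon>\<close> does not converge to a deterministic matrix, but both cells belong to the same well.\<close>

lemma target_neighbourhood:
  assumes "x \<in> S"
  obtains \<rho> where "\<rho> > 0" "\<And>y. \<bar>y\<bar> < \<rho> \<Longrightarrow> target x + y \<in> region (well_index x)"
proof -
  let ?j = "well_index x"
  have j: "?j \<in> {1..n}" using well_index[OF assms] by simp
  have "T x \<in> W ?j" using well_index[OF T_props(1)[OF assms]] well_index_T[OF assms] by simp
  then have reg: "target x \<in> region ?j"
    using T_props(2)[OF assms] interval_subset_cell cell_subset_region[OF j] by blast
  have "\<Sigma> (?j - 1) \<noteq> ereal (target x)"
  proof (cases "?j = 1")
    case False
    then have j': "?j - 1 \<in> {1..<n}" using j by auto
    have "target x \<noteq> s (?j - 1)" using no_saddle_hit assms j' unfolding target_def by blast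
    then show ?thesis unfolding saddle_eq[OF j'] by simp
  qed simp
  then show thesis
    using reg neighbourhood_in_region[of ?j "target x"] that by (auto simp: region_def less_le)
qed

lemma Min_neq_Max: "Min S \<noteq> Max S"
proof
  assume "Min S = Max S"
  then have "\<And>x. x \<in> S \<Longrightarrow> x = Min S" by (metis Max_ge Min_le antisym finite_S)
  then have "m 1 = m 2" using minima_in_S[of 1] minima_in_S[of 2] n_ge by (metis atLeastAtMost_iff one_le_numeral order_refl order_trans)
  then show False using m_inj[of 1 2] n_ge by auto
qed

end


section \<open>Almost harmonic functions are almost constant on basins\<close>

text \<open>Let \<open>D\<close> be the largest distance of \<open>w\<close> from its value at the end point \<open>c x\<close> of the \<open>T\<close>-orbit. One step of \<open>P\<close> follows the
orbit with probability at least \<open>1/4\<close>, and otherwise, up to leaking, it sees a distance of at most \<open>D\<close>. By induction on the number \<open>k\<close> of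
steps to the end point, the distance at \<open>x\<close> is at most \<open>(1 - 4\<^sup>-\<^sup>k) D\<close> plus an error; taking \<open>x\<close> with distance \<open>D\<close> and \<open>k = N\<close> bounds \<open>D\<close>.\<close>

lemma oscillation_bound:
  fixes P :: "'x \<Rightarrow> 'x \<Rightarrow> real" and w :: "'x \<Rightarrow> complex" and T c :: "'x \<Rightarrow> 'x"
  assumes S: "finite S" and P_nonneg: "\<And>x y. x \<in> S \<Longrightarrow> y \<in> S \<Longrightarrow> 0 \<le> P x y"
    and rows: "\<And>x. x \<in> S \<Longrightarrow> (\<Sum>y\<in>S. P x y) = 1"
    and T: "\<And>x. x \<in> S \<Longrightarrow> T x \<in> S" "\<And>x. x \<in> S \<Longrightarrow> c (T x) = c x" "\<And>x. x \<in> S \<Longrightarrow> P x (T x) \<ge> 1 / 4"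
    and N: "\<And>x. x \<in> S \<Longrightarrow> (T ^^ N) x = c x" and c: "\<And>x. x \<in> S \<Longrightarrow> c x \<in> S"
    and leak: "\<And>x. x \<in> S \<Longrightarrow> (\<Sum>y\<in>{y \<in> S. c y \<noteq> c x}. P x y) \<le> e"
    and w: "\<And>x. x \<in> S \<Longrightarrow> cmod (w x) \<le> B"
    and residual: "\<And>x. x \<in> S \<Longrightarrow> cmod ((\<Sum>y\<in>S. complex_of_real (P x y) * w y) - w x) \<le> e * B"
    and eB: "0 \<le> e" "0 \<le> B" and x: "x \<in> S"
  shows "cmod (w x - w (c x)) \<le> 4 ^ Suc N * (e * B)"
proof -
  define d where "d x = cmod (w x - w (c x))" for x
  define D where "D = Max (d ` S)"
  have d_le: "d x \<le> D" if "x \<in> S" for x unfolding D_def using that S by simp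
  have "D \<in> d ` S" unfolding D_def using S x by (intro Max_in) auto
  then obtain x0 where x0: "x0 \<in> S" "D = d x0" by auto
  have d_nonneg: "0 \<le> d x" for x by (simp add: d_def)
  have D_nonneg: "0 \<le> D" using x0 d_nonneg by simp
  have eB': "0 \<le> e * B" using eB by simp
  have step: "d x \<le> d (T x) / 4 + 3 / 4 * D + 3 * (e * B)" if x: "x \<in> S" for x
  proof -
    let ?s = "\<Sum>y\<in>S. complex_of_real (P x y) * (w y - w (c x))"
    have Tx: "T x \<in> S" by (rule T(1)[OF x])
    have "?s
        = (\<Sum>y\<in>S. complex_of_real (P x y) * w y) - complex_of_real (\<Sum>y\<in>S. P x y) * w (c x)"
      by (simp add: right_diff_distrib sum_subtractf sum_distrib_right)
    then have "w x - w (c x) = ?s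
        - ((\<Sum>y\<in>S. complex_of_real (P x y) * w y) - w x)"
      using rows[OF x] by simp
    then have "d x \<le> cmod ?s + e * B"
      unfolding d_def using residual[OF x] norm_triangle_ineq4 order_trans add_left_mono by (metis (no_types, lifting))
    also have "cmod ?s \<le> (\<Sum>y\<in>S. P x y * cmod (w y - w (c x)))"
      using P_nonneg[OF x] by (intro sum_norm_le) (simp add: norm_mult)
    also have "(\<Sum>y\<in>S. P x y * cmod (w y - w (c x))) \<le>
        (\<Sum>y\<in>S. (P x y * D + (if y = T x then P x y * (d y - D) else 0)) + (if c y \<noteq> c x then P x y * (2 * B) else 0))"
    proof (rule sum_mono)
      fix y assume y: "y \<in> S"
      have Py: "0 \<le> P x y" using P_nonneg x y by simp
      show "P x y * cmod (w y - w (c x)) \<le> (P x y * D + (if y = T x then P x y * (d y - D) else 0)) + (if c y \<noteq> c x then P x y * (2 * B) else 0)"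
      proof (cases "c y = c x")
        case True
        then have "cmod (w y - w (c x)) = d y" by (simp add: d_def)
        then show ?thesis
          using True mult_left_mono[OF d_le[OF y] Py] by (auto simp: algebra_simps)
      next
        case False
        then have "y \<noteq> T x" using T(2)[OF x] by auto
        moreover have "cmod (w y - w (c x)) \<le> 2 * B"
          using norm_triangle_ineq4[of "w y" "w (c x)"] w[OF y] w[OF c[OF x]] by linarith
        then have "P x y * cmod (w y - w (c x)) \<le> P x y * (2 * B)" using Py by (rule mult_left_mono)
        moreover have "0 \<le> P x y * D" using Py D_nonneg by simp
        ultimately show ?thesis using False by simp
      qed
    qed
    also have "\<dots> = (\<Sum>y\<in>S. P x y) * D + P x (T x) * (d (T x) - D) + (\<Sum>y\<in>{y \<in> S. c y \<noteq> c x}. P x y) * (2 * B)"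
      using S Tx by (simp add: sum.distrib sum_distrib_right sum.If_cases Int_def)
    also have "\<dots> \<le> D + 1 / 4 * (d (T x) - D) + e * (2 * B)"
    proof -
      have "P x (T x) * (d (T x) - D) \<le> 1 / 4 * (d (T x) - D)"
        by (rule mult_right_mono_neg) (use T(3)[OF x] d_le[OF Tx] in auto)
      moreover have "(\<Sum>y\<in>{y \<in> S. c y \<noteq> c x}. P x y) * (2 * B) \<le> e * (2 * B)"
        by (rule mult_right_mono) (use leak[OF x] eB in auto)
      ultimately show ?thesis unfolding rows[OF x] by linarith
    qed
    finally show ?thesis by (simp add: field_simps)
  qed
  have level: "(T ^^ k) x = c x \<Longrightarrow> x \<in> S \<Longrightarrow> d x \<le> (1 - (1 / 4) ^ k) * D + 4 * (e * B)" for k x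
  proof (induction k arbitrary: x)
    case 0
    then show ?case using eB' by (simp add: d_def)
  next
    case (Suc k)
    have "(T ^^ k) (T x) = c (T x)" using Suc.prems T(2) by (simp add: funpow_swap1)
    then have "d (T x) \<le> (1 - (1 / 4) ^ k) * D + 4 * (e * B)" using Suc T(1) by blast
    then show ?case using step[OF Suc.prems(2)] by (simp add: left_diff_distrib)
  qed
  have "D \<le> (1 - (1 / 4) ^ N) * D + 4 * (e * B)"
    using level[OF N[OF x0(1)] x0(1)] x0(2) by simp
  then have "(1 / 4) ^ N * D \<le> 4 * (e * B)" by (simp add: algebra_simps)
  then have "D \<le> 4 ^ Suc N * (e * B)" by (simp add: power_divide field_simps)
  then show ?thesis using d_le[OF x] unfolding d_def by linarith
qed


section \<open>Transition rates of the perturbed chain\<close>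

locale perturbed_chain = stable_noise \<alpha> M L + discretized_potential U n m s R h \<delta> S a b
  for \<alpha> :: real and M :: "'a measure" and L :: "'a \<Rightarrow> real"
    and U :: "real \<Rightarrow> real" and n :: nat and m s :: "nat \<Rightarrow> real"
    and R h \<delta> :: real and S :: "real set" and a b :: "real \<Rightarrow> real"
begin

abbreviation "P \<equiv> P_eps \<alpha> M L U h S a b"
abbreviation "Qe \<equiv> Q_eps \<alpha> M L U h S a b"
abbreviation "Q \<equiv> Q_entry \<alpha> n m s"

abbreviation gen :: "real \<Rightarrow> (real \<Rightarrow> complex) \<Rightarrow> real \<Rightarrow> complex" where
  "gen \<epsilon> w x \<equiv> \<Sum>y\<in>S. complex_of_real (Qe \<epsilon> x y) * w y"

abbreviation limit_gen :: "(nat \<Rightarrow> complex) \<Rightarrow> nat \<Rightarrow> complex" where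
  "limit_gen v j \<equiv> \<Sum>k=1..n. complex_of_real (Q j k) * v k"

abbreviation (input) at_minima :: "(real \<Rightarrow> complex) \<Rightarrow> nat \<Rightarrow> complex" where
  "at_minima w \<equiv> \<lambda>k. w (m k)"

text \<open>The noise increment of one time step.\<close>

definition Y :: "real \<Rightarrow> 'a \<Rightarrow> real" where "Y \<epsilon> \<omega> = \<epsilon> * h powr (1 / \<alpha>) * L \<omega>"

lemma Y_measurable [measurable]: "Y \<epsilon> \<in> borel_measurable M"
  unfolding Y_def[abs_def] by measurable

lemma scale_pos: "0 < \<epsilon> \<Longrightarrow> 0 < \<epsilon> * h powr (1 / \<alpha>)" "0 < \<epsilon> \<Longrightarrow> 0 < h * \<epsilon> powr \<alpha>"
  using h_pos by simp_all

lemma Y_no_atom: assumes "\<epsilon> > 0" shows "prob {\<omega> \<in> space M. z + Y \<epsilon> \<omega> = c} = 0"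
proof -
  have "z + Y \<epsilon> \<omega> = c \<longleftrightarrow> L \<omega> = (c - z) / (\<epsilon> * h powr (1 / \<alpha>))" for \<omega>
  proof -
    have "z + k * l = c \<longleftrightarrow> l = (c - z) / k" if "k > 0" for k l :: real
      using that by (auto simp: field_simps)
    from this[OF scale_pos(1)[OF assms]] show ?thesis by (simp add: Y_def)
  qed
  then show ?thesis by (simp add: stable_no_atom)
qed

lemma AE_Y_neq: assumes "\<epsilon> > 0" shows "AE \<omega> in M. z + Y \<epsilon> \<omega> \<noteq> c"
proof -
  have "{\<omega> \<in> space M. z + Y \<epsilon> \<omega> = c} \<in> null_sets M"
    using Y_no_atom[OF assms, of z c] by (intro null_setsI) (auto simp: emeasure_eq_measure)
  then show ?thesis by (rule AE_I') auto
qed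

lemma Y_lower_tail: assumes "\<epsilon> > 0"
  shows "prob {\<omega> \<in> space M. Y \<epsilon> \<omega> \<le> - r} = prob {\<omega> \<in> space M. r \<le> Y \<epsilon> \<omega>}"
proof -
  let ?c = "\<epsilon> * h powr (1 / \<alpha>)"
  have "Y \<epsilon> \<omega> \<le> - r \<longleftrightarrow> L \<omega> \<le> - (r / ?c)" "r \<le> Y \<epsilon> \<omega> \<longleftrightarrow> r / ?c \<le> L \<omega>" for \<omega>
    using scale_pos(1)[OF assms] unfolding Y_def by (simp_all add: field_simps)
  then show ?thesis by (simp add: stable_lower_tail)
qed

lemma Y_tail: "r > 0 \<Longrightarrow> ((\<lambda>\<epsilon>. prob {\<omega> \<in> space M. r \<le> Y \<epsilon> \<omega>} / (h * \<epsilon> powr \<alpha>)) \<longlongrightarrow> 1 / (2 * r powr \<alpha>)) (at_right 0)"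
  unfolding Y_def using h_pos by (rule scaled_stable_tail)

lemma scale_tendsto_0: "((\<lambda>\<epsilon>. h * \<epsilon> powr \<alpha>) \<longlongrightarrow> 0) (at_right 0)"
proof -
  have "((\<lambda>\<epsilon>. \<epsilon> powr \<alpha>) \<longlongrightarrow> 0 powr \<alpha>) (at_right 0)"
    using alpha by (intro tendsto_powr') (auto simp: eventually_at_right_less less_imp_le eventually_at_filter)
  then show ?thesis by (auto intro: tendsto_mult_right_zero)
qed

lemma Y_exceeds_tendsto_0:
  assumes "r > 0" shows "((\<lambda>\<epsilon>. prob {\<omega> \<in> space M. r \<le> Y \<epsilon> \<omega>}) \<longlongrightarrow> 0) (at_right 0)"
proof -
  have "((\<lambda>\<epsilon>. (prob {\<omega> \<in> space M. r \<le> Y \<epsilon> \<omega>} / (h * \<epsilon> powr \<alpha>)) * (h * \<epsilon> powr \<alpha>)) \<longlongrightarrow> 1 / (2 * r powr \<alpha>) * 0) (at_right 0)"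
    by (intro tendsto_mult Y_tail[OF assms] scale_tendsto_0)
  moreover have "\<forall>\<^sub>F \<epsilon> in at_right 0. (prob {\<omega> \<in> space M. r \<le> Y \<epsilon> \<omega>} / (h * \<epsilon> powr \<alpha>)) * (h * \<epsilon> powr \<alpha>)
      = prob {\<omega> \<in> space M. r \<le> Y \<epsilon> \<omega>}"
    using eventually_at_right_less[of 0] by eventually_elim (use h_pos in simp)
  ultimately show ?thesis by (auto dest: Lim_transform_eventually)
qed

lemma Y_outside_le: assumes "\<epsilon> > 0"
  shows "prob {\<omega> \<in> space M. r \<le> \<bar>Y \<epsilon> \<omega>\<bar>} \<le> 2 * prob {\<omega> \<in> space M. r \<le> Y \<epsilon> \<omega>}"
proof -
  have "prob {\<omega> \<in> space M. r \<le> \<bar>Y \<epsilon> \<omega>\<bar>} \<le> measure M ({\<omega> \<in> space M. r \<le> Y \<epsilon> \<omega>} \<union> {\<omega> \<in> space M. Y \<epsilon> \<omega> \<le> - r})"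
    by (rule finite_measure_mono) auto
  also have "\<dots> \<le> prob {\<omega> \<in> space M. r \<le> Y \<epsilon> \<omega>} + prob {\<omega> \<in> space M. Y \<epsilon> \<omega> \<le> - r}"
    by (rule measure_Un_le) auto
  finally show ?thesis by (simp add: Y_lower_tail[OF assms])
qed

lemma cell_borel [measurable]: "cell y \<in> sets borel"
  unfolding cell_def by measurable

lemma region_borel [measurable]: "region k \<in> sets borel"
  unfolding region_def by measurable

text \<open>The leftmost cell contains its right endpoint in the definition of the transition matrix; it
carries no mass.\<close>

lemma P_eq_cell: assumes "\<epsilon> > 0" "x \<in> S" "y \<in> S"
  shows "P \<epsilon> x y = prob {\<omega> \<in> space M. target x + Y \<epsilon> \<omega> \<in> cell y}"
proof -
  have "P \<epsilon> x y = prob {\<omega> \<in> space M. if y = Min S then target x + Y \<epsilon> \<omega> \<le> b y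
      else if y = Max S then a y \<le> target x + Y \<epsilon> \<omega> else target x + Y \<epsilon> \<omega> \<in> {a y..<b y}}"
    by (simp add: P_eps_def target_def Y_def Let_def)
  also have "\<dots> = prob {\<omega> \<in> space M. target x + Y \<epsilon> \<omega> \<in> cell y}"
  proof (rule measure_eq_AE)
    show "AE \<omega> in M. (\<omega> \<in> {\<omega> \<in> space M. if y = Min S then target x + Y \<epsilon> \<omega> \<le> b y
      else if y = Max S then a y \<le> target x + Y \<epsilon> \<omega> else target x + Y \<epsilon> \<omega> \<in> {a y..<b y}}) =
      (\<omega> \<in> {\<omega> \<in> space M. target x + Y \<epsilon> \<omega> \<in> cell y})"
      using AE_Y_neq[OF assms(1), of "target x" "b y"]
      by eventually_elim (use Min_neq_Max in \<open>auto simp: cell_def\<close>)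
  qed (measurable, auto)
  finally show ?thesis .
qed

lemma sum_P: assumes "\<epsilon> > 0" "x \<in> S" "A \<subseteq> S"
  shows "(\<Sum>y\<in>A. P \<epsilon> x y) = prob {\<omega> \<in> space M. \<exists>y\<in>A. target x + Y \<epsilon> \<omega> \<in> cell y}"
proof -
  let ?E = "\<lambda>y. {\<omega> \<in> space M. target x + Y \<epsilon> \<omega> \<in> cell y}"
  have "finite A" using assms(3) finite_S by (rule finite_subset)
  have "(\<Sum>y\<in>A. P \<epsilon> x y) = (\<Sum>y\<in>A. measure M (?E y))"
    using assms by (intro sum.cong) (auto simp: P_eq_cell)
  also have "\<dots> = measure M (\<Union>y\<in>A. ?E y)"
  proof (rule finite_measure_finite_Union[symmetric])
    show "disjoint_family_on ?E A"
      unfolding disjoint_family_on_def using cell_disjoint assms(3) by blast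
  qed (use \<open>finite A\<close> in auto)
  also have "(\<Union>y\<in>A. ?E y) = {\<omega> \<in> space M. \<exists>y\<in>A. target x + Y \<epsilon> \<omega> \<in> cell y}" by auto
  finally show ?thesis .
qed

lemma P_row_sum: assumes "\<epsilon> > 0" "x \<in> S" shows "(\<Sum>y\<in>S. P \<epsilon> x y) = 1"
  using sum_P[OF assms subset_refl] cell_cover prob_space by simp

lemma P_nonneg: "0 \<le> P \<epsilon> x y"
  by (simp add: P_eps_def Let_def)

lemma P_apply:
  fixes w :: "real \<Rightarrow> complex"
  assumes "\<epsilon> > 0" "x \<in> S"
  shows "(\<Sum>y\<in>S. complex_of_real (P \<epsilon> x y) * w y) = complex_of_real (h * \<epsilon> powr \<alpha>) * gen \<epsilon> w x + w x"
proof -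
  have "complex_of_real (P \<epsilon> x y) = complex_of_real (h * \<epsilon> powr \<alpha>) * complex_of_real (Qe \<epsilon> x y) + (if x = y then 1 else 0)" for y
    using h_pos assms(1) by (simp add: Q_eps_def flip: of_real_mult)
  then have "(\<Sum>y\<in>S. complex_of_real (P \<epsilon> x y) * w y)
      = (\<Sum>y\<in>S. complex_of_real (h * \<epsilon> powr \<alpha>) * (complex_of_real (Qe \<epsilon> x y) * w y) + (if x = y then w y else 0))"
    by (intro sum.cong) (auto simp: algebra_simps)
  then show ?thesis using assms(2) by (simp add: sum.distrib sum_distrib_left)
qed

lemma P_well_sum: assumes "\<epsilon> > 0" "x \<in> S" "k \<in> {1..n}"
  shows "(\<Sum>y\<in>W k. P \<epsilon> x y) = prob {\<omega> \<in> space M. target x + Y \<epsilon> \<omega> \<in> region k}"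
proof -
  have "(\<exists>y\<in>W k. z \<in> cell y) \<longleftrightarrow> z \<in> region k" for z
    using cell_cover[of z] region_iff_well[OF assms(3)] well_subset_S by blast
  then show ?thesis using sum_P[OF assms(1,2) well_subset_S] by simp
qed

lemma P_to_Min_pos: assumes "\<epsilon> > 0" "x \<in> S" shows "P \<epsilon> x (Min S) > 0"
proof -
  define u where "u = - (b (Min S) - target x) / (\<epsilon> * h powr (1 / \<alpha>))"
  have "target x + Y \<epsilon> \<omega> \<le> b (Min S) \<longleftrightarrow> L \<omega> \<le> - u" for \<omega>
    using scale_pos(1)[OF assms(1)] unfolding Y_def u_def by (auto simp: field_simps)
  then have "P \<epsilon> x (Min S) = prob {\<omega> \<in> space M. L \<omega> \<le> - u}"
    by (simp add: P_eps_def Let_def Y_def target_def)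
  then show ?thesis by (simp add: stable_lower_tail stable_tail_pos)
qed

text \<open>The target of \<open>x\<close> lies in the cell of \<open>T x\<close>, possibly at its left end, so every small nonnegative increment stays in that cell;
increments are nonnegative with probability at least \<open>1/2\<close> and small with probability close to one.\<close>

lemma P_drift_ge: assumes "x \<in> S" shows "\<forall>\<^sub>F \<epsilon> in at_right 0. P \<epsilon> x (T x) \<ge> 1 / 4"
proof -
  define r where "r = b (T x) - target x"
  have Tx: "T x \<in> S" "a (T x) \<le> target x" "target x < b (T x)" using T_props[OF assms] by auto
  then have "r > 0" by (simp add: r_def)
  have "\<forall>\<^sub>F \<epsilon> in at_right 0. prob {\<omega> \<in> space M. r \<le> Y \<epsilon> \<omega>} < 1 / 4"
    using Y_exceeds_tendsto_0[OF \<open>r > 0\<close>] by (rule order_tendstoD) simp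
  with eventually_at_right_less[of 0] show ?thesis
  proof eventually_elim
    case (elim \<epsilon>)
    have "0 \<le> Y \<epsilon> \<omega> \<longleftrightarrow> 0 \<le> L \<omega>" for \<omega>
      using scale_pos(1)[of \<epsilon>] elim unfolding Y_def by (simp add: zero_le_mult_iff not_less)
    then have "1 / 2 \<le> prob {\<omega> \<in> space M. 0 \<le> Y \<epsilon> \<omega>}" using stable_nonneg_half by simp
    also have "\<dots> \<le> measure M ({\<omega> \<in> space M. target x + Y \<epsilon> \<omega> \<in> cell (T x)} \<union> {\<omega> \<in> space M. r \<le> Y \<epsilon> \<omega>})"
      using Tx by (intro finite_measure_mono) (auto simp: cell_def r_def)
    also have "\<dots> \<le> P \<epsilon> x (T x) + prob {\<omega> \<in> space M. r \<le> Y \<epsilon> \<omega>}"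
      using P_eq_cell[OF _ assms Tx(1)] elim by (simp add: measure_Un_le)
    finally show ?case using elim by linarith
  qed
qed

lemma outside_well_iff: "x \<in> S \<Longrightarrow> y \<in> S \<Longrightarrow> bottom y \<noteq> bottom x \<longleftrightarrow> y \<notin> W (well_index x)"
  using m_inj well_index well_eq by (auto simp: bottom_def)

text \<open>Leaving the well needs an increment of size bounded below, because the target is an interior point of the region.\<close>

lemma leak_tendsto_0: assumes "x \<in> S" "e > 0"
  shows "\<forall>\<^sub>F \<epsilon> in at_right 0. (\<Sum>y\<in>{y \<in> S. bottom y \<noteq> bottom x}. P \<epsilon> x y) \<le> e"
proof -
  let ?j = "well_index x"
  obtain \<rho> where \<rho>: "\<rho> > 0" "\<And>y. \<bar>y\<bar> < \<rho> \<Longrightarrow> target x + y \<in> region ?j"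
    using target_neighbourhood[OF assms(1)] by blast
  have "\<forall>\<^sub>F \<epsilon> in at_right 0. prob {\<omega> \<in> space M. \<rho> \<le> Y \<epsilon> \<omega>} < e / 2"
    using Y_exceeds_tendsto_0[OF \<open>\<rho> > 0\<close>] by (rule order_tendstoD) (use assms in simp)
  with eventually_at_right_less[of 0] show ?thesis
  proof eventually_elim
    case (elim \<epsilon>)
    have "(\<Sum>y\<in>{y \<in> S. bottom y \<noteq> bottom x}. P \<epsilon> x y)
        = prob {\<omega> \<in> space M. \<exists>y\<in>{y \<in> S. bottom y \<noteq> bottom x}. target x + Y \<epsilon> \<omega> \<in> cell y}"
      using elim assms by (intro sum_P) auto
    also have "\<dots> \<le> prob {\<omega> \<in> space M. \<rho> \<le> \<bar>Y \<epsilon> \<omega>\<bar>}"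
    proof (rule finite_measure_mono)
      show "{\<omega> \<in> space M. \<exists>y\<in>{y \<in> S. bottom y \<noteq> bottom x}. target x + Y \<epsilon> \<omega> \<in> cell y} \<subseteq> {\<omega> \<in> space M. \<rho> \<le> \<bar>Y \<epsilon> \<omega>\<bar>}"
        using \<rho>(2) outside_well_iff[OF assms(1)] region_iff_well[OF well_index(1)[OF assms(1)]]
        by (auto simp: not_less[symmetric])
    qed simp
    also have "\<dots> \<le> e" using Y_outside_le[of \<epsilon> \<rho>] elim by linarith
    finally show ?case .
  qed
qed

text \<open>The minimum is its own target and an interior point of its cell, so leaving the cell needs a large increment, which has
probability of order \<open>\<epsilon>\<^sup>\<alpha>\<close>.\<close>

lemma exit_rate_bounded: assumes "j \<in> {1..n}"
  shows "\<exists>K. \<forall>\<^sub>F \<epsilon> in at_right 0. (\<Sum>y\<in>S - {m j}. \<bar>Qe \<epsilon> (m j) y\<bar>) \<le> K"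
proof -
  have mS: "m j \<in> S" by (rule minima_in_S[OF assms])
  define \<rho> where "\<rho> = min (m j - a (m j)) (b (m j) - m j)"
  have "\<rho> > 0" using cell_ends[OF mS] by (simp add: \<rho>_def)
  define K where "K = 2 * (1 / (2 * \<rho> powr \<alpha>) + 1)"
  have "\<forall>\<^sub>F \<epsilon> in at_right 0. prob {\<omega> \<in> space M. \<rho> \<le> Y \<epsilon> \<omega>} / (h * \<epsilon> powr \<alpha>) < 1 / (2 * \<rho> powr \<alpha>) + 1"
    using Y_tail[OF \<open>\<rho> > 0\<close>] by (rule order_tendstoD) simp
  with eventually_at_right_less[of 0]
  have "\<forall>\<^sub>F \<epsilon> in at_right 0. (\<Sum>y\<in>S - {m j}. \<bar>Qe \<epsilon> (m j) y\<bar>) \<le> K"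
  proof eventually_elim
    case (elim \<epsilon>)
    have "(\<Sum>y\<in>S - {m j}. \<bar>Qe \<epsilon> (m j) y\<bar>) = (\<Sum>y\<in>S - {m j}. P \<epsilon> (m j) y / (h * \<epsilon> powr \<alpha>))"
      using scale_pos(2)[of \<epsilon>] elim P_nonneg h_pos by (intro sum.cong) (auto simp: Q_eps_def abs_mult)
    also have "\<dots> = prob {\<omega> \<in> space M. \<exists>y\<in>S - {m j}. m j + Y \<epsilon> \<omega> \<in> cell y} / (h * \<epsilon> powr \<alpha>)"
      using sum_P[of \<epsilon> "m j" "S - {m j}"] elim mS by (simp add: sum_divide_distrib[symmetric] target_minimum[OF assms])
    also have "\<dots> \<le> prob {\<omega> \<in> space M. \<rho> \<le> \<bar>Y \<epsilon> \<omega>\<bar>} / (h * \<epsilon> powr \<alpha>)"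
    proof (intro divide_right_mono finite_measure_mono)
      have "m j + y \<in> cell (m j)" if "\<bar>y\<bar> < \<rho>" for y
      proof -
        have "m j + y \<in> {a (m j)..<b (m j)}" using that by (auto simp: \<rho>_def abs_less_iff)
        then show ?thesis using interval_subset_cell by blast
      qed
      then show "{\<omega> \<in> space M. \<exists>y\<in>S - {m j}. m j + Y \<epsilon> \<omega> \<in> cell y} \<subseteq> {\<omega> \<in> space M. \<rho> \<le> \<bar>Y \<epsilon> \<omega>\<bar>}"
        using cell_disjoint[OF mS] by (force simp: not_less[symmetric])
    qed (use scale_pos(2)[of \<epsilon>] elim in auto)
    also have "\<dots> \<le> 2 * prob {\<omega> \<in> space M. \<rho> \<le> Y \<epsilon> \<omega>} / (h * \<epsilon> powr \<alpha>)"
      using Y_outside_le[of \<epsilon> \<rho>] elim scale_pos(2)[of \<epsilon>] by (intro divide_right_mono) auto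
    also have "\<dots> \<le> K" using elim by (simp add: K_def)
    finally show ?case .
  qed
  then show ?thesis by blast
qed

lemma lower_exit_rate: assumes j: "j \<in> {1..n}" and i: "i < j"
  shows "((\<lambda>\<epsilon>. prob {\<omega> \<in> space M. ereal (m j + Y \<epsilon> \<omega>) < \<Sigma> i} / (h * \<epsilon> powr \<alpha>))
    \<longlongrightarrow> inv_dist_powr \<alpha> (\<Sigma> i) (m j) / 2) (at_right 0)"
proof (cases "i = 0")
  case True
  then show ?thesis by (simp add: inv_dist_powr_def)
next
  case False
  then have i1: "i \<in> {1..<n}" using i j by auto
  have "\<Sigma> i \<le> \<Sigma> (j - 1)" using i j by (intro saddle_mono) auto
  then have lt: "s i < m j" using minimum_between_saddles[OF j] by (simp add: saddle_eq[OF i1] order_le_less_trans[of "ereal (s i)"] flip: ereal_less_eq(3) less_ereal.simps(1))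
  define r where "r = m j - s i"
  have r: "r > 0" using lt by (simp add: r_def)
  have "\<forall>\<^sub>F \<epsilon> in at_right 0. prob {\<omega> \<in> space M. r \<le> Y \<epsilon> \<omega>} / (h * \<epsilon> powr \<alpha>)
     = prob {\<omega> \<in> space M. ereal (m j + Y \<epsilon> \<omega>) < \<Sigma> i} / (h * \<epsilon> powr \<alpha>)"
    using eventually_at_right_less[of 0]
  proof eventually_elim
    case (elim \<epsilon>)
    have "prob {\<omega> \<in> space M. ereal (m j + Y \<epsilon> \<omega>) < \<Sigma> i} = prob {\<omega> \<in> space M. Y \<epsilon> \<omega> \<le> - r}"
    proof (rule measure_eq_AE)
      show "AE \<omega> in M. (\<omega> \<in> {\<omega> \<in> space M. ereal (m j + Y \<epsilon> \<omega>) < \<Sigma> i}) = (\<omega> \<in> {\<omega> \<in> space M. Y \<epsilon> \<omega> \<le> - r})"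
        using AE_Y_neq[OF elim, of "m j" "s i"]
        by eventually_elim (auto simp: saddle_eq[OF i1] r_def)
    qed (simp_all add: saddle_eq[OF i1])
    then show ?case by (simp add: Y_lower_tail[OF elim])
  qed
  from Lim_transform_eventually[OF Y_tail[OF r] this] show ?thesis
    using r by (simp add: inv_dist_powr_def saddle_eq[OF i1] r_def mult.commute abs_minus_commute)
qed

lemma upper_exit_rate: assumes j: "j \<in> {1..n}" and i: "j \<le> i" "i \<le> n"
  shows "((\<lambda>\<epsilon>. prob {\<omega> \<in> space M. \<Sigma> i \<le> ereal (m j + Y \<epsilon> \<omega>)} / (h * \<epsilon> powr \<alpha>))
    \<longlongrightarrow> inv_dist_powr \<alpha> (\<Sigma> i) (m j) / 2) (at_right 0)"
proof (cases "i = n")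
  case True
  then show ?thesis by (simp add: inv_dist_powr_def)
next
  case False
  then have i1: "i \<in> {1..<n}" using i j by auto
  have "\<Sigma> j \<le> \<Sigma> i" using i by (intro saddle_mono)
  then have "ereal (m j) < ereal (s i)" using minimum_between_saddles[OF j] unfolding saddle_eq[OF i1] by (metis order_less_le_trans)
  define r where "r = s i - m j"
  have r: "r > 0" using \<open>ereal (m j) < ereal (s i)\<close> by (simp add: r_def)
  have "\<Sigma> i \<le> ereal (m j + y) \<longleftrightarrow> r \<le> y" for y
    by (auto simp: saddle_eq[OF i1] r_def)
  then show ?thesis
    using Y_tail[OF r] r by (simp add: inv_dist_powr_def saddle_eq[OF i1] r_def mult.commute)
qed

text \<open>From \<open>m j\<close>, the well \<open>k\<close> is hit by jumping into the interval between two saddles; its probability is a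
difference of two tails. The case distinction is whether the interval lies to the right of \<open>m j\<close>, to the left, or around it.
The absolute value in an entry of \<open>Q\<close> is reached without comparing distances, since the left-hand side is nonnegative for \<open>j \<noteq> k\<close>.\<close>

lemma well_rate_tendsto: assumes j: "j \<in> {1..n}" and k: "k \<in> {1..n}"
  shows "((\<lambda>\<epsilon>. \<Sum>y\<in>W k. Qe \<epsilon> (m j) y) \<longlongrightarrow> Q j k) (at_right 0)"
proof -
  let ?r = "\<lambda>\<epsilon>. h * \<epsilon> powr \<alpha>"
  let ?p = "\<lambda>\<epsilon> k. prob {\<omega> \<in> space M. m j + Y \<epsilon> \<omega> \<in> region k}"
  let ?l = "\<lambda>\<epsilon> i. prob {\<omega> \<in> space M. ereal (m j + Y \<epsilon> \<omega>) < \<Sigma> i}"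
  let ?u = "\<lambda>\<epsilon> i. prob {\<omega> \<in> space M. \<Sigma> i \<le> ereal (m j + Y \<epsilon> \<omega>)}"
  let ?v = "\<lambda>i. inv_dist_powr \<alpha> (\<Sigma> i) (m j)"
  have [measurable]: "{\<omega> \<in> space M. ereal (m j + Y \<epsilon> \<omega>) < \<Sigma> i} \<in> sets M"
    "{\<omega> \<in> space M. \<Sigma> i \<le> ereal (m j + Y \<epsilon> \<omega>)} \<in> sets M"
    "{\<omega> \<in> space M. m j + Y \<epsilon> \<omega> \<in> region k} \<in> sets M" for \<epsilon> i k
    by measurable
  have order: "\<Sigma> (k - 1) \<le> \<Sigma> k" using k by (intro saddle_mono) auto
  have "finite (W k)" using well_subset_S finite_S by (rule finite_subset)
  have "(\<Sum>y\<in>W k. if m j = y then 1 else 0) = (if j = k then 1 else 0 :: real)"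
    using \<open>finite (W k)\<close> minimum_in_well[OF j] well_unique[of "m j" j k] j k by auto
  then have sum_eq: "(\<Sum>y\<in>W k. Qe \<epsilon> (m j) y) = (?p \<epsilon> k - (if j = k then 1 else 0)) / ?r \<epsilon>" if "\<epsilon> > 0" for \<epsilon>
    using P_well_sum[OF that minima_in_S[OF j] k]
    by (simp add: Q_eps_def sum_subtractf sum_divide_distrib[symmetric] target_minimum[OF j])
  have diff: "measure M (B - A) = measure M B - measure M A" if "A \<subseteq> B" "A \<in> sets M" "B \<in> sets M" for A B
    using that by (simp add: finite_measure_Diff)
  consider "j = k" | "j < k" | "k < j" by linarith
  then show ?thesis
  proof cases
    case 1
    have "?p \<epsilon> k = 1 - (?l \<epsilon> (k - 1) + ?u \<epsilon> k)" for \<epsilon>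
    proof -
      let ?A = "{\<omega> \<in> space M. ereal (m j + Y \<epsilon> \<omega>) < \<Sigma> (k - 1)}" and ?B = "{\<omega> \<in> space M. \<Sigma> k \<le> ereal (m j + Y \<epsilon> \<omega>)}"
      have "{\<omega> \<in> space M. m j + Y \<epsilon> \<omega> \<in> region k} = space M - (?A \<union> ?B)"
        by (auto simp: region_def not_less not_le)
      moreover have "measure M (?A \<union> ?B)
          = ?l \<epsilon> (k - 1) + ?u \<epsilon> k"
        using order by (intro finite_measure_Union) (auto dest: order.strict_trans2 order_trans)
      ultimately show ?thesis by (simp add: prob_compl)
    qed
    note p = this
    have "\<forall>\<^sub>F \<epsilon> in at_right 0. - (?l \<epsilon> (k - 1) / ?r \<epsilon> + ?u \<epsilon> k / ?r \<epsilon>) = (\<Sum>y\<in>W k. Qe \<epsilon> (m j) y)"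
      using eventually_at_right_less[of 0]
    proof (rule eventually_mono)
      fix \<epsilon> :: real
      assume "0 < \<epsilon>"
      show "- (?l \<epsilon> (k - 1) / ?r \<epsilon> + ?u \<epsilon> k / ?r \<epsilon>) = (\<Sum>y\<in>W k. Qe \<epsilon> (m j) y)"
        unfolding sum_eq[OF \<open>0 < \<epsilon>\<close>] p using 1 by (simp add: diff_divide_distrib add_divide_distrib)
    qed
    moreover have "((\<lambda>\<epsilon>. - (?l \<epsilon> (k - 1) / ?r \<epsilon> + ?u \<epsilon> k / ?r \<epsilon>)) \<longlongrightarrow> - (?v (k - 1) / 2 + ?v k / 2)) (at_right 0)"
      using 1 j k by (intro tendsto_minus tendsto_add lower_exit_rate upper_exit_rate) auto
    moreover have "- (?v (k - 1) / 2 + ?v k / 2) = Q j k"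
      using 1 by (simp add: Q_entry_def add_divide_distrib)
    ultimately show ?thesis by (auto dest: Lim_transform_eventually)
  next
    case 2
    have "?p \<epsilon> k = ?u \<epsilon> (k - 1) - ?u \<epsilon> k" for \<epsilon>
      using order by (subst diff[symmetric]) (auto simp: region_def not_le intro!: arg_cong[where f="measure M"] intro: order_trans)
    note p = this
    have "\<forall>\<^sub>F \<epsilon> in at_right 0. \<bar>?u \<epsilon> (k - 1) / ?r \<epsilon> - ?u \<epsilon> k / ?r \<epsilon>\<bar> = (\<Sum>y\<in>W k. Qe \<epsilon> (m j) y)"
      using eventually_at_right_less[of 0]
    proof eventually_elim
      case (elim \<epsilon>)
      have nn: "0 \<le> ?p \<epsilon> k / ?r \<epsilon>" using h_pos by simp
      have eq: "?u \<epsilon> (k - 1) / ?r \<epsilon> - ?u \<epsilon> k / ?r \<epsilon> = ?p \<epsilon> k / ?r \<epsilon>"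
        by (simp add: p diff_divide_distrib)
      show ?case unfolding eq sum_eq[OF elim] abs_of_nonneg[OF nn] using 2 by simp
    qed
    moreover have "((\<lambda>\<epsilon>. \<bar>?u \<epsilon> (k - 1) / ?r \<epsilon> - ?u \<epsilon> k / ?r \<epsilon>\<bar>) \<longlongrightarrow> \<bar>?v (k - 1) / 2 - ?v k / 2\<bar>) (at_right 0)"
      using 2 j k by (intro tendsto_rabs tendsto_diff upper_exit_rate) auto
    moreover have "\<bar>?v (k - 1) / 2 - ?v k / 2\<bar> = Q j k"
      using 2 by (simp add: Q_entry_def diff_divide_distrib[symmetric])
    ultimately show ?thesis by (auto dest: Lim_transform_eventually)
  next
    case 3
    have "?p \<epsilon> k = ?l \<epsilon> k - ?l \<epsilon> (k - 1)" for \<epsilon>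
      using order by (subst diff[symmetric]) (auto simp: region_def not_less intro!: arg_cong[where f="measure M"] intro: order.strict_trans2)
    note p = this
    have "\<forall>\<^sub>F \<epsilon> in at_right 0. \<bar>?l \<epsilon> (k - 1) / ?r \<epsilon> - ?l \<epsilon> k / ?r \<epsilon>\<bar> = (\<Sum>y\<in>W k. Qe \<epsilon> (m j) y)"
      using eventually_at_right_less[of 0]
    proof eventually_elim
      case (elim \<epsilon>)
      have nn: "0 \<le> ?p \<epsilon> k / ?r \<epsilon>" using h_pos by simp
      have eq: "?l \<epsilon> (k - 1) / ?r \<epsilon> - ?l \<epsilon> k / ?r \<epsilon> = - (?p \<epsilon> k / ?r \<epsilon>)"
        by (simp add: p diff_divide_distrib)
      show ?case unfolding eq sum_eq[OF elim] abs_minus_cancel abs_of_nonneg[OF nn] using 3 by simp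
    qed
    moreover have "((\<lambda>\<epsilon>. \<bar>?l \<epsilon> (k - 1) / ?r \<epsilon> - ?l \<epsilon> k / ?r \<epsilon>\<bar>) \<longlongrightarrow> \<bar>?v (k - 1) / 2 - ?v k / 2\<bar>) (at_right 0)"
      using 3 j k by (intro tendsto_rabs tendsto_diff lower_exit_rate) auto
    moreover have "\<bar>?v (k - 1) / 2 - ?v k / 2\<bar> = Q j k"
      using 3 by (simp add: Q_entry_def diff_divide_distrib[symmetric])
    ultimately show ?thesis by (auto dest: Lim_transform_eventually)
  qed
qed

lemma sum_over_wells:
  fixes f :: "real \<Rightarrow> 'c::comm_monoid_add"
  shows "(\<Sum>y\<in>S. f y) = (\<Sum>k=1..n. \<Sum>y\<in>W k. f y)"
proof -
  have "(\<Sum>k=1..n. \<Sum>y\<in>W k. f y) = (\<Sum>k=1..n. \<Sum>y\<in>{y \<in> S. well_index y = k}. f y)"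
    by (intro sum.cong) (auto simp: well_eq)
  also have "\<dots> = (\<Sum>y\<in>S. f y)"
    using well_index(1) by (intro sum.group) auto
  finally show ?thesis ..
qed

abbreviation reduces_to_limit :: "real \<Rightarrow> real \<Rightarrow> bool" where
  "reduces_to_limit \<epsilon> e \<equiv>
     \<forall>w B. (\<forall>x\<in>S. cmod (w x) \<le> B) \<longrightarrow> (\<forall>x\<in>S. cmod (gen \<epsilon> w x) \<le> B) \<longrightarrow>
       (\<forall>x\<in>S. cmod (w x - w (bottom x)) \<le> e * B) \<and>
       (\<forall>j\<in>{1..n}. cmod (gen \<epsilon> w (m j) - limit_gen (at_minima w) j) \<le> e * B)"

text \<open>The bound on \<open>Q\<^sup>\<epsilon> w\<close> makes \<open>w\<close> almost harmonic for \<open>P\<^sup>\<epsilon>\<close>, hence almost constant on wells. Since the off-diagonal entries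
of \<open>Q\<^sup>\<epsilon>\<close> in the rows of the minima are bounded, replacing \<open>w\<close> by its value at the bottom of each well changes little there, and
then only sums of rates over wells matter. Uniformity in \<open>w\<close> allows the choice of \<open>w\<close> to depend on \<open>\<epsilon>\<close>.\<close>

lemma generator_reduction:
  assumes "e > 0"
  shows "\<forall>\<^sub>F \<epsilon> in at_right 0. reduces_to_limit \<epsilon> e"
proof -
  obtain N where N: "\<And>x. x \<in> S \<Longrightarrow> (T ^^ N) x = bottom x" using reaches_bottom_uniform by blast
  have "\<forall>j. \<exists>K. j \<in> {1..n} \<longrightarrow> (\<forall>\<^sub>F \<epsilon> in at_right 0. (\<Sum>y\<in>S - {m j}. \<bar>Qe \<epsilon> (m j) y\<bar>) \<le> K)"
    using exit_rate_bounded by blast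
  then obtain K where K: "\<And>j. j \<in> {1..n} \<Longrightarrow> \<forall>\<^sub>F \<epsilon> in at_right 0. (\<Sum>y\<in>S - {m j}. \<bar>Qe \<epsilon> (m j) y\<bar>) \<le> K j"
    by metis
  define K' where "K' = (\<Sum>j=1..n. \<bar>K j\<bar>)"
  have K': "K j \<le> K'" if "j \<in> {1..n}" for j
  proof -
    have "\<bar>K j\<bar> \<le> K'" unfolding K'_def using that by (intro member_le_sum) auto
    then show ?thesis by linarith
  qed
  have K'_nonneg: "K' \<ge> 0" by (auto simp: K'_def intro: sum_nonneg)
  \<comment> \<open>The oscillation enters the equation at a minimum multiplied by the exit rate, which is at most \<open>K'\<close>.\<close>
  define e1 where "e1 = e / (2 * (K' + 1))"
  have e1: "e1 > 0" "e1 \<le> e" "K' * e1 \<le> e / 2"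
    using assms K'_nonneg by (auto simp: e1_def field_simps)
  \<comment> \<open>The factor \<open>4 ^ Suc N\<close> is the loss in \<open>oscillation_bound\<close>.\<close>
  define e2 where "e2 = e1 / 4 ^ Suc N"
  have e2: "e2 > 0" using e1 by (simp add: e2_def)
  have n_pos: "n > 0" using n_ge by simp
  have ev_leak: "\<forall>\<^sub>F \<epsilon> in at_right 0. \<forall>x\<in>S. (\<Sum>y\<in>{y \<in> S. bottom y \<noteq> bottom x}. P \<epsilon> x y) \<le> e2"
    using leak_tendsto_0[OF _ e2] by (intro eventually_ball_finite) auto
  have ev_drift: "\<forall>\<^sub>F \<epsilon> in at_right 0. \<forall>x\<in>S. P \<epsilon> x (T x) \<ge> 1 / 4"
    using P_drift_ge by (intro eventually_ball_finite) auto
  have ev_rate: "\<forall>\<^sub>F \<epsilon> in at_right 0. h * \<epsilon> powr \<alpha> < e2"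
    using scale_tendsto_0 by (rule order_tendstoD) (rule e2)
  have ev_K: "\<forall>\<^sub>F \<epsilon> in at_right 0. \<forall>j\<in>{1..n}. (\<Sum>y\<in>S - {m j}. \<bar>Qe \<epsilon> (m j) y\<bar>) \<le> K j"
    using K by (intro eventually_ball_finite) auto
  have "\<forall>\<^sub>F \<epsilon> in at_right 0. \<bar>(\<Sum>y\<in>W k. Qe \<epsilon> (m j) y) - Q j k\<bar> < e / (2 * n)"
    if "j \<in> {1..n}" "k \<in> {1..n}" for j k
    using tendstoD[OF well_rate_tendsto[OF that], of "e / (2 * n)"] assms n_pos by (simp add: dist_real_def)
  then have ev_Q: "\<forall>\<^sub>F \<epsilon> in at_right 0. \<forall>j\<in>{1..n}. \<forall>k\<in>{1..n}. \<bar>(\<Sum>y\<in>W k. Qe \<epsilon> (m j) y) - Q j k\<bar> < e / (2 * n)"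
    by (intro eventually_ball_finite ballI) auto
  show ?thesis
    using eventually_at_right_less[of 0] ev_leak ev_drift ev_rate ev_K ev_Q
  proof eventually_elim
    case (elim \<epsilon>)
    note \<epsilon> = elim(1) and leak = elim(2) and drift = elim(3) and rate = elim(4) and Kj = elim(5) and QQ = elim(6)
    show ?case
    proof (intro allI impI)
      fix w :: "real \<Rightarrow> complex" and B :: real
      assume w: "\<forall>x\<in>S. cmod (w x) \<le> B"
        and Qw: "\<forall>x\<in>S. cmod (gen \<epsilon> w x) \<le> B"
      have B: "B \<ge> 0" using w Min_Max_in_S(1) norm_ge_zero order_trans by metis
      have r: "h * \<epsilon> powr \<alpha> > 0" using scale_pos(2)[OF \<epsilon>] .
      have residual: "cmod ((\<Sum>y\<in>S. complex_of_real (P \<epsilon> x y) * w y) - w x) \<le> e2 * B" if x: "x \<in> S" for x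
      proof -
        have "cmod ((\<Sum>y\<in>S. complex_of_real (P \<epsilon> x y) * w y) - w x)
            = (h * \<epsilon> powr \<alpha>) * cmod (gen \<epsilon> w x)"
          using h_pos by (simp add: P_apply[OF \<epsilon> x] norm_mult)
        also have "\<dots> \<le> e2 * B" using Qw x rate r by (intro mult_mono) auto
        finally show ?thesis .
      qed
      have osc1: "cmod (w x - w (bottom x)) \<le> e1 * B" if x: "x \<in> S" for x
      proof -
        have "cmod (w x - w (bottom x)) \<le> 4 ^ Suc N * (e2 * B)"
        proof (rule oscillation_bound[where S = S and P = "P \<epsilon>" and T = T and c = bottom])
          show "bottom (T x) = bottom x" if "x \<in> S" for x
            using well_index_T[OF that] by (simp add: bottom_def)
          show "bottom x \<in> S" if "x \<in> S" for x
            using minima_in_S well_index[OF that] by (simp add: bottom_def)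
        qed (use P_nonneg P_row_sum[OF \<epsilon>] T_props(1) drift N leak w residual e2 B x in auto)
        then show ?thesis by (simp add: e2_def)
      qed
      have "cmod (w x - w (bottom x)) \<le> e * B" if "x \<in> S" for x
        using osc1[OF that] mult_right_mono[OF e1(2) B] by linarith
      moreover have "cmod (gen \<epsilon> w (m j)
          - limit_gen (at_minima w) j) \<le> e * B" if j: "j \<in> {1..n}" for j
      proof -
        let ?dev = "\<Sum>y\<in>S. complex_of_real (Qe \<epsilon> (m j) y) * (w y - w (bottom y))"
        have bottom_eq: "w (bottom y) = w (m k)" if "k \<in> {1..n}" "y \<in> W k" for k y
          using well_index_eq[OF that(2,1)] by (simp add: bottom_def)
        have "(\<Sum>y\<in>S. complex_of_real (Qe \<epsilon> (m j) y) * w (bottom y))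
            = (\<Sum>k=1..n. complex_of_real (\<Sum>y\<in>W k. Qe \<epsilon> (m j) y) * w (m k))"
          unfolding sum_over_wells by (intro sum.cong) (auto simp: bottom_eq sum_distrib_right)
        then have split: "gen \<epsilon> w (m j) - limit_gen (at_minima w) j
            = ?dev
            + (\<Sum>k=1..n. complex_of_real ((\<Sum>y\<in>W k. Qe \<epsilon> (m j) y) - Q j k) * w (m k))"
          by (simp add: algebra_simps sum_subtractf)
        have "?dev
            = (\<Sum>y\<in>S - {m j}. complex_of_real (Qe \<epsilon> (m j) y) * (w y - w (bottom y)))"
          using minima_in_S[OF j] by (intro sum.mono_neutral_right) (auto simp: bottom_minimum[OF j])
        then have "cmod ?dev
            \<le> (\<Sum>y\<in>S - {m j}. \<bar>Qe \<epsilon> (m j) y\<bar> * (e1 * B))"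
          using osc1 by (auto simp: norm_mult intro!: sum_norm_le mult_left_mono)
        also have "\<dots> \<le> K' * (e1 * B)"
          unfolding sum_distrib_right[symmetric] using Kj j K'[OF j] e1 B by (intro mult_right_mono) fastforce+
        also have "\<dots> \<le> e / 2 * B" using mult_right_mono[OF e1(3) B] by simp
        finally have 1: "cmod ?dev \<le> e / 2 * B" .
        have "cmod (\<Sum>k=1..n. complex_of_real ((\<Sum>y\<in>W k. Qe \<epsilon> (m j) y) - Q j k) * w (m k)) \<le> (\<Sum>k=1..n. e / (2 * n) * B)"
        proof (rule sum_norm_le)
          fix k assume k: "k \<in> {1..n}"
          have "cmod (complex_of_real ((\<Sum>y\<in>W k. Qe \<epsilon> (m j) y) - Q j k)) \<le> e / (2 * n)"
            using QQ j k unfolding norm_of_real by fastforce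
          then show "cmod (complex_of_real ((\<Sum>y\<in>W k. Qe \<epsilon> (m j) y) - Q j k) * w (m k)) \<le> e / (2 * n) * B"
            unfolding norm_mult using w minima_in_S[OF k] assms by (intro mult_mono) auto
        qed
        also have "\<dots> = e / 2 * B" using n_pos by simp
        finally have 2: "cmod (\<Sum>k=1..n. complex_of_real ((\<Sum>y\<in>W k. Qe \<epsilon> (m j) y) - Q j k) * w (m k)) \<le> e / 2 * B" .
        show ?thesis unfolding split using norm_triangle_mono[OF 1 2] by linarith
      qed
      ultimately show "(\<forall>x\<in>S. cmod (w x - w (bottom x)) \<le> e * B) \<and>
       (\<forall>j\<in>{1..n}. cmod (gen \<epsilon> w (m j)
          - limit_gen (at_minima w) j) \<le> e * B)" by blast
    qed
  qed
qed

end


section \<open>Eigenvectors of the perturbed chain\<close>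

lemma Max_image_eq_1_iff:
  fixes f :: "'x \<Rightarrow> real"
  assumes "finite A" "A \<noteq> {}"
  shows "Max (f ` A) = 1 \<longleftrightarrow> (\<forall>x\<in>A. f x \<le> 1) \<and> (\<exists>x\<in>A. f x = 1)"
proof -
  have "Max (f ` A) = 1 \<longleftrightarrow> 1 \<in> f ` A \<and> (\<forall>y\<in>f ` A. y \<le> 1)"
    using assms by (intro Max_eq_iff) auto
  moreover have "1 \<in> f ` A \<longleftrightarrow> (\<exists>x\<in>A. f x = 1)" by (simp only: image_iff eq_commute[of "1::real"])
  ultimately show ?thesis by auto
qed

context perturbed_chain
begin

definition eigen :: "real \<Rightarrow> complex \<Rightarrow> (real \<Rightarrow> complex) \<Rightarrow> bool" where
  "eigen \<epsilon> k w \<longleftrightarrow> (\<forall>x\<in>S. gen \<epsilon> w x = k * w x)"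

abbreviation normalized :: "real \<Rightarrow> complex \<Rightarrow> (real \<Rightarrow> complex) \<Rightarrow> bool" where
  "normalized \<epsilon> \<equiv> normalized_eigvec S (m ` {1..n}) (Qe \<epsilon>)"

lemma normalized_eigvec_Qe_iff:
  "normalized \<epsilon> k \<psi> \<longleftrightarrow>
     eigen \<epsilon> k \<psi> \<and> (\<forall>j\<in>{1..n}. cmod (\<psi> (m j)) \<le> 1) \<and> (\<exists>j\<in>{1..n}. cmod (\<psi> (m j)) = 1)"
proof -
  have "m ` {1..n} \<noteq> {}" using n_ge by auto
  moreover have "\<exists>x\<in>S. \<psi> x \<noteq> 0" if "j \<in> {1..n}" "cmod (\<psi> (m j)) = 1" for j
    using that minima_in_S[of j] by (intro bexI[of _ "m j"]) auto
  ultimately show ?thesis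
    unfolding normalized_eigvec_def eigenvector_mat_on_iff[OF finite_S] eigen_def
    by (subst Max_image_eq_1_iff) auto
qed

lemma Qe_row_sum: assumes "\<epsilon> > 0" "x \<in> S" shows "(\<Sum>y\<in>S. Qe \<epsilon> x y) = 0"
  using P_row_sum[OF assms] assms(2)
  by (simp add: Q_eps_def sum_distrib_left[symmetric] sum_subtractf sum_divide_distrib[symmetric])

text \<open>The limit of the row sums of \<open>Q\<^sup>\<epsilon>\<close>.\<close>

lemma Q_row_sum: assumes "j \<in> {1..n}" shows "(\<Sum>k=1..n. Q j k) = 0"
proof (rule tendsto_unique)
  show "((\<lambda>\<epsilon>. \<Sum>k=1..n. \<Sum>y\<in>W k. Qe \<epsilon> (m j) y) \<longlongrightarrow> (\<Sum>k=1..n. Q j k)) (at_right 0)"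
    by (intro tendsto_sum well_rate_tendsto assms) auto
  have "\<forall>\<^sub>F \<epsilon> in at_right 0. 0 = (\<Sum>k=1..n. \<Sum>y\<in>W k. Qe \<epsilon> (m j) y)"
    using eventually_at_right_less[of 0]
    by eventually_elim (simp only: sum_over_wells[symmetric] Qe_row_sum[OF _ minima_in_S[OF assms]])
  then show "((\<lambda>\<epsilon>. \<Sum>k=1..n. \<Sum>y\<in>W k. Qe \<epsilon> (m j) y) \<longlongrightarrow> 0) (at_right 0)"
    by (rule Lim_transform_eventually[OF tendsto_const])
qed simp

lemma eigen_Qe_minus_const:
  assumes "\<epsilon> > 0" "eigen \<epsilon> k \<psi>" "x \<in> S"
  shows "(\<Sum>y\<in>S. complex_of_real (Qe \<epsilon> x y) * (\<psi> y - c)) = k * \<psi> x"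
proof -
  have "(\<Sum>y\<in>S. complex_of_real (Qe \<epsilon> x y) * (\<psi> y - c))
      = gen \<epsilon> \<psi> x - complex_of_real (\<Sum>y\<in>S. Qe \<epsilon> x y) * c"
    by (simp add: right_diff_distrib sum_subtractf sum_distrib_right)
  then show ?thesis using assms Qe_row_sum by (simp add: eigen_def)
qed

lemma eigen_linear:
  assumes "eigen \<epsilon> k v" "eigen \<epsilon> k w"
  shows "eigen \<epsilon> k (\<lambda>x. p * v x + q * w x)"
proof -
  have "(\<Sum>y\<in>S. complex_of_real (Qe \<epsilon> x y) * (p * v y + q * w y))
     = p * gen \<epsilon> v x + q * gen \<epsilon> w x" for x
    by (simp add: sum_distrib_left sum.distrib algebra_simps)
  then show ?thesis using assms by (simp add: eigen_def algebra_simps)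
qed

text \<open>The difference \<open>\<psi> - \<psi> (Min S)\<close> is harmonic and vanishes at \<open>Min S\<close>. A point of maximal modulus averages over \<open>Min S\<close> with
positive weight, so the maximal modulus is zero.\<close>

lemma harmonic_constant:
  assumes \<epsilon>: "\<epsilon> > 0" and \<psi>: "eigen \<epsilon> 0 \<psi>" and x: "x \<in> S"
  shows "\<psi> x = \<psi> (Min S)"
proof -
  define w where "w x = \<psi> x - \<psi> (Min S)" for x
  have Pw: "(\<Sum>y\<in>S. complex_of_real (P \<epsilon> x y) * w y) = w x" if x: "x \<in> S" for x
    using eigen_Qe_minus_const[OF \<epsilon> \<psi> x] by (simp add: P_apply[OF \<epsilon> x] w_def)
  define D where "D = Max ((\<lambda>x. cmod (w x)) ` S)"
  have D_ge: "cmod (w y) \<le> D" if "y \<in> S" for y unfolding D_def using that by simp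
  have "D \<in> (\<lambda>x. cmod (w x)) ` S" unfolding D_def using x by (intro Max_in) auto
  then obtain x0 where x0: "x0 \<in> S" "D = cmod (w x0)" by auto
  have "D = cmod (\<Sum>y\<in>S. complex_of_real (P \<epsilon> x0 y) * w y)" using x0 Pw by simp
  also have "\<dots> = cmod (\<Sum>y\<in>S - {Min S}. complex_of_real (P \<epsilon> x0 y) * w y)"
    using Min_Max_in_S(1) by (subst sum.mono_neutral_right[of S "S - {Min S}"]) (auto simp: w_def)
  also have "\<dots> \<le> (\<Sum>y\<in>S - {Min S}. P \<epsilon> x0 y * D)"
    using P_nonneg D_ge by (intro sum_norm_le) (auto simp: norm_mult intro: mult_left_mono)
  also have "\<dots> = (1 - P \<epsilon> x0 (Min S)) * D"
    using P_row_sum[OF \<epsilon> x0(1)] Min_Max_in_S(1) by (simp add: sum_distrib_right[symmetric] sum_diff1)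
  finally have "P \<epsilon> x0 (Min S) * D \<le> 0" by (simp add: algebra_simps)
  then have "D \<le> 0" using P_to_Min_pos[OF \<epsilon> x0(1)] by (simp add: mult_le_0_iff)
  then have "cmod (w x) \<le> 0" using D_ge[OF x] by linarith
  then show ?thesis by (simp add: w_def)
qed

lemma zero_eigenvectors:
  assumes "\<epsilon> > 0"
  shows "normalized \<epsilon> 0 \<psi> \<longleftrightarrow> (\<exists>c. cmod c = 1 \<and> (\<forall>x\<in>S. \<psi> x = c))"
proof
  assume "normalized \<epsilon> 0 \<psi>"
  then obtain j where e: "eigen \<epsilon> 0 \<psi>" and j: "j \<in> {1..n}" "cmod (\<psi> (m j)) = 1"
    unfolding normalized_eigvec_Qe_iff by blast
  have "\<forall>x\<in>S. \<psi> x = \<psi> (Min S)" using harmonic_constant[OF assms e] by blast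
  moreover from this have "cmod (\<psi> (Min S)) = 1" using j minima_in_S by metis
  ultimately show "\<exists>c. cmod c = 1 \<and> (\<forall>x\<in>S. \<psi> x = c)" by blast
next
  assume "\<exists>c. cmod c = 1 \<and> (\<forall>x\<in>S. \<psi> x = c)"
  then obtain c where c: "cmod c = 1" "\<forall>x\<in>S. \<psi> x = c" by blast
  have row: "gen \<epsilon> \<psi> x = complex_of_real (\<Sum>y\<in>S. Qe \<epsilon> x y) * c" for x
    using c by (simp add: sum_distrib_right)
  have "eigen \<epsilon> 0 \<psi>"
    unfolding eigen_def row by (intro ballI) (simp only: Qe_row_sum[OF assms] of_real_0 mult_zero_left)
  moreover have "cmod (\<psi> (m j)) = 1" if "j \<in> {1..n}" for j
    using c minima_in_S[OF that] by simp
  moreover have "1 \<in> {1..n}" using n_ge by simp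
  ultimately show "normalized \<epsilon> 0 \<psi>"
    unfolding normalized_eigvec_Qe_iff by (metis order_refl)
qed

abbreviation minima_dominate :: "real \<Rightarrow> complex \<Rightarrow> bool" where
  "minima_dominate \<epsilon> k \<equiv> \<forall>\<psi> A. eigen \<epsilon> k \<psi> \<longrightarrow> (\<forall>j\<in>{1..n}. cmod (\<psi> (m j)) \<le> A) \<longrightarrow> (\<forall>x\<in>S. cmod (\<psi> x) \<le> 2 * A)"

text \<open>An eigenvector deviates from its values at the minima by at most half of its maximum, once \<open>\<epsilon>\<close> is small.\<close>

lemma eigenvector_bounded_by_minima:
  assumes "(lam \<longlongrightarrow> \<mu>) (at_right 0)"
  shows "\<forall>\<^sub>F \<epsilon> in at_right 0. minima_dominate \<epsilon> (lam \<epsilon>)"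
proof -
  define \<Lambda> where "\<Lambda> = cmod \<mu> + 1"
  have \<Lambda>: "\<Lambda> \<ge> 1" by (simp add: \<Lambda>_def)
  have ev: "\<forall>\<^sub>F \<epsilon> in at_right 0. cmod (lam \<epsilon>) < \<Lambda>"
    using tendsto_norm[OF assms] by (rule order_tendstoD) (simp add: \<Lambda>_def)
  have pos: "1 / (2 * \<Lambda>) > 0" using \<Lambda> by simp
  show ?thesis
    using ev generator_reduction[OF pos]
  proof eventually_elim
    case (elim \<epsilon>)
    note lam = elim(1) and red = elim(2)
    show ?case
    proof (intro allI impI)
      fix \<psi> A
      assume eig: "eigen \<epsilon> (lam \<epsilon>) \<psi>" and A: "\<forall>j\<in>{1..n}. cmod (\<psi> (m j)) \<le> A"
      define K where "K = Max ((\<lambda>x. cmod (\<psi> x)) ` S)"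
      have K_ge: "cmod (\<psi> x) \<le> K" if "x \<in> S" for x unfolding K_def using that by simp
      have "K \<in> (\<lambda>x. cmod (\<psi> x)) ` S" unfolding K_def using S_nonempty by (intro Max_in) auto
      then obtain x0 where x0: "x0 \<in> S" "K = cmod (\<psi> x0)" by auto
      have K: "K \<ge> 0" using x0 by simp
      have "\<forall>x\<in>S. cmod (\<psi> x) \<le> \<Lambda> * K"
        using K_ge mult_right_mono[OF \<Lambda> K] by fastforce
      moreover have "\<forall>x\<in>S. cmod (gen \<epsilon> \<psi> x) \<le> \<Lambda> * K"
        using eig lam K_ge K \<Lambda> unfolding eigen_def by (auto simp: norm_mult intro!: mult_mono)
      ultimately have "cmod (\<psi> x0 - \<psi> (bottom x0)) \<le> 1 / (2 * \<Lambda>) * (\<Lambda> * K)"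
        using red x0(1) by blast
      also have "\<dots> = K / 2" using \<Lambda> by simp
      finally have "K \<le> cmod (\<psi> (bottom x0)) + K / 2"
        using norm_triangle_ineq2[of "\<psi> x0" "\<psi> (bottom x0)"] x0(2) by linarith
      moreover have "cmod (\<psi> (bottom x0)) \<le> A"
        using A well_index[OF x0(1)] by (simp add: bottom_def)
      ultimately show "\<forall>x\<in>S. cmod (\<psi> x) \<le> 2 * A" using K_ge by fastforce
    qed
  qed
qed

lemma eigenvector_approximation:
  assumes lim: "(lam \<longlongrightarrow> \<mu>) (at_right 0)" and "e > 0"
  shows "\<forall>\<^sub>F \<epsilon> in at_right 0. \<forall>\<psi>. eigen \<epsilon> (lam \<epsilon>) \<psi> \<longrightarrow> (\<forall>j\<in>{1..n}. cmod (\<psi> (m j)) \<le> 1) \<longrightarrow>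
    (\<forall>x\<in>S. cmod (\<psi> x - \<psi> (bottom x)) \<le> e) \<and>
    (\<forall>j\<in>{1..n}. cmod (limit_gen (at_minima \<psi>) j - \<mu> * \<psi> (m j)) \<le> e)"
proof -
  define \<Lambda> where "\<Lambda> = cmod \<mu> + 1"
  have \<Lambda>: "\<Lambda> \<ge> 1" by (simp add: \<Lambda>_def)
  define e1 where "e1 = e / (4 * \<Lambda>)"
  have e1: "e1 > 0" "e1 * (\<Lambda> * 2) = e / 2" using \<open>e > 0\<close> \<Lambda> by (simp_all add: e1_def)
  have ev1: "\<forall>\<^sub>F \<epsilon> in at_right 0. cmod (lam \<epsilon>) < \<Lambda>"
    using tendsto_norm[OF lim] by (rule order_tendstoD) (simp add: \<Lambda>_def)
  have ev2: "\<forall>\<^sub>F \<epsilon> in at_right 0. cmod (lam \<epsilon> - \<mu>) < e / 2"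
    using tendstoD[OF lim, of "e / 2"] \<open>e > 0\<close> by (simp add: dist_norm)
  show ?thesis
    using ev1 ev2 eigenvector_bounded_by_minima[OF lim] generator_reduction[OF e1(1)]
  proof eventually_elim
    case (elim \<epsilon>)
    note lam = elim(1,2) and bnd = elim(3) and red = elim(4)
    show ?case
    proof (intro allI impI)
      fix \<psi>
      assume eig: "eigen \<epsilon> (lam \<epsilon>) \<psi>" and norm1: "\<forall>j\<in>{1..n}. cmod (\<psi> (m j)) \<le> 1"
      have \<psi>2: "cmod (\<psi> x) \<le> 2" if "x \<in> S" for x
        using bnd eig norm1 that by (metis mult.right_neutral)
      have "\<forall>x\<in>S. cmod (\<psi> x) \<le> \<Lambda> * 2" using \<psi>2 \<Lambda> by fastforce
      moreover have "\<forall>x\<in>S. cmod (gen \<epsilon> \<psi> x) \<le> \<Lambda> * 2"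
        using eig lam \<psi>2 \<Lambda> unfolding eigen_def by (auto simp: norm_mult intro!: mult_mono)
      ultimately have 1: "\<forall>x\<in>S. cmod (\<psi> x - \<psi> (bottom x)) \<le> e / 2"
        and 2: "\<forall>j\<in>{1..n}. cmod (gen \<epsilon> \<psi> (m j)
            - limit_gen (at_minima \<psi>) j) \<le> e / 2"
        using red unfolding e1(2)[symmetric] by blast+
      have "cmod (limit_gen (at_minima \<psi>) j - \<mu> * \<psi> (m j)) \<le> e" if j: "j \<in> {1..n}" for j
      proof -
        have "cmod (lam \<epsilon> * \<psi> (m j) - limit_gen (at_minima \<psi>) j) \<le> e / 2"
        proof -
          have "gen \<epsilon> \<psi> (m j) = lam \<epsilon> * \<psi> (m j)"
            using eig minima_in_S[OF j] by (simp add: eigen_def)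
          then show ?thesis using bspec[OF 2 j] by (simp only:)
        qed
        moreover have "cmod ((lam \<epsilon> - \<mu>) * \<psi> (m j)) \<le> e / 2 * 1"
          unfolding norm_mult using lam norm1 j \<open>e > 0\<close> by (intro mult_mono) auto
        moreover have eq: "limit_gen (at_minima \<psi>) j - \<mu> * \<psi> (m j)
           = (lam \<epsilon> - \<mu>) * \<psi> (m j) - (lam \<epsilon> * \<psi> (m j) - limit_gen (at_minima \<psi>) j)"
          by (simp add: algebra_simps)
        ultimately show ?thesis
          using norm_triangle_ineq4[of "(lam \<epsilon> - \<mu>) * \<psi> (m j)" "lam \<epsilon> * \<psi> (m j) - limit_gen (at_minima \<psi>) j"]
          unfolding eq by linarith
      qed
      moreover have "\<forall>x\<in>S. cmod (\<psi> x - \<psi> (bottom x)) \<le> e" using 1 \<open>e > 0\<close> by fastforce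
      ultimately show "(\<forall>x\<in>S. cmod (\<psi> x - \<psi> (bottom x)) \<le> e) \<and>
        (\<forall>j\<in>{1..n}. cmod (limit_gen (at_minima \<psi>) j - \<mu> * \<psi> (m j)) \<le> e)" by blast
    qed
  qed
qed

lemma normalizable:
  assumes bnd: "minima_dominate \<epsilon> k"
    and eig: "eigen \<epsilon> k w" and nz: "x \<in> S" "w x \<noteq> 0"
  obtains q where "q \<noteq> 0" "normalized \<epsilon> k (\<lambda>x. q * w x)"
proof -
  define A where "A = Max ((\<lambda>j. cmod (w (m j))) ` {1..n})"
  have ne: "{1..n} \<noteq> {}" using n_ge by simp
  have A_ge: "cmod (w (m j)) \<le> A" if "j \<in> {1..n}" for j unfolding A_def using that by simp
  have "A \<in> (\<lambda>j. cmod (w (m j))) ` {1..n}" unfolding A_def using ne by (intro Max_in) auto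
  then obtain j0 where j0: "j0 \<in> {1..n}" "cmod (w (m j0)) = A" by auto
  have "cmod (w x) \<le> 2 * A" using bnd eig A_ge nz(1) by blast
  then have A: "A > 0" using nz(2) by (smt (verit) zero_less_norm_iff)
  show thesis
  proof (rule that[of "complex_of_real (1 / A)"])
    show "complex_of_real (1 / A) \<noteq> 0" using A by simp
    show "normalized \<epsilon> k (\<lambda>x. complex_of_real (1 / A) * w x)"
      unfolding normalized_eigvec_Qe_iff
    proof (intro conjI ballI bexI[of _ j0])
      show "eigen \<epsilon> k (\<lambda>x. complex_of_real (1 / A) * w x)"
        using eigen_linear[OF eig eig, of "complex_of_real (1 / A)" 0] by simp
      show "cmod (complex_of_real (1 / A) * w (m j)) \<le> 1" if "j \<in> {1..n}" for j
        using A A_ge[OF that] by (simp add: norm_mult norm_divide)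
      show "cmod (complex_of_real (1 / A) * w (m j0)) = 1"
        using A j0 by (simp add: norm_mult norm_divide)
    qed (rule j0)
  qed
qed

lemma eigenvalue_QeE:
  assumes "eigenvalue (mat_on S (Qe \<epsilon>)) k"
  obtains w x where "eigen \<epsilon> k w" "x \<in> S" "w x \<noteq> 0"
  using assms by (auto elim!: eigenvalue_mat_onE[OF finite_S] simp: eigenvector_mat_on_iff eigen_def)

text \<open>Deleting row and column \<open>i0\<close> of \<open>Q - \<mu>\<close> leaves an invertible matrix. This is the form in which simplicity of \<open>\<mu>\<close> enters:
eigenvectors are determined by their value at \<open>i0\<close>.\<close>

definition pivot :: "complex \<Rightarrow> nat \<Rightarrow> bool" where
  "pivot \<mu> i0 \<longleftrightarrow> i0 \<in> {1..n} \<and> (\<forall>w. w i0 = 0 \<longrightarrow>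
     (\<forall>j\<in>{1..n}. j \<noteq> i0 \<longrightarrow> limit_gen w j = \<mu> * w j) \<longrightarrow> (\<forall>j\<in>{1..n}. w j = 0))"

lemma pivotD:
  assumes "pivot \<mu> i0"
  shows "i0 \<in> {1..n}"
    and "\<And>w. w i0 = 0 \<Longrightarrow> (\<And>j. j \<in> {1..n} \<Longrightarrow> j \<noteq> i0 \<Longrightarrow> limit_gen w j = \<mu> * w j)
        \<Longrightarrow> \<forall>j\<in>{1..n}. w j = 0"
  using assms unfolding pivot_def by blast+

lemma simple_root_pivot:
  assumes "Polynomial.order \<mu> (char_poly (mat_on {1..n} Q)) = 1"
  shows "\<exists>i0. pivot \<mu> i0"
  using assms unfolding pivot_def
  by (rule simple_eigenvalue_injective[OF finite_atLeastAtMost]) blast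

text \<open>With \<open>c\<close> chosen such that \<open>\<psi> - c \<psi>Q\<close> vanishes at \<open>i0\<close>, the difference almost solves the eigenvalue equation of \<open>Q\<close>, hence it is
small. Both normalizations then force the modulus of \<open>c\<close> to be almost one.\<close>

lemma normalized_eigenvector_limit:
  assumes lim: "(lam \<longlongrightarrow> \<mu>) (at_right 0)"
    and pivot: "pivot \<mu> i0"
    and \<psi>Q: "normalized_eigvec {1..n} {1..n} Q \<mu> \<psi>Q" and e: "e > 0"
  shows "\<forall>\<^sub>F \<epsilon> in at_right 0. \<forall>\<psi>. normalized \<epsilon> (lam \<epsilon>) \<psi> \<longrightarrow>
     \<bar>cmod (\<psi> (m i0) / \<psi>Q i0) - 1\<bar> \<le> e \<and>
     (\<forall>x\<in>S. cmod (\<psi> x - \<psi> (m i0) / \<psi>Q i0 * \<psi>Q (well_index x)) \<le> e)"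
proof -
  note i0 = pivotD(1)[OF pivot] and inj = pivotD(2)[OF pivot]
  have "{1..n} \<noteq> {}" using n_ge by simp
  then have \<psi>Q_eig: "\<And>j. j \<in> {1..n} \<Longrightarrow> limit_gen \<psi>Q j = \<mu> * \<psi>Q j"
    and \<psi>Q_le: "\<And>j. j \<in> {1..n} \<Longrightarrow> cmod (\<psi>Q j) \<le> 1" and \<psi>Q_att: "\<exists>j\<in>{1..n}. cmod (\<psi>Q j) = 1"
    using \<psi>Q unfolding normalized_eigvec_def eigenvector_mat_on_iff[OF finite_atLeastAtMost] Max_image_eq_1_iff[OF finite_atLeastAtMost \<open>{1..n} \<noteq> {}\<close>]
    by blast+
  have \<psi>Q0: "\<psi>Q i0 \<noteq> 0"
    using inj[of \<psi>Q] \<psi>Q_eig \<psi>Q_att by fastforce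
  define A where "A j k = complex_of_real (Q j k) - (if j = k then \<mu> else 0)" for j k
  have A_sum: "(\<Sum>k=1..n. A j k * w k) = limit_gen w j - \<mu> * w j" if "j \<in> {1..n}" for j w
  proof -
    have "(\<Sum>k=1..n. A j k * w k) = (\<Sum>k=1..n. complex_of_real (Q j k) * w k - (if j = k then \<mu> * w k else 0))"
      by (intro sum.cong) (auto simp: A_def algebra_simps)
    then show ?thesis using that by (simp add: sum_subtractf)
  qed
  have A_sum0: "(\<Sum>k\<in>{1..n} - {i0}. A j k * w k) = (\<Sum>k=1..n. A j k * w k)" if "w i0 = 0" for j w
    using that by (intro sum.mono_neutral_left) auto
  have A_inj: "\<forall>k\<in>{1..n} - {i0}. v k = 0" if "\<forall>j\<in>{1..n}. (\<Sum>k\<in>{1..n} - {i0}. A j k * v k) = 0" for v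
  proof -
    have "(\<Sum>k\<in>{1..n} - {i0}. A j k * v k) = (\<Sum>k\<in>{1..n} - {i0}. A j k * (v(i0 := 0)) k)" for j
      by (intro sum.cong) auto
    then have "(\<Sum>k=1..n. A j k * (v(i0 := 0)) k) = 0" if "j \<in> {1..n}" for j
      using A_sum0[of "v(i0 := 0)"] that \<open>\<forall>j\<in>{1..n}. _ = 0\<close> by simp
    then have "\<forall>j\<in>{1..n}. (v(i0 := 0)) j = 0"
      using A_sum[of _ "v(i0 := 0)"] by (intro inj) auto
    then have "(v(i0 := 0)) k = 0" if "k \<in> {1..n}" for k using that by blast
    then show ?thesis by (metis DiffE fun_upd_other insertI1)
  qed
  obtain C where C: "C > 0" "\<And>v B k. (\<And>j. j \<in> {1..n} \<Longrightarrow> cmod (\<Sum>k\<in>{1..n} - {i0}. A j k * v k) \<le> B) \<Longrightarrow> 0 \<le> B \<Longrightarrow>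
      k \<in> {1..n} - {i0} \<Longrightarrow> cmod (v k) \<le> C * B"
    using injective_imp_bounded_below[of "{1..n} - {i0}" "{1..n}" A] A_inj by blast
  define e1 where "e1 = e / (C + 1)"
  have e1: "e1 > 0" using e C by (simp add: e1_def)
  have "C * e1 + e1 = (C + 1) * e1" by (simp add: distrib_right)
  then have e1_le: "C * e1 + e1 = e" using C(1) by (simp add: e1_def)
  show ?thesis
    using eigenvector_approximation[OF lim e1]
  proof eventually_elim
    case (elim \<epsilon>)
    note approx = elim
    show ?case
    proof (intro allI impI)
      fix \<psi>
      assume "normalized \<epsilon> (lam \<epsilon>) \<psi>"
      then have eig: "eigen \<epsilon> (lam \<epsilon>) \<psi>" and \<psi>_le: "\<forall>j\<in>{1..n}. cmod (\<psi> (m j)) \<le> 1"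
        and \<psi>_att: "\<exists>j\<in>{1..n}. cmod (\<psi> (m j)) = 1"
        unfolding normalized_eigvec_Qe_iff by blast+
      define c where "c = \<psi> (m i0) / \<psi>Q i0"
      define v where "v k = \<psi> (m k) - c * \<psi>Q k" for k
      have v0: "v i0 = 0" using \<psi>Q0 by (simp add: v_def c_def)
      have "cmod (\<Sum>k\<in>{1..n} - {i0}. A j k * v k) \<le> e1" if j: "j \<in> {1..n}" for j
      proof -
        have "(\<Sum>k\<in>{1..n} - {i0}. A j k * v k) = (\<Sum>k=1..n. A j k * \<psi> (m k)) - c * (\<Sum>k=1..n. A j k * \<psi>Q k)"
          unfolding A_sum0[of v, OF v0] by (simp add: v_def algebra_simps sum_subtractf sum_distrib_left)
        also have "\<dots> = limit_gen (at_minima \<psi>) j - \<mu> * \<psi> (m j)"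
          using A_sum[OF j, of "\<lambda>k. \<psi> (m k)"] A_sum[OF j, of \<psi>Q] \<psi>Q_eig[OF j] by simp
        finally show ?thesis using approx eig \<psi>_le j by simp
      qed
      then have "cmod (v k) \<le> C * e1" if "k \<in> {1..n} - {i0}" for k
        using C(2)[of v e1 k] e1 that by simp
      then have v_le: "cmod (v k) \<le> C * e1" if "k \<in> {1..n}" for k
        using v0 C(1) e1 that by (cases "k = i0") auto
      have "cmod (\<psi> x - c * \<psi>Q (well_index x)) \<le> e" if x: "x \<in> S" for x
      proof -
        have "cmod (\<psi> x - \<psi> (m (well_index x))) \<le> e1"
          using approx eig \<psi>_le x by (simp add: bottom_def)
        moreover have "cmod (v (well_index x)) \<le> C * e1" using v_le well_index[OF x] by simp
        moreover have eq: "\<psi> x - c * \<psi>Q (well_index x) = v (well_index x) + (\<psi> x - \<psi> (m (well_index x)))"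
          by (simp add: v_def)
        ultimately show ?thesis
          using norm_triangle_ineq[of "v (well_index x)" "\<psi> x - \<psi> (m (well_index x))"] e1_le
          unfolding eq by linarith
      qed
      moreover have "\<bar>cmod c - 1\<bar> \<le> e"
      proof -
        obtain k where k: "k \<in> {1..n}" "cmod (\<psi>Q k) = 1" using \<psi>Q_att by blast
        have "cmod c = cmod (\<psi> (m k) - v k)" using k by (simp add: v_def norm_mult)
        also have "\<dots> \<le> 1 + C * e1"
          using norm_triangle_ineq4[of "\<psi> (m k)" "v k"] \<psi>_le k v_le[of k] by fastforce
        finally have upper: "cmod c \<le> 1 + C * e1" .
        obtain l where l: "l \<in> {1..n}" "cmod (\<psi> (m l)) = 1" using \<psi>_att by blast
        have "1 = cmod (c * \<psi>Q l + v l)" using l by (simp add: v_def)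
        also have "\<dots> \<le> cmod c * cmod (\<psi>Q l) + C * e1"
          using norm_triangle_ineq[of "c * \<psi>Q l" "v l"] v_le[OF l(1)] by (simp add: norm_mult)
        also have "cmod c * cmod (\<psi>Q l) \<le> cmod c" using \<psi>Q_le[OF l(1)] by (intro mult_left_le) auto
        finally show ?thesis using upper e1_le e1 by linarith
      qed
      ultimately show "\<bar>cmod (\<psi> (m i0) / \<psi>Q i0) - 1\<bar> \<le> e \<and>
       (\<forall>x\<in>S. cmod (\<psi> x - \<psi> (m i0) / \<psi>Q i0 * \<psi>Q (well_index x)) \<le> e)"
        unfolding c_def by blast
    qed
  qed
qed

text \<open>Maximum principle: off the diagonal \<open>Q\<close> is nonnegative and its rows sum to zero, so \<open>Re (Q u) \<le> 0\<close> at a maximum of \<open>Re u\<close>; this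
excludes \<open>Q u = \<one>\<close>.\<close>

lemma Q_const_image_zero:
  assumes eq: "\<And>j. j \<in> {1..n} \<Longrightarrow> limit_gen w j = t"
  shows "t = 0"
proof (rule ccontr)
  assume t: "t \<noteq> 0"
  define u where "u k = Re (w k / t)" for k
  have Qu: "(\<Sum>k=1..n. Q j k * u k) = 1" if "j \<in> {1..n}" for j
  proof -
    have "(\<Sum>k=1..n. complex_of_real (Q j k) * (w k / t)) = 1"
      using eq[OF that] t by (simp add: sum_divide_distrib[symmetric])
    then have "Re (\<Sum>k=1..n. complex_of_real (Q j k) * (w k / t)) = 1" by simp
    then show ?thesis by (simp only: Re_sum u_def Re_complex_of_real times_complex.sel Im_complex_of_real) simp
  qed
  have "Max (u ` {1..n}) \<in> u ` {1..n}" using n_ge by (intro Max_in) auto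
  then obtain j where j: "j \<in> {1..n}" "u j = Max (u ` {1..n})" by auto
  then have u_le: "u k \<le> u j" if "k \<in> {1..n}" for k using that by simp
  have "(\<Sum>k=1..n. Q j k * u k) = (\<Sum>k=1..n. Q j k * (u k - u j)) + (\<Sum>k=1..n. Q j k) * u j"
    by (simp add: algebra_simps sum_subtractf sum_distrib_left)
  also have "\<dots> = (\<Sum>k=1..n. Q j k * (u k - u j))" using Q_row_sum[OF j(1)] by simp
  also have "\<dots> \<le> 0"
  proof (rule sum_nonpos)
    fix k assume k: "k \<in> {1..n}"
    show "Q j k * (u k - u j) \<le> 0"
    proof (cases "j = k")
      case False
      then have "Q j k \<ge> 0" by (simp add: Q_entry_def)
      then show ?thesis using u_le[OF k] by (simp add: mult_nonneg_nonpos)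
    qed simp
  qed
  finally show False using Qu[OF j(1)] by simp
qed

text \<open>Subtracting the constant \<open>\<psi> (m i0)\<close> from an eigenvector gives \<open>w\<close> with \<open>Q\<^sup>\<epsilon> w = \<lambda> w + t\<close>, where \<open>t = \<lambda> \<psi> (m i0)\<close> is constant. In
the limit, \<open>(w, t) \<mapsto> Q w - t\<close> is injective on vectors vanishing at \<open>i0\<close>: the maximum principle gives \<open>t = 0\<close> and then
simplicity gives \<open>w = 0\<close>. Being bounded below, this map admits only \<open>w = 0\<close> and \<open>t = 0\<close> for small \<open>\<epsilon>\<close>. Then
\<open>\<psi>\<close> is a nonzero constant and \<open>\<lambda> = 0\<close>.\<close>

lemma eigenvalue_near_zero_is_zero:
  assumes lim: "(lam \<longlongrightarrow> 0) (at_right 0)"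
    and eigenvalue: "\<forall>\<^sub>F \<epsilon> in at_right 0. eigenvalue (mat_on S (Qe \<epsilon>)) (lam \<epsilon>)"
    and pivot: "pivot 0 i0"
  shows "\<forall>\<^sub>F \<epsilon> in at_right 0. lam \<epsilon> = 0"
proof -
  note i0 = pivotD(1)[OF pivot] and inj = pivotD(2)[OF pivot]
  \<comment> \<open>Column \<open>i0\<close>, which is idle on vectors vanishing there, carries the unknown \<open>t\<close>.\<close>
  define A where "A j k = (if k = i0 then - 1 else complex_of_real (Q j k))" for j k
  have A_sum: "(\<Sum>k=1..n. A j k * v k) = limit_gen (v(i0 := 0)) j - v i0" for j v
  proof -
    have "(\<Sum>k=1..n. A j k * v k) = (\<Sum>k=1..n. complex_of_real (Q j k) * (v(i0 := 0)) k - (if k = i0 then v k else 0))"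
      by (intro sum.cong) (auto simp: A_def)
    then show ?thesis using i0 by (simp add: sum_subtractf)
  qed
  have A_inj: "\<forall>k\<in>{1..n}. v k = 0" if v: "\<forall>j\<in>{1..n}. (\<Sum>k=1..n. A j k * v k) = 0" for v
  proof -
    have Qv: "limit_gen (v(i0 := 0)) j = v i0" if "j \<in> {1..n}" for j
      using v that A_sum by simp
    then have v0: "v i0 = 0" by (rule Q_const_image_zero)
    then have "\<forall>j\<in>{1..n}. (v(i0 := 0)) j = 0"
      using Qv by (intro inj) auto
    then show ?thesis using v0 by (metis fun_upd_triv)
  qed
  obtain C where C: "C > 0" "\<And>v B k. (\<And>j. j \<in> {1..n} \<Longrightarrow> cmod (\<Sum>k=1..n. A j k * v k) \<le> B) \<Longrightarrow> 0 \<le> B \<Longrightarrow>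
      k \<in> {1..n} \<Longrightarrow> cmod (v k) \<le> C * B"
    using injective_imp_bounded_below[of "{1..n}" "{1..n}" A] A_inj by blast
  \<comment> \<open>The estimates below give \<open>B \<le> (4 * C + 1) * e * B\<close>, and this choice turns it into \<open>B \<le> B / 2\<close>.\<close>
  define e where "e = 1 / (2 * (4 * C + 1))"
  have e: "e > 0" "(4 * C + 1) * e = 1 / 2" using C by (simp_all add: e_def field_simps)
  have e_le: "e \<le> 1" using C by (simp add: e_def field_simps)
  have ev: "\<forall>\<^sub>F \<epsilon> in at_right 0. cmod (lam \<epsilon>) < e"
    using tendstoD[OF lim e(1)] by simp
  show ?thesis
    using eventually_at_right_less[of 0] ev eigenvalue generator_reduction[OF e(1)]
  proof eventually_elim
    case (elim \<epsilon>)
    have red: "\<And>w B. (\<forall>x\<in>S. cmod (w x) \<le> B) \<Longrightarrow>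
       (\<forall>x\<in>S. cmod (gen \<epsilon> w x) \<le> B) \<Longrightarrow>
       (\<forall>x\<in>S. cmod (w x - w (bottom x)) \<le> e * B) \<and>
       (\<forall>j\<in>{1..n}. cmod (gen \<epsilon> w (m j)
          - limit_gen (at_minima w) j) \<le> e * B)"
      using elim(4) by blast
    obtain \<psi> x1 where \<psi>: "eigen \<epsilon> (lam \<epsilon>) \<psi>" "x1 \<in> S" "\<psi> x1 \<noteq> 0"
      using eigenvalue_QeE[OF elim(3)] by blast
    define w where "w x = \<psi> x - \<psi> (m i0)" for x
    define t where "t = lam \<epsilon> * \<psi> (m i0)"
    have Qw: "gen \<epsilon> w x = lam \<epsilon> * w x + t" if "x \<in> S" for x
      using eigen_Qe_minus_const[OF elim(1) \<psi>(1) that, of "\<psi> (m i0)"] by (simp add: w_def t_def algebra_simps)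
    define K where "K = Max ((\<lambda>x. cmod (w x)) ` S)"
    have K_ge: "cmod (w x) \<le> K" if "x \<in> S" for x unfolding K_def using that by simp
    have "K \<in> (\<lambda>x. cmod (w x)) ` S" unfolding K_def using S_nonempty by (intro Max_in) auto
    then obtain x0 where x0: "x0 \<in> S" "K = cmod (w x0)" by auto
    have K: "K \<ge> 0" using x0 by simp
    define B where "B = K + cmod t"
    have B: "B \<ge> 0" using K by (simp add: B_def)
    have lam_w: "cmod (lam \<epsilon> * w x) \<le> e * K" if "x \<in> S" for x
      unfolding norm_mult using elim(2) K_ge[OF that] e by (intro mult_mono) auto
    have eK: "e * K \<le> K" using e_le K by (rule mult_left_le_one_le[rotated -1]) (use K e in auto)
    have "\<forall>x\<in>S. cmod (w x) \<le> B" using K_ge by (auto simp: B_def intro: add_increasing2)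
    moreover have "\<forall>x\<in>S. cmod (gen \<epsilon> w x) \<le> B"
    proof
      fix x assume x: "x \<in> S"
      show "cmod (gen \<epsilon> w x) \<le> B"
        unfolding Qw[OF x] using norm_triangle_ineq[of "lam \<epsilon> * w x" t] lam_w[OF x] eK by (simp add: B_def)
    qed
    ultimately have osc: "\<forall>x\<in>S. cmod (w x - w (bottom x)) \<le> e * B"
      and lim_eq: "\<forall>j\<in>{1..n}. cmod (gen \<epsilon> w (m j)
          - limit_gen (at_minima w) j) \<le> e * B"
      using red by blast+
    define v where "v k = (if k = i0 then t else w (m k))" for k
    have v_upd: "(v(i0 := 0)) k = w (m k)" for k by (simp add: v_def w_def)
    have "cmod (\<Sum>k=1..n. A j k * v k) \<le> 2 * e * B" if j: "j \<in> {1..n}" for j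
    proof -
      have "(\<Sum>k=1..n. A j k * v k) = limit_gen (at_minima w) j - t"
        unfolding A_sum v_upd by (simp add: v_def)
      also have "\<dots> = lam \<epsilon> * w (m j) - (gen \<epsilon> w (m j) - limit_gen (at_minima w) j)"
        using Qw[OF minima_in_S[OF j]] by simp
      finally have eq: "(\<Sum>k=1..n. A j k * v k) = \<dots>" .
      have "cmod (\<Sum>k=1..n. A j k * v k) \<le> e * K + e * B"
        unfolding eq using lim_eq j
        by (intro order_trans[OF norm_triangle_ineq4 add_mono] lam_w[OF minima_in_S[OF j]]) blast
      moreover have "e * K \<le> e * B" using e by (simp add: B_def)
      ultimately show ?thesis by simp
    qed
    then have v_le: "cmod (v k) \<le> C * (2 * e * B)" if "k \<in> {1..n}" for k
      using C(2)[of v "2 * e * B" k] e B that by simp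
    have t_le: "cmod t \<le> C * (2 * e * B)" using v_le[OF i0] by (simp add: v_def)
    have "cmod (w (bottom x0)) \<le> C * (2 * e * B)"
    proof (cases "well_index x0 = i0")
      case True
      then show ?thesis using C e B by (simp add: bottom_def w_def)
    next
      case False
      then show ?thesis using v_le[of "well_index x0"] well_index[OF x0(1)] by (simp add: v_def bottom_def)
    qed
    moreover have "K \<le> cmod (w (bottom x0)) + e * B"
      using osc x0 norm_triangle_ineq2[of "w x0" "w (bottom x0)"] by fastforce
    ultimately have "B \<le> C * (2 * e * B) + e * B + C * (2 * e * B)" using t_le by (simp add: B_def)
    also have "\<dots> = (4 * C + 1) * e * B" by (simp add: algebra_simps)
    also have "\<dots> = B / 2" unfolding e(2) by simp
    finally have "B = 0" using B by simp
    then have "K = 0" "t = 0" using K by (auto simp: B_def add_nonneg_eq_0_iff)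
    then have "\<psi> x1 = \<psi> (m i0)" using K_ge[OF \<psi>(2)] by (simp add: w_def)
    then show "lam \<epsilon> = 0" using \<open>t = 0\<close> \<psi>(3) by (simp add: t_def)
  qed
qed

lemma sum_indicator_wells:
  assumes "x \<in> S"
  shows "(\<Sum>j=1..n. f j * indicator (W j) x) = (f (well_index x) :: complex)"
proof -
  have "(\<Sum>j=1..n. f j * indicator (W j) x) = (\<Sum>j=1..n. if j = well_index x then f j else 0)"
    using assms by (intro sum.cong) (auto simp: well_eq indicator_def)
  then show ?thesis using well_index[OF assms] by simp
qed

lemma normalized_eigenvector_exists:
  assumes lim: "(lam \<longlongrightarrow> \<mu>) (at_right 0)"
    and eigenvalue: "\<forall>\<^sub>F \<epsilon> in at_right 0. eigenvalue (mat_on S (Qe \<epsilon>)) (lam \<epsilon>)"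
  shows "\<forall>\<^sub>F \<epsilon> in at_right 0. \<exists>\<psi>. normalized \<epsilon> (lam \<epsilon>) \<psi>"
  using eigenvalue eigenvector_bounded_by_minima[OF lim]
proof eventually_elim
  case (elim \<epsilon>)
  obtain w x where w: "eigen \<epsilon> (lam \<epsilon>) w" "x \<in> S" "w x \<noteq> 0"
    using eigenvalue_QeE[OF elim(1)] by blast
  show ?case using normalizable[OF elim(2) w] by blast
qed

text \<open>A combination of two eigenvectors that vanishes at \<open>m i0\<close> is zero: otherwise it could be normalized, and normalized eigenvectors
have a value at \<open>m i0\<close> close in modulus to that of \<open>\<psi>Q\<close>, which is not zero.\<close>

lemma normalized_eigenvector_unique:
  assumes lim: "(lam \<longlongrightarrow> \<mu>) (at_right 0)"
    and pivot: "pivot \<mu> i0"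
    and \<psi>Q: "normalized_eigvec {1..n} {1..n} Q \<mu> \<psi>Q"
  shows "\<forall>\<^sub>F \<epsilon> in at_right 0. \<forall>\<psi> \<psi>'. normalized \<epsilon> (lam \<epsilon>) \<psi> \<longrightarrow>
     normalized \<epsilon> (lam \<epsilon>) \<psi>' \<longrightarrow> (\<exists>c. cmod c = 1 \<and> (\<forall>x\<in>S. \<psi>' x = c * \<psi> x))"
proof -
  have half: "(1 / 2 :: real) > 0" by simp
  have "\<forall>\<^sub>F \<epsilon> in at_right 0. \<forall>\<psi>. normalized \<epsilon> (lam \<epsilon>) \<psi> \<longrightarrow> \<psi> (m i0) \<noteq> 0"
    using normalized_eigenvector_limit[OF lim pivot \<psi>Q half]
  proof (rule eventually_mono, intro allI impI notI)
    fix \<epsilon> and \<psi> :: "real \<Rightarrow> complex"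
    assume lim: "\<forall>\<psi>. normalized \<epsilon> (lam \<epsilon>) \<psi> \<longrightarrow>
       \<bar>cmod (\<psi> (m i0) / \<psi>Q i0) - 1\<bar> \<le> 1 / 2 \<and>
       (\<forall>x\<in>S. cmod (\<psi> x - \<psi> (m i0) / \<psi>Q i0 * \<psi>Q (well_index x)) \<le> 1 / 2)"
      and "normalized \<epsilon> (lam \<epsilon>) \<psi>" "\<psi> (m i0) = 0"
    from mp[OF spec[OF lim] this(2)] this(3) show False by simp
  qed
  then show ?thesis
    using eigenvector_bounded_by_minima[OF lim]
  proof (eventually_elim, intro allI impI)
    fix \<epsilon> and \<psi> \<psi>' :: "real \<Rightarrow> complex"
    assume nz: "\<forall>\<psi>. normalized \<epsilon> (lam \<epsilon>) \<psi> \<longrightarrow> \<psi> (m i0) \<noteq> 0"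
      and bnd: "minima_dominate \<epsilon> (lam \<epsilon>)"
      and \<psi>: "normalized \<epsilon> (lam \<epsilon>) \<psi>"
      and \<psi>': "normalized \<epsilon> (lam \<epsilon>) \<psi>'"
    define c where "c = \<psi>' (m i0) / \<psi> (m i0)"
    define w where "w x = 1 * \<psi>' x + (- c) * \<psi> x" for x
    have w: "eigen \<epsilon> (lam \<epsilon>) w"
      using \<psi> \<psi>' unfolding w_def normalized_eigvec_Qe_iff by (blast intro: eigen_linear)
    have w0: "w (m i0) = 0" using nz \<psi> by (simp add: w_def c_def)
    have "w x = 0" if x: "x \<in> S" for x
    proof (rule ccontr)
      assume "w x \<noteq> 0"
      then obtain q where "normalized \<epsilon> (lam \<epsilon>) (\<lambda>x. q * w x)"
        using normalizable[OF bnd w x] by blast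
      then show False using nz w0 by force
    qed
    then have proportional: "\<forall>x\<in>S. \<psi>' x = c * \<psi> x" by (simp add: w_def)
    have "cmod c = 1"
    proof (rule antisym)
      obtain j where "j \<in> {1..n}" "cmod (\<psi> (m j)) = 1"
        using \<psi> unfolding normalized_eigvec_Qe_iff by blast
      then show "cmod c \<le> 1"
        using \<psi>' proportional minima_in_S unfolding normalized_eigvec_Qe_iff by (metis mult.right_neutral norm_mult)
      obtain k where k: "k \<in> {1..n}" "cmod (\<psi>' (m k)) = 1"
        using \<psi>' unfolding normalized_eigvec_Qe_iff by blast
      then have "1 = cmod c * cmod (\<psi> (m k))"
        using proportional minima_in_S[OF k(1)] by (metis norm_mult)
      also have "\<dots> \<le> cmod c"
        using \<psi> k unfolding normalized_eigvec_Qe_iff by (intro mult_left_le) auto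
      finally show "1 \<le> cmod c" .
    qed
    with proportional show "\<exists>c. cmod c = 1 \<and> (\<forall>x\<in>S. \<psi>' x = c * \<psi> x)" by blast
  qed
qed

text \<open>The phase \<open>\<sigma>\<close> undoes the phase of the factor \<open>c\<close> between \<open>\<psi>\<close> and \<open>\<psi>Q\<close>; for real vectors it is a sign.\<close>

lemma normalized_eigenvector_convergence:
  assumes lim: "(lam \<longlongrightarrow> \<mu>) (at_right 0)"
    and pivot: "pivot \<mu> i0"
    and \<psi>Q: "normalized_eigvec {1..n} {1..n} Q \<mu> \<psi>Q"
    and \<psi>: "\<forall>\<^sub>F \<epsilon> in at_right 0. normalized \<epsilon> (lam \<epsilon>) (\<psi> \<epsilon>)"
  shows "\<exists>\<sigma>. (\<forall>\<epsilon>. cmod (\<sigma> \<epsilon>) = 1 \<and>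
                ((\<forall>j\<in>{1..n}. \<psi>Q j \<in> \<real>) \<and> (\<forall>x\<in>S. \<psi> \<epsilon> x \<in> \<real>) \<longrightarrow> \<sigma> \<epsilon> \<in> {1, - 1})) \<and>
             ((\<lambda>\<epsilon>. Max ((\<lambda>x. cmod (\<sigma> \<epsilon> * \<psi> \<epsilon> x - (\<Sum>j=1..n. \<psi>Q j * indicator (W j) x))) ` S))
                \<longlongrightarrow> 0) (at_right 0)"
proof -
  note i0 = pivotD(1)[OF pivot]
  define c where "c \<epsilon> = \<psi> \<epsilon> (m i0) / \<psi>Q i0" for \<epsilon>
  define \<sigma> where "\<sigma> \<epsilon> = (if c \<epsilon> = 0 then 1 else cnj (sgn (c \<epsilon>)))" for \<epsilon>
  have \<sigma>1: "cmod (\<sigma> \<epsilon>) = 1" for \<epsilon> by (simp add: \<sigma>_def norm_sgn)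
  have \<sigma>c: "\<sigma> \<epsilon> * c \<epsilon> = complex_of_real (cmod (c \<epsilon>))" for \<epsilon>
  proof (cases "c \<epsilon> = 0")
    case False
    have "cnj (c \<epsilon>) * c \<epsilon> = complex_of_real (cmod (c \<epsilon>)) ^ 2"
      using complex_norm_square[of "c \<epsilon>"] by (simp add: mult.commute)
    then show ?thesis using False by (simp add: \<sigma>_def sgn_eq power2_eq_square)
  qed (simp add: \<sigma>_def)
  have \<sigma>_real: "\<sigma> \<epsilon> \<in> {1, - 1}" if "\<forall>j\<in>{1..n}. \<psi>Q j \<in> \<real>" "\<forall>x\<in>S. \<psi> \<epsilon> x \<in> \<real>" for \<epsilon>
  proof -
    have "c \<epsilon> \<in> \<real>" unfolding c_def using that i0 minima_in_S[OF i0] by (intro Reals_divide) auto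
    then obtain r where "c \<epsilon> = complex_of_real r" by (auto elim: Reals_cases)
    then show ?thesis by (auto simp: \<sigma>_def sgn_of_real sgn_real_def)
  qed
  let ?d = "\<lambda>\<epsilon> x. cmod (\<sigma> \<epsilon> * \<psi> \<epsilon> x - (\<Sum>j=1..n. \<psi>Q j * indicator (W j) x))"
  have ne: "{1..n} \<noteq> {}" using n_ge by simp
  have \<psi>Q_le: "cmod (\<psi>Q j) \<le> 1" if "j \<in> {1..n}" for j
    using \<psi>Q that unfolding normalized_eigvec_def Max_image_eq_1_iff[OF finite_atLeastAtMost ne] by blast
  have "((\<lambda>\<epsilon>. Max (?d \<epsilon> ` S)) \<longlongrightarrow> 0) (at_right 0)"
  proof (rule tendstoI)
    fix e :: real assume "e > 0"
    then have e3: "e / 3 > 0" by simp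
    show "\<forall>\<^sub>F \<epsilon> in at_right 0. dist (Max (?d \<epsilon> ` S)) 0 < e"
      using \<psi> normalized_eigenvector_limit[OF lim pivot \<psi>Q e3]
    proof eventually_elim
      case (elim \<epsilon>)
      have c1: "\<bar>cmod (c \<epsilon>) - 1\<bar> \<le> e / 3"
        and cx: "\<And>x. x \<in> S \<Longrightarrow> cmod (\<psi> \<epsilon> x - c \<epsilon> * \<psi>Q (well_index x)) \<le> e / 3"
        using mp[OF spec[OF elim(2), of "\<psi> \<epsilon>"] elim(1)] unfolding c_def by blast+
      have "?d \<epsilon> x < e" if x: "x \<in> S" for x
      proof -
        let ?q = "\<psi>Q (well_index x)"
        have eq: "\<sigma> \<epsilon> * \<psi> \<epsilon> x - (\<Sum>j=1..n. \<psi>Q j * indicator (W j) x)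
            = \<sigma> \<epsilon> * (\<psi> \<epsilon> x - c \<epsilon> * ?q) + (complex_of_real (cmod (c \<epsilon>)) - 1) * ?q"
          unfolding sum_indicator_wells[OF x] \<sigma>c[symmetric] by (simp add: algebra_simps)
        have "cmod (complex_of_real (cmod (c \<epsilon>)) - 1) \<le> e / 3"
          using c1 by (metis norm_of_real of_real_1 of_real_diff)
        then have "cmod ((complex_of_real (cmod (c \<epsilon>)) - 1) * ?q) \<le> e / 3 * 1"
          unfolding norm_mult using \<psi>Q_le well_index[OF x] e3 by (intro mult_mono) auto
        moreover have "cmod (\<sigma> \<epsilon> * (\<psi> \<epsilon> x - c \<epsilon> * ?q)) \<le> e / 3"
          using cx[OF x] by (simp add: norm_mult \<sigma>1)
        ultimately show ?thesis
          unfolding eq using norm_triangle_ineq[of "\<sigma> \<epsilon> * (\<psi> \<epsilon> x - c \<epsilon> * ?q)" "(complex_of_real (cmod (c \<epsilon>)) - 1) * ?q"] \<open>e > 0\<close>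
          by linarith
      qed
      then have "Max (?d \<epsilon> ` S) < e"
        using S_nonempty by (subst Max_less_iff) auto
      moreover have "0 \<le> Max (?d \<epsilon> ` S)"
        using Min_Max_in_S(1) by (subst Max_ge_iff) auto
      ultimately show ?case by (simp add: dist_real_def)
    qed
  qed
  then show ?thesis using \<sigma>1 \<sigma>_real by (intro exI[of _ \<sigma>]) blast
qed

end

theorem theorem2p4:
  fixes U :: "real \<Rightarrow> real" and n :: nat and m s :: "nat \<Rightarrow> real"
    and \<alpha> :: real and M :: "'a measure" and L :: "'a \<Rightarrow> real"
    and R h \<delta> :: real and S :: "real set" and a b :: "real \<Rightarrow> real"
    and lamQ :: "nat \<Rightarrow> complex" and lam :: "nat \<Rightarrow> real \<Rightarrow> complex"
    and i :: nat and \<psi>Q :: "nat \<Rightarrow> complex"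
  defines "Q \<equiv> Q_entry \<alpha> n m s"
    and "Qe \<equiv> Q_eps \<alpha> M L U h S a b"
    and "minima \<equiv> m ` {1..n}"
  assumes potential: "multiwell_potential U n m s"
    and alpha: "0 < \<alpha>" "\<alpha> < 2"
    and noise: "symmetric_stable_rv \<alpha> M L"
    and discretization: "discretization U n m s R h \<delta> S a b"
    and no_saddle_hit: "\<forall>x\<in>S. \<forall>j\<in>{1..<n}. x - h * deriv U x \<noteq> s j"
    and eigenvalues_Q: "char_poly (mat_on {1..n} Q) = (\<Prod>k=1..n. [:- lamQ k, 1:])" "lamQ 1 = 0"
    and real_simple: "\<forall>k\<in>{1..n}. lamQ k \<in> \<real> \<and>
                        Polynomial.order (lamQ k) (char_poly (mat_on {1..n} Q)) = 1"
    and eigenvalues_Qe: "\<forall>k\<in>{1..n}. (\<forall>\<^sub>F \<epsilon> in at_right 0. eigenvalue (mat_on S (Qe \<epsilon>)) (lam k \<epsilon>)) \<and>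
                           (lam k \<longlongrightarrow> lamQ k) (at_right 0)"
    and i: "i \<in> {1..n}"
    and \<psi>Q: "normalized_eigvec {1..n} {1..n} Q (lamQ i) \<psi>Q"
  shows
    "(\<forall>\<^sub>F \<epsilon> in at_right 0.
        (\<exists>\<psi>. normalized_eigvec S minima (Qe \<epsilon>) (lam i \<epsilon>) \<psi>) \<and>
        (\<forall>\<psi> \<psi>'. normalized_eigvec S minima (Qe \<epsilon>) (lam i \<epsilon>) \<psi> \<longrightarrow>
                 normalized_eigvec S minima (Qe \<epsilon>) (lam i \<epsilon>) \<psi>' \<longrightarrow>
                 (\<exists>c. cmod c = 1 \<and> (\<forall>x\<in>S. \<psi>' x = c * \<psi> x)))) \<and>
     (\<forall>\<psi>. (\<forall>\<^sub>F \<epsilon> in at_right 0. normalized_eigvec S minima (Qe \<epsilon>) (lam i \<epsilon>) (\<psi> \<epsilon>)) \<longrightarrow>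
        (\<exists>\<sigma>. (\<forall>\<epsilon>. cmod (\<sigma> \<epsilon>) = 1 \<and>
                ((\<forall>j\<in>{1..n}. \<psi>Q j \<in> \<real>) \<and> (\<forall>x\<in>S. \<psi> \<epsilon> x \<in> \<real>) \<longrightarrow> \<sigma> \<epsilon> \<in> {1, - 1})) \<and>
             ((\<lambda>\<epsilon>. Max ((\<lambda>x. cmod (\<sigma> \<epsilon> * \<psi> \<epsilon> x - (\<Sum>j=1..n. \<psi>Q j * indicator (well n s S j) x))) ` S))
                \<longlongrightarrow> 0) (at_right 0))) \<and>
     (\<forall>\<^sub>F \<epsilon> in at_right 0. lam 1 \<epsilon> = 0) \<and>
     (\<forall>\<epsilon>>0. \<forall>\<psi>. normalized_eigvec S minima (Qe \<epsilon>) 0 \<psi> \<longleftrightarrow>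
                 (\<exists>c. cmod c = 1 \<and> (\<forall>x\<in>S. \<psi> x = c)))"
proof -
  interpret perturbed_chain \<alpha> M L U n m s R h \<delta> S a b
    using alpha noise potential discretization no_saddle_hit
    by (intro perturbed_chain.intro stable_noise.intro discretized_potential.intro)
  have pivot_ex: "\<exists>i0. pivot (lamQ k) i0" if "k \<in> {1..n}" for k
    using real_simple that unfolding Q_def by (intro simple_root_pivot) blast
  have lim: "(lam k \<longlongrightarrow> lamQ k) (at_right 0)"
    and ev: "\<forall>\<^sub>F \<epsilon> in at_right 0. eigenvalue (mat_on S (Qe \<epsilon>)) (lam k \<epsilon>)" if "k \<in> {1..n}" for k
    using eigenvalues_Qe that by blast+
  obtain i0 where i0: "pivot (lamQ i) i0" using pivot_ex[OF i] by blast
  note limit_facts = lim[OF i] i0 \<psi>Q[unfolded Q_def]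
  have one: "1 \<in> {1..n}" using i by simp
  obtain l0 where l0: "pivot 0 l0" using pivot_ex[OF one] unfolding eigenvalues_Q(2) by blast
  show ?thesis
  proof (intro conjI)
    show "\<forall>\<^sub>F \<epsilon> in at_right 0.
        (\<exists>\<psi>. normalized_eigvec S minima (Qe \<epsilon>) (lam i \<epsilon>) \<psi>) \<and>
        (\<forall>\<psi> \<psi>'. normalized_eigvec S minima (Qe \<epsilon>) (lam i \<epsilon>) \<psi> \<longrightarrow>
                 normalized_eigvec S minima (Qe \<epsilon>) (lam i \<epsilon>) \<psi>' \<longrightarrow>
                 (\<exists>c. cmod c = 1 \<and> (\<forall>x\<in>S. \<psi>' x = c * \<psi> x)))"
      unfolding minima_def Qe_def
      by (intro eventually_conj normalized_eigenvector_exists[OF lim[OF i] ev[OF i, unfolded Qe_def]]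
          normalized_eigenvector_unique[OF limit_facts])
    show "\<forall>\<psi>. (\<forall>\<^sub>F \<epsilon> in at_right 0. normalized_eigvec S minima (Qe \<epsilon>) (lam i \<epsilon>) (\<psi> \<epsilon>)) \<longrightarrow>
        (\<exists>\<sigma>. (\<forall>\<epsilon>. cmod (\<sigma> \<epsilon>) = 1 \<and>
                ((\<forall>j\<in>{1..n}. \<psi>Q j \<in> \<real>) \<and> (\<forall>x\<in>S. \<psi> \<epsilon> x \<in> \<real>) \<longrightarrow> \<sigma> \<epsilon> \<in> {1, - 1})) \<and>
             ((\<lambda>\<epsilon>. Max ((\<lambda>x. cmod (\<sigma> \<epsilon> * \<psi> \<epsilon> x - (\<Sum>j=1..n. \<psi>Q j * indicator (well n s S j) x))) ` S))
                \<longlongrightarrow> 0) (at_right 0))"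
      unfolding minima_def Qe_def
      by (intro allI impI normalized_eigenvector_convergence[OF limit_facts])
    show "\<forall>\<^sub>F \<epsilon> in at_right 0. lam 1 \<epsilon> = 0"
      using eigenvalue_near_zero_is_zero[OF lim[OF one, unfolded eigenvalues_Q(2)] ev[OF one, unfolded Qe_def] l0] .
    show "\<forall>\<epsilon>>0. \<forall>\<psi>. normalized_eigvec S minima (Qe \<epsilon>) 0 \<psi> \<longleftrightarrow>
                 (\<exists>c. cmod c = 1 \<and> (\<forall>x\<in>S. \<psi> x = c))"
      unfolding minima_def Qe_def using zero_eigenvectors by blast
  qed
qed

end
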